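(* Let $m_{ODRF,B,n}$ be the oblique-decision-tree-based random forest estimator with $B\ge1$ random ODTs, each grown on a subsample of size $a_n$ and having $t_n$ leaves, as defined in the context. Assume $\mathbf E(e^{cY^2})<\infty$ for some $c>0$ and that $m(X)$ is $L^2$ integrable. If $a_n\to\infty$, $t_n\to\infty$ and $t_n=o\left(\frac{a_n}{\ln^4 a_n}\right)$, then $$\mathbf E\left(\int|m_{ODRF,B,n}(x)-m(x)|^2\,d\mu(x)\right)\to0\quad\text{as }n\to\infty,$$ where the expectation is over the data $\mathcal D_n$ and all the random seeds used to build the trees.
   Context: **Setting.** $p\ge1$ is fixed, $X$ is a random vector in $[0,1]^p$ with distribution $\mu$, $Y$ is a real random variable, $m(x)=\mathbf E(Y\mid X=x)$, and $\mathcal D_n=\{(X_i,Y_i)\}_{i=1}^n$ are i.i.d. copies of $(X,Y)$. "$m(X)$ is $L^2$ integrable" means $\mathbf E(m(X)^2)<\infty$. $\Theta^q$ is the unit sphere $\{\theta\in\mathbb R^q:\|\theta\|_2=1\}$. For $\mathcal S\subseteq\{1,\dots,p\}$, $x_{\mathcal S}$ is the subvector of $x$ with coordinates in $\mathcal S$. **Random ODT.** Let $\mathfrak G$ be a uniformly random subset of $\{1,\dots,n\}$ of size $a_n\le n$ (subsampling without replacement); only the data $(X_i,Y_i)$, $i\in\mathfrak G$, are used. For $A\subseteq[0,1]^p$ let $N(A)=\#\{i\in\mathfrak G:X_i\in A\}$ and let $\bar Y_A$ be the mean of $Y_i$ over $i\in\mathfrak G$ with $X_i\in A$ ($0$ if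 there are none). Let $\mathcal S_1,\mathcal S_2,\dots,\mathcal S_{t_n-1}$ be i.i.d. random nonempty subsets of $\{1,\dots,p\}$, independent of the data, with $\mathbf P(\mathcal S)=\frac1p\binom{p}{\mathrm{Card}(\mathcal S)}^{-1}$ (choose $q$ uniformly in $\{1,\dots,p\}$, then a uniform subset of size $q$). For a nonempty $\mathcal S$ with $\mathrm{Card}(\mathcal S)=q$, $\theta\in\Theta^q$, $s\in\mathbb R$, let $A^+=\{x\in A:\theta^Tx_{\mathcal S}\le s\}$, $A^-=\{x\in A:\theta^Tx_{\mathcal S}>s\}$ and $$\Delta_{A,q}(\theta,s)=\frac1{N(A)}\Big[\sum_{X_i\in A}(Y_i-\bar Y_A)^2-\sum_{X_i\in A^+}(Y_i-\bar Y_{A^+})^2-\sum_{X_i\in A^-}(Y_i-\bar Y_{A^-})^2\Big]$$ (sums over $i\in\mathfrak G$). Starting from layer $0$ consisting of the node $[0,1]^p$, the nodes of the current layer are processed one after another: a node with at most one data point is passed unchanged to the next layer; a node $A$ with at least two data points is split, and if this is the $\tau$-th split it is split into $A^+,A^-$ using $\mathcal S=\mathcal S_\tau$ and a maximizer $(\hat\theta_A,\hat s_A)$ of $\Delta_{A,q}$ over $\Theta^{q}\times\mathbb R$, $q=\mathrm{Card}(\mathcal S_\tau)$; the daughters are put in the next layer. When a layer is exhausted one moves to the next; one stops as soon as there are $t_n$ leaves ($t_n\le a_n$). The random ODT estimator $m^r_{n,a_n,t_n,\mathcal L}(x)$ equals $\bar Y_{A}$ where $A$ is the leaf containing $x$.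 **Forest.** $m_{ODRF,B,n}(x)=\frac1B\sum_{b=1}^Bm^{r,b}_{n,a_n,t_n,\mathcal L}(x)$, where the $m^{r,b}$, $b=1,\dots,B$, are built from the same $\mathcal D_n$ with independent copies of the random seeds (subsample and feature subsets). *)

theory Defs
  imports "HOL-Probability.Probability"
begin

section \<open>Oblique decision trees and random forests built from them\<close>

text \<open>A sample maps the index \<open>i\<close> to the observation \<open>(X\<^sub>i, Y\<^sub>i)\<close>. The dimension \<open>p\<close> of the
  feature space is \<open>CARD('p)\<close>; \<open>G\<close> always denotes the set of subsampled indices.\<close>

type_synonym 'p sample = "nat \<Rightarrow> (real^'p) \<times> real"

definition node_points :: "'p::finite sample \<Rightarrow> nat set \<Rightarrow> (real^'p) set \<Rightarrow> nat set" where
  "node_points D G A = {i \<in> G. fst (D i) \<in> A}"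

definition node_count :: "'p::finite sample \<Rightarrow> nat set \<Rightarrow> (real^'p) set \<Rightarrow> nat" where
  "node_count D G A = card (node_points D G A)"

text \<open>The mean over a node without data points is \<open>0\<close>, because \<open>0 / 0 = 0\<close>.\<close>

definition node_mean :: "'p::finite sample \<Rightarrow> nat set \<Rightarrow> (real^'p) set \<Rightarrow> real" where
  "node_mean D G A = (\<Sum>i\<in>node_points D G A. snd (D i)) / real (node_count D G A)"

definition node_sse :: "'p::finite sample \<Rightarrow> nat set \<Rightarrow> (real^'p) set \<Rightarrow> real" where
  "node_sse D G A = (\<Sum>i\<in>node_points D G A. (snd (D i) - node_mean D G A)\<^sup>2)"

text \<open>For \<open>F\<close> of cardinality \<open>q\<close>, the space \<open>\<real>\<^sup>q\<close> of vectors indexed by \<open>F\<close> is identified with the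
  vectors of \<open>real^'p\<close> that vanish outside \<open>F\<close>; the norm and the inner product are the same.
  Under this identification \<open>subvector F x\<close> is \<open>x\<close> restricted to the coordinates in \<open>F\<close>, and
  \<open>directions F\<close> is the unit sphere of \<open>\<real>\<^sup>q\<close>.\<close>

definition subvector :: "'p::finite set \<Rightarrow> real^'p \<Rightarrow> real^'p" where
  "subvector F x = (\<chi> j. if j \<in> F then x $ j else 0)"

definition directions :: "'p::finite set \<Rightarrow> (real^'p) set" where
  "directions F = {\<theta>. norm \<theta> = 1 \<and> (\<forall>j. j \<notin> F \<longrightarrow> \<theta> $ j = 0)}"

definition daughter_le :: "(real^'p::finite) set \<Rightarrow> 'p set \<Rightarrow> (real^'p) \<times> real \<Rightarrow> (real^'p) set" where
  "daughter_le A F = (\<lambda>(\<theta>, s). {x \<in> A. \<theta> \<bullet> subvector F x \<le> s})"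

definition daughter_gt :: "(real^'p::finite) set \<Rightarrow> 'p set \<Rightarrow> (real^'p) \<times> real \<Rightarrow> (real^'p) set" where
  "daughter_gt A F = (\<lambda>(\<theta>, s). {x \<in> A. \<theta> \<bullet> subvector F x > s})"

definition impurity_gain ::
  "'p::finite sample \<Rightarrow> nat set \<Rightarrow> (real^'p) set \<Rightarrow> 'p set \<Rightarrow> (real^'p) \<times> real \<Rightarrow> real" where
  "impurity_gain D G A F \<theta>s =
     (node_sse D G A - node_sse D G (daughter_le A F \<theta>s) - node_sse D G (daughter_gt A F \<theta>s))
       / real (node_count D G A)"

definition split_maximizer ::
  "'p::finite sample \<Rightarrow> nat set \<Rightarrow> (real^'p) set \<Rightarrow> 'p set \<Rightarrow> (real^'p) \<times> real \<Rightarrow> bool" where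
  "split_maximizer D G A F \<theta>s \<longleftrightarrow>
     \<theta>s \<in> directions F \<times> UNIV \<and>
     (\<forall>\<theta>s' \<in> directions F \<times> UNIV. impurity_gain D G A F \<theta>s' \<le> impurity_gain D G A F \<theta>s)"

text \<open>A maximizer is in general not unique. A split rule \<open>sel\<close> names the one to be used:
  \<open>sel \<tau> (restrict D G) G A F\<close> is the pair \<open>(\<theta>, s)\<close> for the node \<open>A\<close> when \<open>A\<close> is split in the
  \<open>\<tau>\<close>-th split with the features \<open>F\<close>; it sees the observations in \<open>G\<close> only, and no feature set
  drawn later.\<close>

type_synonym 'p split_rule =
  "nat \<Rightarrow> 'p sample \<Rightarrow> nat set \<Rightarrow> (real^'p) set \<Rightarrow> 'p set \<Rightarrow> (real^'p) \<times> real"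

text \<open>\<open>grow_layer sel D G S t As k\<close> processes the nodes \<open>As\<close> of a layer in turn when \<open>k\<close> splits have been
  made so far, so that the tree has \<open>k + 1\<close> leaves. It returns the next layer and the new number of
  splits. Once there are \<open>t\<close> leaves nothing is split any more; the nodes not yet processed are
  then carried over, so that the result is the list of all leaves.\<close>

fun grow_layer ::
  "'p::finite split_rule \<Rightarrow> 'p sample \<Rightarrow> nat set \<Rightarrow> (nat \<Rightarrow> 'p set) \<Rightarrow> nat
     \<Rightarrow> (real^'p) set list \<Rightarrow> nat \<Rightarrow> (real^'p) set list \<times> nat" where
  "grow_layer sel D G S t [] k = ([], k)"
| "grow_layer sel D G S t (A # As) k =
     (if t \<le> k + 1 \<or> node_count D G A \<le> 1
      then (let (Bs, k') = grow_layer sel D G S t As k in (A # Bs, k'))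
      else (let \<tau> = k + 1;
                \<theta>s = sel \<tau> (restrict D G) G A (S \<tau>);
                (Bs, k') = grow_layer sel D G S t As \<tau>
            in (daughter_le A (S \<tau>) \<theta>s # daughter_gt A (S \<tau>) \<theta>s # Bs, k')))"

text \<open>For data in the unit cube, as long as there are fewer than \<open>t \<le> card G\<close> leaves, some leaf contains
  two data points, so every layer contributes at least one split. Hence \<open>t\<close> rounds suffice to reach \<open>t\<close> leaves, and further
  rounds change nothing.\<close>

definition odt_leaves ::
  "'p::finite split_rule \<Rightarrow> 'p sample \<Rightarrow> nat set \<Rightarrow> (nat \<Rightarrow> 'p set) \<Rightarrow> nat \<Rightarrow> (real^'p) set list" where
  "odt_leaves sel D G S t =
     fst (((\<lambda>(As, k). grow_layer sel D G S t As k) ^^ t) ([cbox 0 1], 0))"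

text \<open>The leaves partition the unit cube; outside of it the estimator is set to \<open>0\<close>.\<close>

definition odt_estimator ::
  "'p::finite split_rule \<Rightarrow> 'p sample \<Rightarrow> nat set \<Rightarrow> (nat \<Rightarrow> 'p set) \<Rightarrow> nat \<Rightarrow> real^'p \<Rightarrow> real" where
  "odt_estimator sel D G S t x =
     (case find (\<lambda>A. x \<in> A) (odt_leaves sel D G S t) of
        None \<Rightarrow> 0
      | Some A \<Rightarrow> node_mean D G A)"

definition odrf_estimator ::
  "'p::finite split_rule \<Rightarrow> 'p sample \<Rightarrow> (nat \<Rightarrow> nat set) \<Rightarrow> (nat \<Rightarrow> nat \<Rightarrow> 'p set) \<Rightarrow> nat \<Rightarrow> nat
     \<Rightarrow> real^'p \<Rightarrow> real" where
  "odrf_estimator sel D G S t B x =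
     1 / real B * (\<Sum>b=1..B. odt_estimator sel D (G b) (S b) t x)"


section \<open>Mutual independence of the data and the seeds\<close>

text \<open>Observations, subsamples and feature sets take values in different types, so their mutual
  independence is stated through the events they generate: \<open>Obs i\<close> is the \<open>i\<close>-th
  observation, \<open>Sub b\<close> the subsample of the \<open>b\<close>-th tree and \<open>Feat b \<tau>\<close> the feature set of its
  \<open>\<tau>\<close>-th split.\<close>

datatype random_source = Obs nat | Sub nat | Feat nat nat

definition forest_sources :: "nat \<Rightarrow> nat \<Rightarrow> nat \<Rightarrow> random_source set" where
  "forest_sources n B t =
     Obs ` {1..n} \<union> Sub ` {1..B} \<union> {Feat b \<tau> | b \<tau>. b \<in> {1..B} \<and> \<tau> \<in> {1..t - 1}}"

fun source_events ::
  "'a measure \<Rightarrow> (nat \<Rightarrow> 'a \<Rightarrow> (real^'p::finite) \<times> real) \<Rightarrow> (nat \<Rightarrow> 'a \<Rightarrow> nat set)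
     \<Rightarrow> (nat \<Rightarrow> nat \<Rightarrow> 'a \<Rightarrow> 'p set) \<Rightarrow> random_source \<Rightarrow> 'a set set" where
  "source_events M Z G S (Obs i) = {Z i -` U \<inter> space M | U. U \<in> sets borel}"
| "source_events M Z G S (Sub b) = {G b -` U \<inter> space M | U. True}"
| "source_events M Z G S (Feat b \<tau>) = {S b \<tau> -` U \<inter> space M | U. True}"

end

(*
The error of a tree with estimator g is E|Y - g(X)|^2 - E|Y - m(X)|^2 for a fresh pair (X, Y). It is
compared with the error of a fixed finite combination f of halfspace indicators; these are dense in
L2(mu), because the exponentials of linear forms span an algebra (Stone-Weierstrass).

Training error: in a node A whose residual error exceeds that of f, some halfspace of f correlates with
the residuals, so a split with all features, which has probability 1/p, decreases the excess by at
least (excess of A)^2 / (N(A) V^2), where V is the total weight of f. A tree with t leaves contains at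
least log2 t complete layers, so the mean excess over f is O(V sqrt(p E Y^2 / log t)).

Generalization: only the deviation of E(g^2 - 2 Y g) from its empirical counterpart matters. It is
linear in the cell values of g and of g^2, hence a ghost sample and random swaps bound it by the
maximum of a Rademacher sum over sign patterns on the cells. There are at most exp(O(t ln a)) of them
(Sauer-Shelah for halfspaces), and since max |Y_i|^2 is O(ln a) in mean, the deviation is of order
ln a * sqrt(t ln a / a), which tends to 0.
*)
theory Submission
  imports Defs
begin

section \<open>Halfspace traces on finite point sets\<close>

text \<open>The two error bounds hold in different senses. The decrease of the training error needs
  fixed data and random feature sets, whereas the deviation bound holds for each fixed subsample and
  each fixed sequence of feature sets, in mean over the data. So everything is stated in
  expectation, and the two bounds meet only after an exchange of averages. The responses are
  unbounded, yet neither \<open>Y\<close> nor the estimator is truncated. Given the double sample,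
  the sign argument may use any bound on the responses that swaps leave unchanged; a soft maximum
  with computable mean is taken. The splits are arbitrary maximizers and the tree itself changes
  when observations are swapped. Therefore only the cells that some tree can cut on the points of
  the double sample are counted, and this one count serves all swapped samples at once. In the limit
  the approximation \<open>f\<close>, and with it \<open>V\<close>, is fixed before the number of
  layers is chosen, and both before \<open>n\<close>.\<close>

definition shatters :: "'i set set \<Rightarrow> 'i set \<Rightarrow> bool" where
  "shatters \<F> Y \<longleftrightarrow> (\<forall>T\<subseteq>Y. \<exists>F\<in>\<F>. F \<inter> Y = T)"

lemma shattersE:
  assumes "shatters \<F> Y" "T \<subseteq> Y"
  obtains F where "F \<in> \<F>" "F \<inter> Y = T"
  using assms by (auto simp: shatters_def)

text \<open>Pajor's form of the Sauer--Shelah lemma.\<close>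

lemma card_le_card_shattered:
  assumes "finite I" "\<F> \<subseteq> Pow I"
  shows "card \<F> \<le> card {Y. Y \<subseteq> I \<and> shatters \<F> Y}"
  using assms
proof (induction I arbitrary: \<F> rule: finite_induct)
  case empty
  then have "\<F> = {} \<or> \<F> = {{}}" by auto
  then show ?case
  proof
    assume "\<F> = {{}}"
    then have "{Y. Y \<subseteq> {} \<and> shatters \<F> Y} = {{}}" by (auto simp: shatters_def)
    then show ?thesis using \<open>\<F> = {{}}\<close> by simp
  qed simp
next
  case (insert x I)
  \<comment> \<open>The members avoiding \<open>x\<close>, and the traces on \<open>I\<close> of the
    members containing \<open>x\<close>. A set shattered by either is counted once; a set shattered
    by both is counted again with \<open>x\<close> added.\<close>
  define \<F>0 where "\<F>0 = {F \<in> \<F>. x \<notin> F}"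
  define \<F>1 where "\<F>1 = (\<lambda>F. F - {x}) ` {F \<in> \<F>. x \<in> F}"
  define sh where "sh \<G> = {Y. Y \<subseteq> I \<and> shatters \<G> Y}" for \<G>
  have fin: "finite \<F>" using insert.prems insert.hyps by (meson finite_Pow_iff finite_insert finite_subset)
  have sub: "\<F>0 \<subseteq> Pow I" "\<F>1 \<subseteq> Pow I"
    using insert.prems by (auto simp: \<F>0_def \<F>1_def)
  have fin_sh: "finite (sh \<G>)" for \<G>
    using insert.hyps by (auto simp: sh_def)
  have "inj_on (\<lambda>F. F - {x}) {F \<in> \<F>. x \<in> F}"
    by (intro inj_onI) (metis (mono_tags, lifting) insert_Diff mem_Collect_eq)
  then have "card \<F>1 = card {F \<in> \<F>. x \<in> F}" by (simp add: \<F>1_def card_image)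
  then have "card \<F> = card \<F>0 + card \<F>1"
    using card_Un_disjoint[of "{F \<in> \<F>. x \<notin> F}" "{F \<in> \<F>. x \<in> F}"] fin
    by (simp add: \<F>0_def disjoint_iff flip: Collect_disj_eq)
      (metis (no_types, lifting) Collect_cong Collect_mem_eq conj_disj_distribL)
  also have "\<dots> \<le> card (sh \<F>0) + card (sh \<F>1)"
    using insert.IH[OF sub(1)] insert.IH[OF sub(2)] by (simp add: sh_def)
  also have "\<dots> = card (sh \<F>0 \<union> sh \<F>1) + card (sh \<F>0 \<inter> sh \<F>1)"
    using card_Un_Int[OF fin_sh fin_sh] .
  also have "card (sh \<F>0 \<inter> sh \<F>1) = card (Set.insert x ` (sh \<F>0 \<inter> sh \<F>1))"
    using insert.hyps by (intro card_image[symmetric] inj_onI) (auto simp: sh_def)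
  also have "card (sh \<F>0 \<union> sh \<F>1) + card (Set.insert x ` (sh \<F>0 \<inter> sh \<F>1))
      = card ((sh \<F>0 \<union> sh \<F>1) \<union> Set.insert x ` (sh \<F>0 \<inter> sh \<F>1))"
    using insert.hyps fin_sh by (intro card_Un_disjoint[symmetric]) (auto simp: sh_def)
  also have "\<dots> \<le> card {Y. Y \<subseteq> Set.insert x I \<and> shatters \<F> Y}"
  proof (rule card_mono)
    have "shatters \<F> Y" if Y: "Y \<in> sh \<F>0 \<union> sh \<F>1" for Y
      unfolding shatters_def
    proof (intro allI impI)
      fix T assume T: "T \<subseteq> Y"
      have "x \<notin> Y" using Y insert.hyps by (auto simp: sh_def)
      show "\<exists>F\<in>\<F>. F \<inter> Y = T"
      proof (cases "Y \<in> sh \<F>0")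
        case True
        then have "shatters \<F>0 Y" by (simp add: sh_def)
        then obtain F where "F \<in> \<F>0" "F \<inter> Y = T" using T by (rule shattersE)
        then show ?thesis by (auto simp: \<F>0_def)
      next
        case False
        then have "shatters \<F>1 Y" using Y by (auto simp: sh_def)
        then obtain F where "F \<in> \<F>1" "F \<inter> Y = T" using T by (rule shattersE)
        then obtain F' where "F' \<in> \<F>" "F = F' - {x}" by (auto simp: \<F>1_def)
        then have "F' \<inter> Y = T" using \<open>F \<inter> Y = T\<close> \<open>x \<notin> Y\<close> by auto
        then show ?thesis using \<open>F' \<in> \<F>\<close> by auto
      qed
    qed
    moreover have "shatters \<F> (Set.insert x Y)" if Y: "Y \<in> sh \<F>0" "Y \<in> sh \<F>1" for Y
      unfolding shatters_def
    proof (intro allI impI)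
      fix T assume T: "T \<subseteq> Set.insert x Y"
      have "x \<notin> Y" using Y insert.hyps by (auto simp: sh_def)
      show "\<exists>F\<in>\<F>. F \<inter> Set.insert x Y = T"
      proof (cases "x \<in> T")
        case False
        then have "T \<subseteq> Y" using T by auto
        moreover have "shatters \<F>0 Y" using Y by (simp add: sh_def)
        ultimately obtain F where "F \<in> \<F>0" "F \<inter> Y = T" using shattersE by metis
        then show ?thesis by (intro bexI[of _ F]) (auto simp: \<F>0_def)
      next
        case True
        have "T - {x} \<subseteq> Y" using T by auto
        moreover have "shatters \<F>1 Y" using Y by (simp add: sh_def)
        ultimately obtain F where "F \<in> \<F>1" "F \<inter> Y = T - {x}" using shattersE by metis
        then obtain F' where "F' \<in> \<F>" "x \<in> F'" "F = F' - {x}" by (auto simp: \<F>1_def)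
        then have "F' \<inter> Set.insert x Y = T"
          using \<open>F \<inter> Y = T - {x}\<close> \<open>x \<notin> Y\<close> True by auto
        then show ?thesis using \<open>F' \<in> \<F>\<close> by auto
      qed
    qed
    ultimately show "(sh \<F>0 \<union> sh \<F>1) \<union> Set.insert x ` (sh \<F>0 \<inter> sh \<F>1)
        \<subseteq> {Y. Y \<subseteq> Set.insert x I \<and> shatters \<F> Y}"
      by (auto simp: sh_def)
  qed (use insert.hyps in auto)
  finally show ?case .
qed

text \<open>A set with at most \<open>d\<close> elements is read off from a list of length exactly
  \<open>d\<close> over \<open>I\<close> and one padding symbol \<open>None\<close>, whence the base
  \<open>card I + 1\<close>.\<close>

lemma card_subsets_card_le:
  assumes "finite I"
  shows "card {Y. Y \<subseteq> I \<and> card Y \<le> d} \<le> (card I + 1) ^ d"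
proof -
  define L where "L = {xs. set xs \<subseteq> Set.insert None (Some ` I) \<and> length xs = d}"
  have L: "finite L" "card L = (card I + 1) ^ d"
    using assms by (auto simp: L_def finite_lists_length_eq card_lists_length_eq card_image)
  have "Y \<in> (\<lambda>xs. Some -` set xs) ` L" if Y: "Y \<subseteq> I" "card Y \<le> d" for Y
  proof -
    obtain ys where ys: "set ys = Y" "length ys = card Y"
      using Y assms finite_distinct_list[of Y] distinct_card finite_subset by metis
    have "map Some ys @ replicate (d - card Y) None \<in> L"
      using ys Y by (auto simp: L_def)
    moreover have "Some -` set (map Some ys @ replicate (d - card Y) None) = Y"
      using ys by (auto simp: set_replicate_conv_if)
    ultimately show ?thesis by (metis image_eqI)
  qed
  then have "{Y. Y \<subseteq> I \<and> card Y \<le> d} \<subseteq> (\<lambda>xs. Some -` set xs) ` L" by auto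
  then have "card {Y. Y \<subseteq> I \<and> card Y \<le> d} \<le> card L"
    using L(1) by (meson card_image_le card_mono finite_imageI le_trans)
  then show ?thesis using L by simp
qed

text \<open>The inequality is strict because it is so in \<open>daughter_gt\<close>; the other
  daughter is the complement within the node. Neither \<open>v\<close> nor \<open>s\<close> is
  restricted, so splits on every feature set are covered.\<close>

definition halfspace_traces :: "('i \<Rightarrow> 'a::euclidean_space) \<Rightarrow> 'i set \<Rightarrow> 'i set set" where
  "halfspace_traces x I = {{i \<in> I. v \<bullet> x i > s} | v s. True}"

text \<open>Radon's theorem: any \<open>DIM('a) + 2\<close> points contain two disjoint subsets
  whose convex hulls meet, and no halfspace contains the one and avoids the other.\<close>

lemma card_halfspace_shattered_le:
  fixes x :: "'i \<Rightarrow> 'a::euclidean_space"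
  assumes "finite I" "Y \<subseteq> I" and sh: "shatters (halfspace_traces x I) Y"
  shows "card Y \<le> DIM('a) + 1"
proof (rule ccontr)
  assume large: "\<not> card Y \<le> DIM('a) + 1"
  have sep: "\<exists>v s. \<forall>i\<in>Y. (i \<in> T \<longleftrightarrow> v \<bullet> x i > s)" if "T \<subseteq> Y" for T
  proof -
    obtain F where "F \<in> halfspace_traces x I" "F \<inter> Y = T"
      by (rule shattersE[OF sh \<open>T \<subseteq> Y\<close>])
    then obtain v s where "{i \<in> I. v \<bullet> x i > s} \<inter> Y = T"
      unfolding halfspace_traces_def by blast
    then show ?thesis using assms(2) by (intro exI[of _ v] exI[of _ s]) blast
  qed
  \<comment> \<open>Radon's theorem counts points, whereas \<open>Y\<close> is a set of indices;
    shattering forces distinct indices to have distinct points.\<close>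
  have inj: "inj_on x Y"
  proof (rule inj_onI, rule ccontr)
    fix i j assume "i \<in> Y" "j \<in> Y" "x i = x j" "i \<noteq> j"
    moreover obtain v s where "\<forall>k\<in>Y. (k \<in> {i} \<longleftrightarrow> v \<bullet> x k > s)"
      using sep[of "{i}"] \<open>i \<in> Y\<close> by auto
    ultimately show False by (metis singletonD singletonI)
  qed
  have fin: "finite (x ` Y)" using assms finite_subset by blast
  have "card (x ` Y) \<ge> DIM('a) + 2" using large inj by (simp add: card_image)
  then have "affine_dependent (x ` Y)" using affine_dependent_biggerset fin by blast
  then obtain C D where CD: "C \<subseteq> x ` Y" "D \<subseteq> x ` Y" "C \<inter> D = {}"
      "convex hull C \<inter> convex hull D \<noteq> {}"
    by (rule Radon)
  obtain v s where vs: "\<forall>i\<in>Y. (i \<in> {i \<in> Y. x i \<in> C} \<longleftrightarrow> v \<bullet> x i > s)"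
    using sep[of "{i \<in> Y. x i \<in> C}"] by auto
  have "convex hull C \<subseteq> {y. v \<bullet> y > s}"
    using vs CD by (intro hull_minimal convex_halfspace_gt) auto
  moreover have "convex hull D \<subseteq> {y. v \<bullet> y \<le> s}"
    using vs CD by (intro hull_minimal convex_halfspace_le) (force simp: not_less)
  ultimately show False using CD(4) by force
qed

lemma halfspace_traces_subset: "halfspace_traces x I \<subseteq> Pow I"
  by (auto simp: halfspace_traces_def)

lemma finite_halfspace_traces: "finite I \<Longrightarrow> finite (halfspace_traces x I)"
  by (meson finite_Pow_iff finite_subset halfspace_traces_subset)

lemma card_halfspace_traces_le:
  fixes x :: "'i \<Rightarrow> 'a::euclidean_space"
  assumes "finite I"
  shows "card (halfspace_traces x I) \<le> (card I + 1) ^ (DIM('a) + 1)"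
proof -
  have "card (halfspace_traces x I) \<le> card {Y. Y \<subseteq> I \<and> shatters (halfspace_traces x I) Y}"
    by (rule card_le_card_shattered[OF assms halfspace_traces_subset])
  also have "\<dots> \<le> card {Y. Y \<subseteq> I \<and> card Y \<le> DIM('a) + 1}"
    using assms card_halfspace_shattered_le by (intro card_mono) auto
  also have "\<dots> \<le> (card I + 1) ^ (DIM('a) + 1)"
    by (rule card_subsets_card_le[OF assms])
  finally show ?thesis .
qed

section \<open>Rademacher averages of finite classes\<close>

text \<open>The fair sign in Hoeffding's lemma: for probability \<open>1/2\<close> and width
  \<open>2 * y\<close> the logarithm of the centred moment generating function is
  \<open>ln (cosh y)\<close>. The auxiliary bound asks for a nonnegative width; symmetry does the
  rest.\<close>

lemma cosh_real_le_exp: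
  fixes x :: real
  shows "cosh x \<le> exp (x\<^sup>2 / 2)"
proof -
  have *: "cosh y \<le> exp (y\<^sup>2 / 2)" if "y \<ge> 0" for y :: real
  proof -
    have "1 + 1/2 * (exp (2 * y) - 1) = exp y * cosh y"
      by (simp add: cosh_def exp_minus field_simps flip: exp_add)
    then have "ln (exp y * cosh y) \<le> y + y\<^sup>2 / 2"
      using Hoeffdings_lemma_aux[of "2 * y" "1/2"] that by (simp add: power_mult_distrib)
    then have "ln (cosh y) \<le> y\<^sup>2 / 2"
      using cosh_real_pos[of y] by (simp add: ln_mult)
    then show ?thesis using cosh_real_pos[of y] by (metis exp_le_cancel_iff exp_ln)
  qed
  show ?thesis using *[of x] *[of "-x"] by (cases "x \<ge> 0") auto
qed

text \<open>The inequality \<open>u \<le> exp u / M - 1 + ln M\<close> replaces Jensen's inequality in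
  bounding the mean of a maximum by exponential moments.\<close>

lemma le_exp_div_add_ln:
  fixes u :: real
  assumes "M > 0"
  shows "u \<le> exp u / M - 1 + ln M"
proof -
  have "1 + (u - ln M) \<le> exp (u - ln M)" by (rule exp_ge_add_one_self)
  then show ?thesis using assms by (simp add: exp_diff)
qed

text \<open>\<open>T\<close> is the set of indices with sign \<open>-1\<close>, so the left side is
  \<open>2 ^ card H\<close> times a moment generating function. Expanding a product of two-term sums
  turns it into a product of hyperbolic cosines.\<close>

lemma sum_Pow_rademacher_le:
  fixes v :: "'i \<Rightarrow> real"
  assumes "finite H" "\<And>i. i \<in> H \<Longrightarrow> \<bar>v i\<bar> \<le> K"
  shows "(\<Sum>T\<in>Pow H. exp (l * (\<Sum>i\<in>H. if i \<in> T then - v i else v i)))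
           \<le> 2 ^ card H * exp (l\<^sup>2 * K\<^sup>2 * real (card H) / 2)"
proof -
  have "(\<Sum>T\<in>Pow H. exp (l * (\<Sum>i\<in>H. if i \<in> T then - v i else v i)))
      = (\<Sum>T\<in>Pow H. (\<Prod>i\<in>T. exp (- l * v i)) * (\<Prod>i\<in>H - T. exp (l * v i)))"
  proof (intro sum.cong refl)
    fix T assume T: "T \<in> Pow H"
    have "(\<Sum>i\<in>H. if i \<in> T then - v i else v i) = (\<Sum>i\<in>T. - v i) + (\<Sum>i\<in>H - T. v i)"
    proof -
      have "H \<inter> {i. i \<in> T} = T" "H \<inter> - {i. i \<in> T} = H - T" using T by auto
      then show ?thesis using assms(1) by (simp add: sum.If_cases)
    qed
    then have "exp (l * (\<Sum>i\<in>H. if i \<in> T then - v i else v i))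
        = exp (\<Sum>i\<in>T. - l * v i) * exp (\<Sum>i\<in>H - T. l * v i)"
      by (simp only: distrib_left sum_distrib_left exp_add) simp
    then show "exp (l * (\<Sum>i\<in>H. if i \<in> T then - v i else v i))
        = (\<Prod>i\<in>T. exp (- l * v i)) * (\<Prod>i\<in>H - T. exp (l * v i))"
      using T assms(1) by (simp add: exp_sum finite_subset)
  qed
  also have "\<dots> = (\<Prod>i\<in>H. exp (- l * v i) + exp (l * v i))"
    by (rule prod_add[OF assms(1), symmetric])
  also have "\<dots> \<le> (\<Prod>i\<in>H. 2 * exp (l\<^sup>2 * K\<^sup>2 / 2))"
  proof (intro prod_mono conjI)
    fix i assume i: "i \<in> H"
    have "exp (- l * v i) + exp (l * v i) = 2 * cosh (l * v i)"
      by (simp add: cosh_def)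
    also have "\<dots> \<le> 2 * exp ((l * v i)\<^sup>2 / 2)"
      using cosh_real_le_exp by simp
    also have "(l * v i)\<^sup>2 \<le> l\<^sup>2 * K\<^sup>2"
      using assms(2)[OF i] by (metis abs_ge_zero mult_left_mono power2_abs power_mono power_mult_distrib zero_le_power2)
    finally show "exp (- l * v i) + exp (l * v i) \<le> 2 * exp (l\<^sup>2 * K\<^sup>2 / 2)" by simp
  qed (simp add: add_nonneg_nonneg)
  also have "\<dots> = 2 ^ card H * exp (l\<^sup>2 * K\<^sup>2 * real (card H) / 2)"
    by (simp add: power_mult_distrib mult.commute flip: exp_of_nat_mult)
  finally show ?thesis .
qed

text \<open>Massart's maximal inequality: \<open>\<Phi> T\<close> may pick its vector from
  \<open>\<V>\<close> depending on the signs, and the size of \<open>\<V>\<close> enters only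
  through its logarithm.\<close>

lemma rademacher_sum_le:
  fixes \<V> :: "('i \<Rightarrow> real) set" and \<Phi> :: "'i set \<Rightarrow> real"
  assumes "finite H" "finite \<V>" "real (card \<V>) \<le> N" "N > 0" "l > 0"
    and bound: "\<And>v i. v \<in> \<V> \<Longrightarrow> i \<in> H \<Longrightarrow> \<bar>v i\<bar> \<le> K"
    and \<Phi>: "\<And>T. T \<subseteq> H \<Longrightarrow> \<exists>v\<in>\<V>. \<Phi> T \<le> (\<Sum>i\<in>H. if i \<in> T then - v i else v i)"
  shows "(\<Sum>T\<in>Pow H. \<Phi> T) \<le> 2 ^ card H * (ln N / l + l * K\<^sup>2 * real (card H) / 2)"
proof -
  define r where "r v T = (\<Sum>i\<in>H. if i \<in> T then - v i else v i :: real)" for v T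
  \<comment> \<open>\<open>2 ^ card H * M\<close> bounds the exponentials summed over all signs and
    vectors. With this \<open>M\<close> the first two terms of \<open>le_exp_div_add_ln\<close>
    contribute at most zero after summation, and \<open>ln M\<close> remains.\<close>
  define M where "M = N * exp (l\<^sup>2 * K\<^sup>2 * real (card H) / 2)"
  have M: "M > 0" using assms by (simp add: M_def)
  have "l * \<Phi> T \<le> (\<Sum>v\<in>\<V>. exp (l * r v T)) / M - 1 + ln M" if T: "T \<in> Pow H" for T
  proof -
    obtain v where v: "v \<in> \<V>" "\<Phi> T \<le> r v T" using \<Phi>[of T] T unfolding r_def by blast
    have "l * \<Phi> T \<le> l * r v T" using v assms by simp
    also have "\<dots> \<le> exp (l * r v T) / M - 1 + ln M" by (rule le_exp_div_add_ln[OF M])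
    also have "exp (l * r v T) \<le> (\<Sum>v\<in>\<V>. exp (l * r v T))"
      using v assms(2) by (intro member_le_sum) auto
    finally show ?thesis using M by (simp add: divide_right_mono)
  qed
  then have "l * (\<Sum>T\<in>Pow H. \<Phi> T) \<le> (\<Sum>T\<in>Pow H. (\<Sum>v\<in>\<V>. exp (l * r v T)) / M - 1 + ln M)"
    unfolding sum_distrib_left by (rule sum_mono)
  also have "\<dots> = (\<Sum>v\<in>\<V>. \<Sum>T\<in>Pow H. exp (l * r v T)) / M + 2 ^ card H * (ln M - 1)"
    using assms(1) by (subst sum.swap) (simp add: sum.distrib sum_subtractf card_Pow sum_divide_distrib algebra_simps)
  also have "(\<Sum>v\<in>\<V>. \<Sum>T\<in>Pow H. exp (l * r v T)) \<le> 2 ^ card H * M"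
  proof -
    have "(\<Sum>v\<in>\<V>. \<Sum>T\<in>Pow H. exp (l * r v T))
        \<le> (\<Sum>v\<in>\<V>. 2 ^ card H * exp (l\<^sup>2 * K\<^sup>2 * real (card H) / 2))"
      unfolding r_def using assms(1) bound by (intro sum_mono sum_Pow_rademacher_le) auto
    also have "\<dots> = real (card \<V>) * (2 ^ card H * exp (l\<^sup>2 * K\<^sup>2 * real (card H) / 2))" by simp
    also have "\<dots> \<le> N * (2 ^ card H * exp (l\<^sup>2 * K\<^sup>2 * real (card H) / 2))"
      using assms by (intro mult_right_mono) auto
    finally show ?thesis by (simp add: M_def algebra_simps)
  qed
  finally have "l * (\<Sum>T\<in>Pow H. \<Phi> T) \<le> 2 ^ card H * ln M"
    using M by (simp add: divide_right_mono algebra_simps)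
  also have "ln M = ln N + l\<^sup>2 * K\<^sup>2 * real (card H) / 2"
    using assms by (simp add: M_def ln_mult)
  also have "2 ^ card H * (ln N + l\<^sup>2 * K\<^sup>2 * real (card H) / 2)
      = l * (2 ^ card H * (ln N / l + l * K\<^sup>2 * real (card H) / 2))"
    using assms(5) by (simp add: field_simps power2_eq_square)
  finally show ?thesis using assms(5) by simp
qed

text \<open>A linear functional of the values of a function that is constant on cells is maximal when these
  values are extreme; so bounded values reduce to signs, of which there are finitely many.\<close>

lemma label_rademacher_sum_le:
  fixes Labs :: "('i \<times> bool \<Rightarrow> nat option) set" and z :: "'i \<times> bool \<Rightarrow> real"
    and lab :: "'i set \<Rightarrow> 'i \<times> bool \<Rightarrow> nat option" and val :: "'i set \<Rightarrow> nat \<Rightarrow> real"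
  assumes H: "finite H" and Labs: "finite Labs"
    and N: "2 ^ t * real (card Labs) \<le> N" "N > 0" and l: "l > 0"
    and labs: "\<And>lab i b m. lab \<in> Labs \<Longrightarrow> i \<in> H \<Longrightarrow> lab (i, b) = Some m \<Longrightarrow> m < t"
    and z: "\<And>i b. i \<in> H \<Longrightarrow> \<bar>z (i, b)\<bar> \<le> Z" and \<beta>: "\<beta> \<ge> 0"
    and lab: "\<And>T. T \<subseteq> H \<Longrightarrow> lab T \<in> Labs"
    and val: "\<And>T m. T \<subseteq> H \<Longrightarrow> \<bar>val T m\<bar> \<le> \<beta>"
    and u: "\<And>T i b. T \<subseteq> H \<Longrightarrow> i \<in> H \<Longrightarrow>
      u T (i, b) = (case lab T (i, b) of None \<Rightarrow> 0 | Some m \<Rightarrow> val T m)"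
  shows "(\<Sum>T\<in>Pow H. \<Sum>i\<in>H. (if i \<in> T then -1 else 1) *
            (z (i, True) * u T (i, True) - z (i, False) * u T (i, False)))
         \<le> 2 ^ card H * (ln N / l + l * (2 * \<beta> * Z)\<^sup>2 * real (card H) / 2)"
proof -
  \<comment> \<open>The value of a cell is replaced by \<open>1\<close> or \<open>-1\<close>
    according to membership in \<open>Q\<close>; points in no cell keep the value
    \<open>0\<close>.\<close>
  define sg where "sg Q k = (case k of None \<Rightarrow> (0 :: real) | Some m \<Rightarrow> if m \<in> Q then 1 else - 1)"
    for Q :: "nat set" and k :: "nat option"
  define w where "w L Q i = \<beta> * (z (i, True) * sg Q (L (i, True)) - z (i, False) * sg Q (L (i, False)))"
    for L Q i
  define \<V> where "\<V> = (\<lambda>(L, Q). w L Q) ` (Labs \<times> Pow {..<t})"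
  have sg_le: "\<bar>sg Q k\<bar> \<le> 1" for Q k by (auto simp: sg_def split: option.split)
  show ?thesis
  proof (rule rademacher_sum_le[OF H _ _ N(2) l])
    show "finite \<V>" using Labs by (simp add: \<V>_def)
    \<comment> \<open>A labelling and a set \<open>Q\<close> of labels determine the vector; the
      choice of \<open>Q\<close> accounts for the factor \<open>2 ^ t\<close>.\<close>
    have "card \<V> \<le> card (Labs \<times> Pow {..<t})"
      unfolding \<V>_def using Labs by (intro card_image_le) auto
    then have "real (card \<V>) \<le> 2 ^ t * real (card Labs)"
      by (simp add: card_cartesian_product card_Pow mult.commute flip: of_nat_le_iff[where 'a = real])
    then show "real (card \<V>) \<le> N" using N(1) by simp
  next
    fix v i assume "v \<in> \<V>" "i \<in> H"
    then obtain L Q where v: "v = w L Q" by (auto simp: \<V>_def)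
    have le_Z: "\<bar>z (i, b) * sg Q k\<bar> \<le> Z" for b k
      using mult_mono[OF z[OF \<open>i \<in> H\<close>] sg_le] z[OF \<open>i \<in> H\<close>, of b] by (simp add: abs_mult)
    then have "\<bar>z (i, True) * sg Q (L (i, True)) - z (i, False) * sg Q (L (i, False))\<bar> \<le> 2 * Z"
      using le_Z[of True "L (i, True)"] le_Z[of False "L (i, False)"] by linarith
    then show "\<bar>v i\<bar> \<le> 2 * \<beta> * Z"
      using \<beta> mult_left_mono[of _ "2 * Z" \<beta>] by (simp add: v w_def abs_mult mult.assoc mult.left_commute)
  next
    fix T assume T: "T \<subseteq> H"
    define e where "e i = (if i \<in> T then -1 else 1 :: real)" for i
    \<comment> \<open>The coefficient of the value of cell \<open>m\<close> in the signed sum. Over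
      values in \<open>[-\<beta>, \<beta>]\<close> the sum is largest when each value has the sign
      of its coefficient, and this defines \<open>Q\<close>.\<close>
    define S where "S m = (\<Sum>i\<in>H. e i * (z (i, True) * of_bool (lab T (i, True) = Some m)
        - z (i, False) * of_bool (lab T (i, False) = Some m)))" for m
    define Q where "Q = {m \<in> {..<t}. S m \<ge> 0}"
    have expand: "(\<Sum>i\<in>H. e i * (z (i, True) * (case lab T (i, True) of None \<Rightarrow> 0 | Some m \<Rightarrow> h m)
          - z (i, False) * (case lab T (i, False) of None \<Rightarrow> 0 | Some m \<Rightarrow> h m)))
        = (\<Sum>m<t. h m * S m)" for h :: "nat \<Rightarrow> real"
    proof -
      have case_sum: "(case lab T (i, b) of None \<Rightarrow> 0 | Some m \<Rightarrow> h m)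
          = (\<Sum>m<t. h m * of_bool (lab T (i, b) = Some m))" if "i \<in> H" for i b
      proof (cases "lab T (i, b)")
        case (Some m)
        then have "m < t" using labs[OF lab[OF T] that] by blast
        then show ?thesis using Some by (simp add: of_bool_def if_distrib[of "(*) _"] sum.delta' cong: if_cong)
      qed simp
      have "(\<Sum>i\<in>H. e i * (z (i, True) * (case lab T (i, True) of None \<Rightarrow> 0 | Some m \<Rightarrow> h m)
          - z (i, False) * (case lab T (i, False) of None \<Rightarrow> 0 | Some m \<Rightarrow> h m)))
          = (\<Sum>i\<in>H. \<Sum>m<t. h m * (e i * (z (i, True) * of_bool (lab T (i, True) = Some m)
              - z (i, False) * of_bool (lab T (i, False) = Some m))))"
        by (intro sum.cong refl, simp only: case_sum sum_distrib_left flip: sum_subtractf)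
          (intro sum.cong refl, simp add: algebra_simps)
      also have "\<dots> = (\<Sum>m<t. h m * S m)"
        by (subst sum.swap) (simp add: S_def sum_distrib_left)
      finally show ?thesis .
    qed
    have "(\<Sum>i\<in>H. e i * (z (i, True) * u T (i, True) - z (i, False) * u T (i, False)))
        = (\<Sum>m<t. val T m * S m)"
      using expand[of "val T"] u[OF T] by (simp cong: sum.cong)
    also have "\<dots> \<le> (\<Sum>m<t. \<beta> * ((if m \<in> Q then 1 else -1) * S m))"
    proof (intro sum_mono)
      fix m assume "m \<in> {..<t}"
      have "val T m * S m \<le> \<bar>val T m\<bar> * \<bar>S m\<bar>" by (metis abs_ge_self abs_mult)
      also have "\<dots> \<le> \<beta> * \<bar>S m\<bar>" using val[OF T] by (simp add: mult_right_mono)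
      also have "\<bar>S m\<bar> = (if m \<in> Q then 1 else -1) * S m"
        using \<open>m \<in> {..<t}\<close> by (auto simp: Q_def)
      finally show "val T m * S m \<le> \<beta> * ((if m \<in> Q then 1 else -1) * S m)" .
    qed
    also have "\<dots> = \<beta> * (\<Sum>m<t. (if m \<in> Q then 1 else -1) * S m)"
      by (simp add: sum_distrib_left)
    also have "\<dots> = \<beta> * (\<Sum>i\<in>H. e i * (z (i, True) * sg Q (lab T (i, True))
        - z (i, False) * sg Q (lab T (i, False))))"
      unfolding sg_def using expand[of "\<lambda>m. if m \<in> Q then 1 else -1"] by simp
    also have "\<dots> = (\<Sum>i\<in>H. if i \<in> T then - w (lab T) Q i else w (lab T) Q i)"
      unfolding sum_distrib_left by (intro sum.cong refl) (auto simp: w_def e_def algebra_simps)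
    finally have "(\<Sum>i\<in>H. e i * (z (i, True) * u T (i, True) - z (i, False) * u T (i, False)))
        \<le> (\<Sum>i\<in>H. if i \<in> T then - w (lab T) Q i else w (lab T) Q i)" .
    moreover have "w (lab T) Q \<in> \<V>"
      using lab[OF T] by (auto simp: \<V>_def Q_def)
    ultimately show "\<exists>v\<in>\<V>. (\<Sum>i\<in>H. (if i \<in> T then -1 else 1) *
            (z (i, True) * u T (i, True) - z (i, False) * u T (i, False)))
        \<le> (\<Sum>i\<in>H. if i \<in> T then - v i else v i)"
      unfolding e_def by blast
  qed
qed

section \<open>Cells of the trees on a finite point set\<close>

lemma find_map_conv: "find P (map f xs) = map_option f (find (P \<circ> f) xs)"
  by (induction xs) auto

lemma find_cong_set: "(\<And>x. x \<in> set xs \<Longrightarrow> P x = Q x) \<Longrightarrow> find P xs = find Q xs"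
  by (induction xs) auto

text \<open>Keeps of a growing tree only its effect on a finite set: each of the \<open>k\<close>
  splits chooses a position and a trace. The two parts take the places of the daughters in the list
  of leaves, so that an index names a leaf.\<close>

fun split_lists :: "'i set set \<Rightarrow> 'i set \<Rightarrow> nat \<Rightarrow> 'i set list set" where
  "split_lists \<H> I 0 = {[I]}"
| "split_lists \<H> I (Suc k) = (\<lambda>(P, m, h). take m P @ [P ! m - h, P ! m \<inter> h] @ drop (Suc m) P) `
     (split_lists \<H> I k \<times> {..k} \<times> \<H>)"

lemma length_split_lists: "P \<in> split_lists \<H> I k \<Longrightarrow> length P = Suc k"
  by (induction k arbitrary: P) auto

lemma split_lists_SucI:
  assumes "As @ A # Bs \<in> split_lists \<H> I k" "h \<in> \<H>"
  shows "As @ (A - h) # (A \<inter> h) # Bs \<in> split_lists \<H> I (Suc k)"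
proof -
  have "length As \<le> k" using length_split_lists[OF assms(1)] by simp
  then have "(As @ A # Bs, length As, h) \<in> split_lists \<H> I k \<times> {..k} \<times> \<H>"
    using assms by simp
  then show ?thesis by (force simp: image_iff intro!: bexI)
qed

lemma finite_split_lists: "finite \<H> \<Longrightarrow> finite (split_lists \<H> I k)"
  by (induction k) auto

lemma card_split_lists_le:
  assumes "finite \<H>" "k \<le> t"
  shows "card (split_lists \<H> I k) \<le> (t * card \<H>) ^ k"
  using assms(2)
proof (induction k)
  case (Suc k)
  have "card (split_lists \<H> I (Suc k)) \<le> card (split_lists \<H> I k \<times> {..k} \<times> \<H>)"
    using assms(1) finite_split_lists by (auto intro!: card_image_le)
  also have "\<dots> = card (split_lists \<H> I k) * (Suc k * card \<H>)"
    by (simp add: card_cartesian_product)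
  also have "\<dots> \<le> (t * card \<H>) ^ k * (t * card \<H>)"
    using Suc by (intro mult_mono) auto
  finally show ?case by (simp add: mult.commute)
qed simp

definition node_trace :: "('i \<Rightarrow> real^'p::finite) \<Rightarrow> 'i set \<Rightarrow> (real^'p) set \<Rightarrow> 'i set" where
  "node_trace x I A = {j \<in> I. x j \<in> A}"

text \<open>Discarding the coordinates outside \<open>F\<close> is self-adjoint, so a split on a
  subset of the features is a halfspace of the full space.\<close>

lemma inner_subvector:
  fixes \<theta> x :: "real^'p::finite"
  shows "\<theta> \<bullet> subvector F x = subvector F \<theta> \<bullet> x"
  unfolding subvector_def inner_vec_def by (intro sum.cong) auto

lemma node_trace_daughters:
  "\<exists>h\<in>halfspace_traces x I. node_trace x I (daughter_le A F \<theta>s) = node_trace x I A - h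
     \<and> node_trace x I (daughter_gt A F \<theta>s) = node_trace x I A \<inter> h"
proof -
  obtain \<theta> s where \<theta>s: "\<theta>s = (\<theta>, s)" by (cases \<theta>s)
  let ?h = "{j \<in> I. subvector F \<theta> \<bullet> x j > s}"
  have "?h \<in> halfspace_traces x I" unfolding halfspace_traces_def by blast
  moreover have "node_trace x I (daughter_le A F \<theta>s) = node_trace x I A - ?h"
    "node_trace x I (daughter_gt A F \<theta>s) = node_trace x I A \<inter> ?h"
    by (auto simp: node_trace_def daughter_le_def daughter_gt_def \<theta>s inner_subvector)
  ultimately show ?thesis by blast
qed

text \<open>The invariant concerns the whole list \<open>Bs @ As\<close> of nodes already passed and
  still pending, since a split replaces one position of that list.\<close>

lemma grow_layer_split_lists:
  assumes "map (node_trace x I) (Bs @ As) \<in> split_lists (halfspace_traces x I) J k"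
    and "grow_layer sel D G S t As k = (Cs, k')"
  shows "map (node_trace x I) (Bs @ Cs) \<in> split_lists (halfspace_traces x I) J k'"
  using assms
proof (induction As arbitrary: Bs k Cs)
  case (Cons A As)
  show ?case
  proof (cases "t \<le> k + 1 \<or> node_count D G A \<le> 1")
    case True
    then obtain Cs' where "grow_layer sel D G S t As k = (Cs', k')" "Cs = A # Cs'"
      using Cons.prems(2) by (auto split: prod.splits)
    then show ?thesis using Cons.IH[of "Bs @ [A]" k Cs'] Cons.prems(1) by simp
  next
    case False
    define \<theta>s where "\<theta>s = sel (k + 1) (restrict D G) G A (S (k + 1))"
    define Dl where "Dl = daughter_le A (S (k + 1)) \<theta>s"
    define Dg where "Dg = daughter_gt A (S (k + 1)) \<theta>s"
    obtain Cs' where Cs': "grow_layer sel D G S t As (k + 1) = (Cs', k')" "Cs = Dl # Dg # Cs'"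
      using Cons.prems(2) False
      by (auto simp: Let_def \<theta>s_def Dl_def Dg_def split: prod.splits)
    obtain h where "h \<in> halfspace_traces x I"
      "node_trace x I Dl = node_trace x I A - h" "node_trace x I Dg = node_trace x I A \<inter> h"
      using node_trace_daughters[of x I A "S (k + 1)" \<theta>s] unfolding Dl_def Dg_def by blast
    then have "map (node_trace x I) ((Bs @ [Dl, Dg]) @ As)
        \<in> split_lists (halfspace_traces x I) J (Suc k)"
      using split_lists_SucI[of "map (node_trace x I) Bs" "node_trace x I A" "map (node_trace x I) As"]
        Cons.prems(1) by simp
    then show ?thesis using Cons.IH[of "Bs @ [Dl, Dg]" "Suc k" Cs'] Cs' by simp
  qed
qed simp

lemma grow_layer_splits_less: "k < t \<Longrightarrow> snd (grow_layer sel D G S t As k) < t"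
proof (induction As arbitrary: k)
  case (Cons A As)
  then show ?case
    using Cons.IH[of k] Cons.IH[of "Suc k"] by (auto simp: Let_def case_prod_beta)
qed simp

text \<open>Exposes the number \<open>l\<close> of rounds and keeps the number of splits, because
  the decrease of the training error is summed over rounds.\<close>

definition odt_layer ::
  "'p::finite split_rule \<Rightarrow> 'p sample \<Rightarrow> nat set \<Rightarrow> (nat \<Rightarrow> 'p set) \<Rightarrow> nat \<Rightarrow> nat
     \<Rightarrow> (real^'p) set list \<times> nat" where
  "odt_layer sel D G S t l = ((\<lambda>(As, k). grow_layer sel D G S t As k) ^^ l) ([cbox 0 1], 0)"

lemma odt_layer_0 [simp]: "odt_layer sel D G S t 0 = ([cbox 0 1], 0)"
  by (simp add: odt_layer_def)

lemma odt_layer_Suc [simp]: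
  "odt_layer sel D G S t (Suc l) = (case odt_layer sel D G S t l of (As, k) \<Rightarrow> grow_layer sel D G S t As k)"
  by (simp add: odt_layer_def)

lemma odt_leaves_eq_odt_layer: "odt_leaves sel D G S t = fst (odt_layer sel D G S t t)"
  by (simp add: odt_leaves_def odt_layer_def)

lemma odt_layer_split_lists:
  assumes "t \<ge> 1"
  shows "snd (odt_layer sel D G S t l) < t \<and>
    map (node_trace x I) (fst (odt_layer sel D G S t l))
      \<in> split_lists (halfspace_traces x I) (node_trace x I (cbox 0 1)) (snd (odt_layer sel D G S t l))"
proof (induction l)
  case (Suc l)
  obtain As k where As: "odt_layer sel D G S t l = (As, k)" by fastforce
  obtain Cs k' where Cs: "grow_layer sel D G S t As k = (Cs, k')" by fastforce
  have "k' < t" using grow_layer_splits_less[of k t sel D G S As] Suc As Cs by simp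
  then show ?case
    using Suc As Cs grow_layer_split_lists[of x I "[]" As _ k, OF _ Cs] by simp
qed (use assms in simp)

text \<open>Repeats the \<open>find\<close> of \<open>odt_estimator\<close> on indices instead of
  cells. \<open>None\<close> is the label of points in no cell, such as those outside the
  cube.\<close>

definition first_cell :: "'i set list \<Rightarrow> 'i \<Rightarrow> nat option" where
  "first_cell P j = find (\<lambda>m. j \<in> P ! m) [0..<length P]"

text \<open>Depends on the points alone: it contains the labelling of every tree with at most
  \<open>t\<close> leaves, whatever its sample, feature sets and split rule.\<close>

definition tree_labels :: "('i \<Rightarrow> real^'p::finite) \<Rightarrow> 'i set \<Rightarrow> nat \<Rightarrow> ('i \<Rightarrow> nat option) set" where
  "tree_labels x I t = (\<Union>k<t. first_cell ` split_lists (halfspace_traces x I) (node_trace x I (cbox 0 1)) k)"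

lemma finite_tree_labels: "finite I \<Longrightarrow> finite (tree_labels x I t)"
  by (simp add: tree_labels_def finite_split_lists finite_halfspace_traces)

lemma card_tree_labels_le:
  fixes x :: "'i \<Rightarrow> real^'p::finite"
  assumes "finite I" "t \<ge> 1"
  shows "card (tree_labels x I t) \<le> t * (t * (card I + 1) ^ (CARD('p) + 1)) ^ t"
proof -
  let ?h = "(card I + 1) ^ (CARD('p) + 1)"
  have h: "card (halfspace_traces x I) \<le> ?h"
    using card_halfspace_traces_le[OF assms(1), of x] by simp
  have "card (tree_labels x I t)
      \<le> (\<Sum>k<t. card (first_cell ` split_lists (halfspace_traces x I) (node_trace x I (cbox 0 1)) k))"
    unfolding tree_labels_def by (rule card_UN_le) simp
  also have "\<dots> \<le> (\<Sum>k<t. (t * ?h) ^ t)"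
  proof (intro sum_mono)
    fix k assume k: "k \<in> {..<t}"
    have "card (first_cell ` split_lists (halfspace_traces x I) (node_trace x I (cbox 0 1)) k)
        \<le> card (split_lists (halfspace_traces x I) (node_trace x I (cbox 0 1)) k)"
      using assms by (intro card_image_le finite_split_lists finite_halfspace_traces)
    also have "\<dots> \<le> (t * card (halfspace_traces x I)) ^ k"
      using k assms by (intro card_split_lists_le finite_halfspace_traces) auto
    also have "\<dots> \<le> (t * ?h) ^ k" using h by (intro power_mono mult_left_mono) auto
    also have "\<dots> \<le> (t * ?h) ^ t" using k assms by (intro power_increasing) (auto simp del: power_Suc)
    finally show "card (first_cell ` split_lists (halfspace_traces x I) (node_trace x I (cbox 0 1)) k)
        \<le> (t * ?h) ^ t" .
  qed
  finally show ?thesis by simp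
qed

lemma tree_labels_less:
  assumes "lab \<in> tree_labels x I t" "lab j = Some m"
  shows "m < t"
proof -
  obtain k P where P: "k < t" "P \<in> split_lists (halfspace_traces x I) (node_trace x I (cbox 0 1)) k"
      "lab = first_cell P"
    using assms(1) by (auto simp: tree_labels_def)
  then have "m < length P" using assms(2) by (auto simp: first_cell_def find_Some_iff)
  then show ?thesis using P length_split_lists[OF P(2)] by simp
qed

lemma abs_node_mean_le:
  assumes "\<And>i. i \<in> G \<Longrightarrow> \<bar>snd (D i)\<bar> \<le> \<beta>" "\<beta> \<ge> 0"
  shows "\<bar>node_mean D G A\<bar> \<le> \<beta>"
proof (cases "node_count D G A = 0")
  case False
  have "\<bar>\<Sum>i\<in>node_points D G A. snd (D i)\<bar> \<le> (\<Sum>i\<in>node_points D G A. \<bar>snd (D i)\<bar>)" by (rule sum_abs)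
  also have "\<dots> \<le> (\<Sum>i\<in>node_points D G A. \<beta>)"
    using assms by (intro sum_mono) (auto simp: node_points_def)
  also have "\<dots> = real (node_count D G A) * \<beta>" by (simp add: node_count_def)
  finally show ?thesis using False by (simp add: node_mean_def field_simps)
qed (use assms in \<open>simp add: node_mean_def\<close>)

lemma abs_odt_estimator_le:
  assumes "\<And>i. i \<in> G \<Longrightarrow> \<bar>snd (D i)\<bar> \<le> \<beta>" "\<beta> \<ge> 0"
  shows "\<bar>odt_estimator sel D G S t x\<bar> \<le> \<beta>"
  using abs_node_mean_le[OF assms] assms(2) by (auto simp: odt_estimator_def split: option.split)

text \<open>The evaluation points \<open>x\<close> are unrelated to the training sample
  \<open>D\<close>. Hence one finite set of labellings describes the trees grown on all swapped
  samples, at the points of both copies.\<close>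

lemma odt_estimator_tree_labels:
  fixes x :: "'i \<Rightarrow> real^'p::finite"
  assumes "t \<ge> 1" and \<beta>: "\<And>i. i \<in> G \<Longrightarrow> \<bar>snd (D i)\<bar> \<le> \<beta>" "\<beta> \<ge> 0"
  obtains lab val where "lab \<in> tree_labels x I t" "\<And>m. \<bar>val m\<bar> \<le> \<beta>"
    "\<And>j. j \<in> I \<Longrightarrow> odt_estimator sel D G S t (x j) = (case lab j of None \<Rightarrow> 0 | Some m \<Rightarrow> val m)"
proof -
  define Cs where "Cs = odt_leaves sel D G S t"
  define P where "P = map (node_trace x I) Cs"
  show thesis
  proof (rule that[of "first_cell P" "\<lambda>m. node_mean D G (Cs ! m)"])
    show "first_cell P \<in> tree_labels x I t"
      using odt_layer_split_lists[OF assms(1), of sel D G S t x I]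
      unfolding tree_labels_def P_def Cs_def odt_leaves_eq_odt_layer by blast
  next
    fix j assume j: "j \<in> I"
    have "find (\<lambda>A. x j \<in> A) Cs = map_option ((!) Cs) (find (\<lambda>m. x j \<in> Cs ! m) [0..<length Cs])"
      using find_map_conv[of "\<lambda>A. x j \<in> A" "(!) Cs" "[0..<length Cs]"] by (simp add: map_nth o_def)
    also have "find (\<lambda>m. x j \<in> Cs ! m) [0..<length Cs] = first_cell P j"
      unfolding first_cell_def using j by (auto simp: P_def node_trace_def intro: find_cong_set)
    finally show "odt_estimator sel D G S t (x j)
        = (case first_cell P j of None \<Rightarrow> 0 | Some m \<Rightarrow> node_mean D G (Cs ! m))"
      by (auto simp: odt_estimator_def Cs_def split: option.split)
  qed (rule abs_node_mean_le[OF \<beta>])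
qed

section \<open>Decrease of the training error\<close>

definition ridge_step :: "real \<Rightarrow> (real \<times> (real^'p) \<times> real) list \<Rightarrow> real^'p::finite \<Rightarrow> real" where
  "ridge_step c0 ps x = c0 + (\<Sum>(c, \<theta>, s)\<leftarrow>ps. c * of_bool (\<theta> \<bullet> x > s))"

text \<open>Negative values are possible. Summed over the leaves it is the training error of the
  tree minus that of \<open>f\<close>; the part with \<open>f\<close> is additive over daughters, so
  a split changes the sum only through \<open>node_sse\<close>.\<close>

definition node_excess :: "'p::finite sample \<Rightarrow> nat set \<Rightarrow> (real^'p \<Rightarrow> real) \<Rightarrow> (real^'p) set \<Rightarrow> real" where
  "node_excess D G f A =
     node_sse D G A - (\<Sum>i\<in>node_points D G A. (snd (D i) - f (fst (D i)))\<^sup>2)"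

lemma finite_node_points [simp]: "finite G \<Longrightarrow> finite (node_points D G A)"
  by (simp add: node_points_def)

lemma sum_sub_node_mean:
  assumes "finite G"
  shows "(\<Sum>i\<in>node_points D G A. snd (D i) - node_mean D G A) = 0"
proof (cases "node_count D G A = 0")
  case True
  then have "node_points D G A = {}" using assms by (simp add: node_count_def)
  then show ?thesis by simp
next
  case False
  then show ?thesis by (simp add: sum_subtractf node_mean_def node_count_def)
qed

lemma node_sse_le:
  assumes "finite G"
  shows "node_sse D G A \<le> (\<Sum>i\<in>node_points D G A. (snd (D i) - b)\<^sup>2)"
proof -
  define r where "r i = snd (D i) - node_mean D G A" for i
  define d where "d = node_mean D G A - b"
  have "(\<Sum>i\<in>node_points D G A. (snd (D i) - b)\<^sup>2)
      = (\<Sum>i\<in>node_points D G A. (r i)\<^sup>2 + 2 * d * r i + d\<^sup>2)"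
    by (intro sum.cong refl) (simp add: r_def d_def power2_eq_square algebra_simps)
  also have "\<dots> = node_sse D G A + 2 * d * (\<Sum>i\<in>node_points D G A. r i)
      + real (card (node_points D G A)) * d\<^sup>2"
    by (simp add: sum.distrib node_sse_def r_def sum_distrib_left)
  also have "(\<Sum>i\<in>node_points D G A. r i) = 0"
    unfolding r_def by (rule sum_sub_node_mean[OF assms])
  finally show ?thesis by simp
qed

lemma node_points_daughters:
  "node_points D G A = node_points D G (daughter_le A F \<theta>s) \<union> node_points D G (daughter_gt A F \<theta>s)"
  "node_points D G (daughter_le A F \<theta>s) \<inter> node_points D G (daughter_gt A F \<theta>s) = {}"
  by (cases \<theta>s; force simp: node_points_def daughter_le_def daughter_gt_def)+

lemma sum_node_points_daughters:
  assumes "finite G"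
  shows "(\<Sum>i\<in>node_points D G A. h i) = (\<Sum>i\<in>node_points D G (daughter_le A F \<theta>s). h i)
     + (\<Sum>i\<in>node_points D G (daughter_gt A F \<theta>s). h i)"
  using sum.union_disjoint[OF _ _ node_points_daughters(2)[of D G A F \<theta>s], of h] assms
  by (simp flip: node_points_daughters(1))

text \<open>The mean minimizes the sum of squares, so in the daughters it may be replaced by the
  mean of \<open>A\<close> shifted by \<open>\<plusminus>2 s / N(A)\<close>; no closed formula for the gain is needed.\<close>

lemma sse_gain_ge:
  fixes A :: "(real^'p::finite) set" and F :: "'p set" and \<theta>s :: "(real^'p) \<times> real"
  assumes "finite G" and "node_count D G A > 0"
  defines "s \<equiv> \<Sum>i\<in>node_points D G (daughter_gt A F \<theta>s). snd (D i) - node_mean D G A"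
  shows "node_sse D G A - node_sse D G (daughter_le A F \<theta>s) - node_sse D G (daughter_gt A F \<theta>s)
     \<ge> 4 * s\<^sup>2 / real (node_count D G A)"
proof -
  define N where "N = real (node_count D G A)"
  define Pl where "Pl = node_points D G (daughter_le A F \<theta>s)"
  define Pg where "Pg = node_points D G (daughter_gt A F \<theta>s)"
  define mu where "mu = node_mean D G A"
  define r where "r i = snd (D i) - mu" for i
  \<comment> \<open>The shift that maximizes the lower bound
    \<open>4 * b * s - N * b\<^sup>2\<close> for the gain.\<close>
  define b where "b = 2 * s / N"
  have N: "N > 0" using assms by (simp add: N_def)
  have split: "(\<Sum>i\<in>node_points D G A. h i) = (\<Sum>i\<in>Pl. h i) + (\<Sum>i\<in>Pg. h i)" for h :: "nat \<Rightarrow> real"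
    unfolding Pl_def Pg_def by (rule sum_node_points_daughters[OF assms(1)])
  have s: "(\<Sum>i\<in>Pg. r i) = s" by (simp add: s_def Pg_def r_def mu_def)
  then have s': "(\<Sum>i\<in>Pl. r i) = - s"
    using split[of r] sum_sub_node_mean[OF assms(1), of D A] by (simp add: r_def mu_def)
  have card: "real (card Pl) + real (card Pg) = N"
    using split[of "\<lambda>_. 1"] by (simp add: N_def node_count_def)
  have "node_sse D G (daughter_le A F \<theta>s) \<le> (\<Sum>i\<in>Pl. (r i + b)\<^sup>2)"
    using node_sse_le[OF assms(1), of D _ "mu - b"] by (simp add: Pl_def r_def algebra_simps)
  also have "\<dots> = (\<Sum>i\<in>Pl. (r i)\<^sup>2 + 2 * b * r i + b\<^sup>2)"
    by (intro sum.cong refl) (simp add: power2_sum)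
  also have "\<dots> = (\<Sum>i\<in>Pl. (r i)\<^sup>2) + 2 * b * (\<Sum>i\<in>Pl. r i) + real (card Pl) * b\<^sup>2"
    by (simp add: sum.distrib flip: sum_distrib_left)
  finally have 1: "node_sse D G (daughter_le A F \<theta>s) \<le> (\<Sum>i\<in>Pl. (r i)\<^sup>2) - 2 * b * s + real (card Pl) * b\<^sup>2"
    by (simp add: s')
  have "node_sse D G (daughter_gt A F \<theta>s) \<le> (\<Sum>i\<in>Pg. (r i - b)\<^sup>2)"
    using node_sse_le[OF assms(1), of D _ "mu + b"] by (simp add: Pg_def r_def algebra_simps)
  also have "\<dots> = (\<Sum>i\<in>Pg. (r i)\<^sup>2 - 2 * b * r i + b\<^sup>2)"
    by (intro sum.cong refl) (simp add: power2_diff)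
  also have "\<dots> = (\<Sum>i\<in>Pg. (r i)\<^sup>2) - 2 * b * (\<Sum>i\<in>Pg. r i) + real (card Pg) * b\<^sup>2"
    by (simp add: sum.distrib sum_subtractf flip: sum_distrib_left)
  finally have 2: "node_sse D G (daughter_gt A F \<theta>s) \<le> (\<Sum>i\<in>Pg. (r i)\<^sup>2) - 2 * b * s + real (card Pg) * b\<^sup>2"
    by (simp add: s)
  have "node_sse D G A = (\<Sum>i\<in>Pl. (r i)\<^sup>2) + (\<Sum>i\<in>Pg. (r i)\<^sup>2)"
    using split[of "\<lambda>i. (r i)\<^sup>2"] by (simp add: node_sse_def r_def mu_def)
  then have "node_sse D G A - node_sse D G (daughter_le A F \<theta>s) - node_sse D G (daughter_gt A F \<theta>s)
      \<ge> 4 * b * s - (real (card Pl) + real (card Pg)) * b\<^sup>2"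
    using 1 2 by (simp add: algebra_simps)
  also have "4 * b * s - (real (card Pl) + real (card Pg)) * b\<^sup>2 = 4 * s\<^sup>2 / N"
    unfolding card b_def using N by (simp add: field_simps power2_eq_square)
  finally show ?thesis by (simp add: N_def)
qed

text \<open>Valid for every split, because the means of the daughters fit at least as well as the
  mean of \<open>A\<close>. It covers the feature sets for which the halfspaces of \<open>f\<close>
  need not be admissible.\<close>

lemma node_excess_daughters_le:
  assumes "finite G"
  shows "node_excess D G f (daughter_le A F \<theta>s) + node_excess D G f (daughter_gt A F \<theta>s)
    \<le> node_excess D G f A"
proof -
  have "node_sse D G (daughter_le A F \<theta>s) + node_sse D G (daughter_gt A F \<theta>s) \<le> node_sse D G A"
  proof -
    let ?m = "node_mean D G A"
    have "node_sse D G A = (\<Sum>i\<in>node_points D G (daughter_le A F \<theta>s). (snd (D i) - ?m)\<^sup>2)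
       + (\<Sum>i\<in>node_points D G (daughter_gt A F \<theta>s). (snd (D i) - ?m)\<^sup>2)"
      unfolding node_sse_def by (rule sum_node_points_daughters[OF assms])
    then show ?thesis
      using node_sse_le[OF assms, of D "daughter_le A F \<theta>s" ?m]
        node_sse_le[OF assms, of D "daughter_gt A F \<theta>s" ?m] by linarith
  qed
  then show ?thesis
    unfolding node_excess_def
    using sum_node_points_daughters[OF assms, of "\<lambda>i. (snd (D i) - f (fst (D i)))\<^sup>2" D A F \<theta>s]
    by simp
qed

text \<open>Some halfspace of \<open>f\<close> correlates with the residuals at least as well as \<open>f\<close> itself does,
  up to the factor \<open>V\<close>.\<close>

lemma node_excess_decrease:
  assumes "finite G" and cnt: "node_count D G A > 0"
    and f: "f = ridge_step c0 ps" and unit: "\<And>c \<theta> s. (c, \<theta>, s) \<in> set ps \<Longrightarrow> norm \<theta> = 1"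
    and V: "(\<Sum>(c, \<theta>, s)\<leftarrow>ps. \<bar>c\<bar>) \<le> V" "V > 0"
    and max: "split_maximizer D G A UNIV \<theta>s"
  shows "node_excess D G f (daughter_le A UNIV \<theta>s) + node_excess D G f (daughter_gt A UNIV \<theta>s)
    \<le> node_excess D G f A - (max 0 (node_excess D G f A))\<^sup>2 / (real (node_count D G A) * V\<^sup>2)"
proof (cases "node_excess D G f A \<le> 0")
  case True
  then show ?thesis
    using node_excess_daughters_le[OF assms(1), of D f A UNIV \<theta>s] by (simp add: max_absorb1)
next
  case False
  define N where "N = real (node_count D G A)"
  have N: "N > 0" using cnt by (simp add: N_def)
  define P where "P = node_points D G A"
  define r where "r i = snd (D i) - node_mean D G A" for i
  define ex where "ex = node_excess D G f A"
  define g where "g \<theta>s = node_sse D G A - node_sse D G (daughter_le A UNIV \<theta>s)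
    - node_sse D G (daughter_gt A UNIV \<theta>s)" for \<theta>s
  define corr where "corr \<theta> s = (\<Sum>i\<in>P. r i * of_bool (\<theta> \<bullet> fst (D i) > s))" for \<theta> s
  have g_max: "g \<theta>s' \<le> g \<theta>s" if "norm (fst \<theta>s') = 1" for \<theta>s'
  proof -
    have "\<theta>s' \<in> directions UNIV \<times> UNIV" using that by (cases \<theta>s') (auto simp: directions_def)
    then have "g \<theta>s' / N \<le> g \<theta>s / N"
      using max unfolding split_maximizer_def impurity_gain_def g_def N_def by blast
    then show ?thesis using N by (simp add: divide_le_cancel)
  qed
  have g_nonneg: "0 \<le> g \<theta>s"
    using sse_gain_ge[OF assms(1) cnt, of UNIV \<theta>s] N unfolding g_def N_def
    by (smt (verit) divide_nonneg_pos zero_le_power2)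
  have corr_le: "\<bar>corr \<theta> s\<bar> \<le> sqrt (N * g \<theta>s / 4)" if "norm \<theta> = 1" for \<theta> s
  proof -
    \<comment> \<open>With all features every unit vector is an admissible direction, so each
      halfspace of \<open>f\<close> competes with the chosen split.\<close>
    have sub: "subvector UNIV x = x" for x :: "real^'a" by (simp add: subvector_def vec_eq_iff)
    have "node_points D G (daughter_gt A UNIV (\<theta>, s)) = {i \<in> P. \<theta> \<bullet> fst (D i) > s}"
      by (auto simp: node_points_def daughter_gt_def P_def sub)
    then have "(\<Sum>i\<in>node_points D G (daughter_gt A UNIV (\<theta>, s)). snd (D i) - node_mean D G A) = corr \<theta> s"
      unfolding corr_def r_def using assms(1)
      by (simp add: P_def of_bool_def if_distrib[of "(*) _"] sum.inter_filter cong: if_cong)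
    then have "4 * (corr \<theta> s)\<^sup>2 / N \<le> g (\<theta>, s)"
      using sse_gain_ge[OF assms(1) cnt, of UNIV "(\<theta>, s)"] by (simp add: g_def N_def)
    also have "\<dots> \<le> g \<theta>s" using g_max that by simp
    finally have "(corr \<theta> s)\<^sup>2 \<le> N * g \<theta>s / 4" using N by (simp add: field_simps)
    then show ?thesis by (metis real_sqrt_abs real_sqrt_le_iff)
  qed
  \<comment> \<open>The residuals sum to zero, so \<open>c0\<close> drops out and does not count
    towards \<open>V\<close>.\<close>
  have "(\<Sum>i\<in>P. r i * f (fst (D i))) = c0 * (\<Sum>i\<in>P. r i) + (\<Sum>(c, \<theta>, s)\<leftarrow>ps. c * corr \<theta> s)"
  proof (unfold f, induction ps)
    case (Cons p ps)
    obtain c \<theta> s where p: "p = (c, \<theta>, s)" by (cases p)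
    have "(\<Sum>i\<in>P. r i * ridge_step c0 (p # ps) (fst (D i)))
        = c * corr \<theta> s + (\<Sum>i\<in>P. r i * ridge_step c0 ps (fst (D i)))"
      unfolding corr_def sum_distrib_left sum.distrib[symmetric]
      by (intro sum.cong refl) (simp add: ridge_step_def p algebra_simps)
    then show ?case using Cons p by simp
  qed (simp add: ridge_step_def sum_distrib_left mult.commute)
  also have "(\<Sum>i\<in>P. r i) = 0"
    unfolding P_def r_def by (rule sum_sub_node_mean[OF assms(1)])
  also have "(\<Sum>(c, \<theta>, s)\<leftarrow>ps. c * corr \<theta> s) \<le> (\<Sum>(c, \<theta>, s)\<leftarrow>ps. \<bar>c\<bar> * sqrt (N * g \<theta>s / 4))"
  proof (intro sum_list_mono, clarify)
    fix c \<theta> s assume "(c, \<theta>, s) \<in> set ps"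
    then have "\<bar>c\<bar> * \<bar>corr \<theta> s\<bar> \<le> \<bar>c\<bar> * sqrt (N * g \<theta>s / 4)"
      using corr_le unit by (intro mult_left_mono) auto
    then show "c * corr \<theta> s \<le> \<bar>c\<bar> * sqrt (N * g \<theta>s / 4)"
      by (metis abs_ge_self abs_mult order_trans)
  qed
  also have "(\<Sum>(c, \<theta>, s)\<leftarrow>ps. \<bar>c\<bar> * sqrt (N * g \<theta>s / 4))
      = (\<Sum>(c, \<theta>, s)\<leftarrow>ps. \<bar>c\<bar>) * sqrt (N * g \<theta>s / 4)"
    by (induction ps) (auto simp: algebra_simps)
  also have "\<dots> \<le> V * sqrt (N * g \<theta>s / 4)"
    using V N g_nonneg by (intro mult_right_mono) auto
  finally have rf: "(\<Sum>i\<in>P. r i * f (fst (D i))) \<le> V * sqrt (N * g \<theta>s / 4)" by simp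
  \<comment> \<open>Expanding the squares around the node mean leaves twice the correlation of
    residuals and \<open>f\<close> minus the square of \<open>f - ?m\<close>, up to a multiple of
    the vanishing residual sum.\<close>
  have "ex \<le> 2 * (\<Sum>i\<in>P. r i * f (fst (D i)))"
  proof -
    let ?m = "node_mean D G A"
    have "(\<Sum>i\<in>P. r i) = 0" unfolding P_def r_def by (rule sum_sub_node_mean[OF assms(1)])
    then have "ex = (\<Sum>i\<in>P. (r i)\<^sup>2) - (\<Sum>i\<in>P. (snd (D i) - f (fst (D i)))\<^sup>2) + 2 * ?m * (\<Sum>i\<in>P. r i)"
      by (simp add: ex_def node_excess_def node_sse_def P_def r_def)
    also have "\<dots> = (\<Sum>i\<in>P. 2 * (r i * f (fst (D i))) - (f (fst (D i)) - ?m)\<^sup>2)"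
      unfolding sum_distrib_left sum_subtractf[symmetric] sum.distrib[symmetric]
      by (intro sum.cong refl) (simp add: r_def power2_eq_square algebra_simps)
    also have "\<dots> \<le> (\<Sum>i\<in>P. 2 * (r i * f (fst (D i))))" by (intro sum_mono) simp
    finally show ?thesis by (simp add: sum_distrib_left)
  qed
  then have "ex \<le> V * (2 * sqrt (N * g \<theta>s / 4))" using rf by simp
  also have "2 * sqrt (N * g \<theta>s / 4) = sqrt (N * g \<theta>s)"
    by (simp add: real_sqrt_divide)
  finally have "ex\<^sup>2 \<le> (V * sqrt (N * g \<theta>s))\<^sup>2"
    using False by (intro power_mono) (auto simp: ex_def)
  also have "\<dots> = V\<^sup>2 * (N * g \<theta>s)" using N g_nonneg by (simp add: power_mult_distrib)
  finally have "ex\<^sup>2 / (N * V\<^sup>2) \<le> g \<theta>s" using N V by (simp add: field_simps)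
  moreover have "node_excess D G f (daughter_le A UNIV \<theta>s) + node_excess D G f (daughter_gt A UNIV \<theta>s)
      = ex - g \<theta>s"
    unfolding ex_def g_def node_excess_def
    using sum_node_points_daughters[OF assms(1), of "\<lambda>i. (snd (D i) - f (fst (D i)))\<^sup>2" D A UNIV \<theta>s]
    by simp
  ultimately show ?thesis using False by (simp add: ex_def N_def)
qed

section \<open>Averaging the decrease over the random feature sets\<close>

lemma expectation_Pi_pmf_insert:
  fixes h :: "('i \<Rightarrow> 'b::finite) \<Rightarrow> real"
  assumes "finite A" "x \<notin> A"
  shows "measure_pmf.expectation (Pi_pmf (insert x A) d p) h
     = (\<Sum>y\<in>UNIV. pmf (p x) y * measure_pmf.expectation (Pi_pmf A d p) (\<lambda>f. h (f(x := y))))"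
proof -
  have fin: "finite (set_pmf (Pi_pmf A d p))"
    by (simp add: set_Pi_pmf[OF assms(1)] finite_PiE_dflt[OF assms(1)])
  have "measure_pmf.expectation (Pi_pmf (insert x A) d p) h
    = measure_pmf.expectation (p x \<bind> (\<lambda>y. map_pmf (\<lambda>f. f(x := y)) (Pi_pmf A d p))) h"
    using assms by (simp add: Pi_pmf_insert' map_pmf_def)
  also have "\<dots> = (\<Sum>y\<in>UNIV. pmf (p x) y *\<^sub>R
      measure_pmf.expectation (map_pmf (\<lambda>f. f(x := y)) (Pi_pmf A d p)) h)"
    by (rule pmf_expectation_bind) (use fin in auto)
  finally show ?thesis by simp
qed

text \<open>A tree is grown layer by layer; \<open>Bs\<close> and \<open>As\<close> are the processed and the pending nodes of the
  current layer, and \<open>j\<close> layers are still to come. The value is the total predicted decrease of the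
  excess over the remaining layers plus the final excess. Its mean over the features never
  exceeds the current excess.\<close>

function descent_value ::
  "'p::finite split_rule \<Rightarrow> 'p sample \<Rightarrow> nat set \<Rightarrow> nat \<Rightarrow> ((real^'p) set \<Rightarrow> real) \<Rightarrow> ((real^'p) set \<Rightarrow> real)
    \<Rightarrow> nat \<Rightarrow> (real^'p) set list \<Rightarrow> (real^'p) set list \<Rightarrow> nat \<Rightarrow> (nat \<Rightarrow> 'p set) \<Rightarrow> real" where
  "descent_value sel D G t ex pr j Bs (A # As) k S =
     (if t \<le> k + 1 \<or> node_count D G A \<le> 1 then descent_value sel D G t ex pr j (Bs @ [A]) As k S
      else (let \<theta>s = sel (k + 1) (restrict D G) G A (S (k + 1)) in
        descent_value sel D G t ex pr j
          (Bs @ [daughter_le A (S (k + 1)) \<theta>s, daughter_gt A (S (k + 1)) \<theta>s]) As (k + 1) S))"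
| "descent_value sel D G t ex pr 0 Bs [] k S = (\<Sum>A\<leftarrow>Bs. ex A)"
| "descent_value sel D G t ex pr (Suc j) Bs [] k S =
     (\<Sum>A\<leftarrow>Bs. pr A) + descent_value sel D G t ex pr j [] Bs k S"
  by pat_completeness auto
termination
  by (relation "measures [\<lambda>(_, _, _, _, _, _, j, _, _, _, _). j, \<lambda>(_, _, _, _, _, _, _, _, As, _, _). length As]") auto

text \<open>Once \<open>k\<close> splits are made only later feature sets matter, which allows the
  set of the next split to be averaged separately from the rest.\<close>

lemma descent_value_cong:
  "(\<And>\<tau>. \<tau> > k \<Longrightarrow> S \<tau> = S' \<tau>) \<Longrightarrow>
    descent_value sel D G t ex pr j Bs As k S = descent_value sel D G t ex pr j Bs As k S'"
  by (induction sel D G t ex pr j Bs As k S rule: descent_value.induct) (simp_all add: Let_def)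

lemma descent_value_grow_layer:
  "descent_value sel D G t ex pr j Bs As k S
     = (case grow_layer sel D G S t As k of (Cs, k') \<Rightarrow> descent_value sel D G t ex pr j (Bs @ Cs) [] k' S)"
proof (induction As arbitrary: Bs k)
  case (Cons A As)
  show ?case
    using Cons.IH[of "Bs @ [A]" k] Cons.IH[of "Bs @ [_, _]" "Suc k"]
    by (simp add: Let_def case_prod_beta)
qed simp

text \<open>Unfolds the recursion along the rounds of \<open>odt_layer\<close>, so that a bound on
  the mean of \<open>descent_value\<close> becomes one on the trees themselves.\<close>

lemma descent_value_odt_layer:
  "(case odt_layer sel D G S t l of (Bs, k) \<Rightarrow> descent_value sel D G t ex pr j Bs [] k S)
     = (\<Sum>i<j. \<Sum>A\<leftarrow>fst (odt_layer sel D G S t (l + i)). pr A)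
       + (\<Sum>A\<leftarrow>fst (odt_layer sel D G S t (l + j)). ex A)"
proof (induction j arbitrary: l)
  case (Suc j)
  obtain Bs k where Bs: "odt_layer sel D G S t l = (Bs, k)" by fastforce
  have "descent_value sel D G t ex pr (Suc j) Bs [] k S
      = (\<Sum>A\<leftarrow>Bs. pr A) + descent_value sel D G t ex pr j [] Bs k S" by simp
  also have "descent_value sel D G t ex pr j [] Bs k S
      = (case odt_layer sel D G S t (Suc l) of (Cs, k') \<Rightarrow> descent_value sel D G t ex pr j Cs [] k' S)"
    by (subst descent_value_grow_layer) (simp add: Bs)
  also have "(\<Sum>A\<leftarrow>Bs. pr A) + \<dots> = (\<Sum>i<Suc j. \<Sum>A\<leftarrow>fst (odt_layer sel D G S t (l + i)). pr A)
       + (\<Sum>A\<leftarrow>fst (odt_layer sel D G S t (l + Suc j)). ex A)"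
    unfolding Suc.IH by (subst sum.lessThan_Suc_shift) (simp add: Bs)
  finally show ?case by (simp add: Bs)
qed (simp add: case_prod_beta)

lemma daughters_subset: "daughter_le A F \<theta>s \<subseteq> A" "daughter_gt A F \<theta>s \<subseteq> A"
  by (auto simp: daughter_le_def daughter_gt_def split: prod.splits)

text \<open>A supermartingale argument: the decrease \<open>u A\<close> is fixed before the feature
  set of \<open>A\<close> is drawn and is granted with probability \<open>pmf Q UNIV\<close>, so in
  mean every pending node loses \<open>pr A\<close>. The budget counts the leaves if all pending
  nodes and then all nodes of \<open>j\<close> further layers are split; hence the limit
  \<open>t\<close> never interrupts these layers. The induction is lexicographic in the layers left
  and the pending nodes.\<close>

lemma expectation_descent_value_le:
  fixes Q :: "'p::finite set pmf" and ex pr :: "(real^'p) set \<Rightarrow> real"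
  assumes Q: "pmf Q {} = 0"
    and leaf: "\<And>A. node_count D G A \<le> 1 \<Longrightarrow> pr A = 0"
    and split: "\<And>\<tau> A F. \<tau> \<in> {1..t - 1} \<Longrightarrow> A \<subseteq> cbox 0 1 \<Longrightarrow> node_count D G A \<ge> 2 \<Longrightarrow> F \<noteq> {} \<Longrightarrow>
      ex (daughter_le A F (sel \<tau> (restrict D G) G A F)) + ex (daughter_gt A F (sel \<tau> (restrict D G) G A F))
        \<le> ex A - (if F = UNIV then u A else 0)"
    and pr: "\<And>A. node_count D G A \<ge> 2 \<Longrightarrow> pr A = pmf Q UNIV * u A"
    and cube: "\<forall>A\<in>set Bs \<union> set As. A \<subseteq> cbox 0 1"
    and budget: "(length Bs + 2 * length As) * 2 ^ j \<le> t" and k: "k + 1 = length Bs + length As"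
  shows "measure_pmf.expectation (Pi_pmf {k+1..t-1} UNIV (\<lambda>_. Q)) (descent_value sel D G t ex pr j Bs As k)
    \<le> (\<Sum>A\<leftarrow>Bs. ex A) + (\<Sum>A\<leftarrow>As. ex A - pr A)"
  using cube budget k
proof (induction "(j, length As)" arbitrary: j Bs As k rule: wf_induct_rule[OF wf_lex_prod[OF wf_less_than wf_less_than]])
  case (1 j As Bs k)
  note IH = 1(1)
  let ?E = "measure_pmf.expectation (Pi_pmf {k+1..t-1} UNIV (\<lambda>_. Q)) :: ((nat \<Rightarrow> 'p set) \<Rightarrow> real) \<Rightarrow> real"
  let ?v = "descent_value sel D G t ex pr"
  show ?case
  proof (cases As)
    case Nil
    show ?thesis
    proof (cases j)
      case 0
      then have "?v j Bs As k = (\<lambda>_. \<Sum>A\<leftarrow>Bs. ex A)"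
        using Nil by (intro ext) simp
      then show ?thesis using Nil by (simp add: measure_pmf.prob_space)
    next
      case (Suc j')
      have fin: "integrable (measure_pmf (Pi_pmf {k+1..t-1} UNIV (\<lambda>_. Q))) h" for h :: "(nat \<Rightarrow> 'p set) \<Rightarrow> real"
        by (intro integrable_measure_pmf_finite) (simp add: set_Pi_pmf finite_PiE_dflt)
      have "?E (?v j Bs As k)
          = (\<Sum>A\<leftarrow>Bs. pr A) + ?E (?v j' [] Bs k)"
      proof -
        have "?v j Bs As k S
            = (\<Sum>A\<leftarrow>Bs. pr A) + ?v j' [] Bs k S" for S
          unfolding Nil Suc by (rule descent_value.simps)
        then have "?v j Bs As k
            = (\<lambda>S. (\<Sum>A\<leftarrow>Bs. pr A) + ?v j' [] Bs k S)" ..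
        then have "?E (?v j Bs As k)
            = ?E (\<lambda>S. (\<Sum>A\<leftarrow>Bs. pr A) + ?v j' [] Bs k S)" by (rule arg_cong[where f = "?E"])
        also have "\<dots> = ?E (\<lambda>_. \<Sum>A\<leftarrow>Bs. pr A)
            + ?E (?v j' [] Bs k)"
          by (rule Bochner_Integration.integral_add[OF fin fin])
        also have "?E (\<lambda>_. \<Sum>A\<leftarrow>Bs. pr A)
            = (\<Sum>A\<leftarrow>Bs. pr A)" by (simp add: measure_pmf.prob_space)
        finally show ?thesis .
      qed
      also have "?E (?v j' [] Bs k)
          \<le> (\<Sum>A\<leftarrow>[]. ex A) + (\<Sum>A\<leftarrow>Bs. ex A - pr A)"
        using 1(2-4) Nil Suc by (intro IH) (auto simp: algebra_simps)
      finally show ?thesis by (simp add: Nil sum_list_subtractf)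
    qed
  next
    case (Cons A As')
      \<comment> \<open>\<open>k + 1\<close> is the number of present nodes; the budget counts the
        pending ones twice, and there is at least one.\<close>
      have kt: "k + 1 < t"
    proof -
      have "(length Bs + 2 * length As) * 1 \<le> (length Bs + 2 * length As) * 2 ^ j"
        by (intro mult_left_mono) auto
      then show ?thesis using 1(3,4) Cons by simp
    qed
    show ?thesis
    proof (cases "node_count D G A \<le> 1")
      case True
      then have "?v j Bs As k = ?v j (Bs @ [A]) As' k"
        using Cons by (intro ext) simp
      moreover have "?E (?v j (Bs @ [A]) As' k) \<le> (\<Sum>A\<leftarrow>Bs @ [A]. ex A) + (\<Sum>A\<leftarrow>As'. ex A - pr A)"
      proof (rule IH)
        have "(length (Bs @ [A]) + 2 * length As') * 2 ^ j \<le> (length Bs + 2 * length As) * 2 ^ j"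
          using Cons by (intro mult_right_mono) auto
        then show "(length (Bs @ [A]) + 2 * length As') * 2 ^ j \<le> t" using 1(3) by simp
      qed (use 1(2,4) Cons in auto)
      ultimately show ?thesis using leaf[OF True] Cons by simp
    next
      case False
      define d1 where "d1 F = daughter_le A F (sel (k + 1) (restrict D G) G A F)" for F
      define d2 where "d2 F = daughter_gt A F (sel (k + 1) (restrict D G) G A F)" for F
      define E where "E F = measure_pmf.expectation (Pi_pmf {k+2..t-1} UNIV (\<lambda>_. Q))
            (?v j (Bs @ [d1 F, d2 F]) As' (k + 1))" for F
      define R where "R = (\<Sum>A\<leftarrow>Bs. ex A) + (\<Sum>A\<leftarrow>As'. ex A - pr A)"
      have A: "A \<subseteq> cbox 0 1" using 1(2) Cons by simp
      have E_le: "E F \<le> R + ex A - (if F = UNIV then u A else 0)" if "F \<noteq> {}" for F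
      proof -
        have "E F \<le> (\<Sum>A\<leftarrow>Bs @ [d1 F, d2 F]. ex A) + (\<Sum>A\<leftarrow>As'. ex A - pr A)"
        proof -
          have sub: "d1 F \<subseteq> cbox 0 1" "d2 F \<subseteq> cbox 0 1"
            unfolding d1_def d2_def by (rule order_trans[OF daughters_subset(1) A] order_trans[OF daughters_subset(2) A])+
          have suc: "k + 1 + 1 = k + 2" by simp
          show ?thesis
            unfolding E_def suc[symmetric]
          proof (rule IH)
            show "((j, length As'), (j, length As)) \<in> less_than <*lex*> less_than" using Cons by simp
            show "\<forall>A\<in>set (Bs @ [d1 F, d2 F]) \<union> set As'. A \<subseteq> cbox 0 1" using 1(2) Cons sub by simp
          qed (use 1(3,4) Cons in auto)
        qed
        moreover have "ex (d1 F) + ex (d2 F) \<le> ex A - (if F = UNIV then u A else 0)"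
          unfolding d1_def d2_def using kt A False that by (intro split) auto
        ultimately show ?thesis by (simp add: R_def)
      qed
      \<comment> \<open>Separates the feature set of split \<open>k + 1\<close>, the one applied to
        \<open>A\<close>.\<close>
      have "{k+1..t-1} = insert (k+1) {k+2..t-1}" using kt by auto
      then have "?E (?v j Bs As k)
          = (\<Sum>F\<in>UNIV. pmf Q F * measure_pmf.expectation (Pi_pmf {k+2..t-1} UNIV (\<lambda>_. Q))
              (\<lambda>S. ?v j Bs As k (S(k + 1 := F))))"
        by (simp add: expectation_Pi_pmf_insert)
      also have "\<dots> = (\<Sum>F\<in>UNIV. pmf Q F * E F)"
      proof (intro sum.cong refl, unfold E_def, intro arg_cong2[of _ _ _ _ "(*)"] refl Bochner_Integration.integral_cong)
        fix F S
        show "?v j Bs As k (S(k + 1 := F))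
            = ?v j (Bs @ [d1 F, d2 F]) As' (k + 1) S"
          using False kt descent_value_cong[of "k + 1" "S(k + 1 := F)" S]
          by (simp add: Cons Let_def d1_def d2_def)
      qed
      \<comment> \<open>For \<open>F = {}\<close> there is no bound on \<open>E F\<close>, but its
        weight is zero.\<close>
      also have "\<dots> \<le> (\<Sum>F\<in>UNIV. pmf Q F * (R + ex A - (if F = UNIV then u A else 0)))"
        using E_le Q by (intro sum_mono) (metis mult_left_mono mult_zero_left order_refl pmf_nonneg)
      also have "\<dots> = (\<Sum>F\<in>UNIV. pmf Q F) * (R + ex A) - pmf Q UNIV * u A"
        by (simp add: right_diff_distrib sum_subtractf sum_distrib_right if_distrib[of "(*) _"] cong: if_cong)
      also have "(\<Sum>F\<in>UNIV. pmf Q F) = 1" by (rule sum_pmf_eq_1) auto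
      finally have "?E (?v j Bs As k)
          \<le> R + ex A - pmf Q UNIV * u A" by (simp only: mult_1)
      also have "R + ex A - pmf Q UNIV * u A = (\<Sum>A\<leftarrow>Bs. ex A) + (\<Sum>A\<leftarrow>As. ex A - pr A)"
        using pr[of A] False Cons by (simp add: R_def)
      finally show ?thesis .
    qed
  qed
qed

section \<open>Passing from sums over leaves to sums over data points\<close>

lemma sum_list_member_grow_layer:
  fixes x :: "real^'p::finite"
  shows "(\<Sum>A\<leftarrow>fst (grow_layer sel D G S t As k). of_bool (x \<in> A)) = (\<Sum>A\<leftarrow>As. of_bool (x \<in> A) :: nat)"
proof (induction As arbitrary: k)
  case (Cons A As)
  have "of_bool (x \<in> daughter_le A F \<theta>s) + of_bool (x \<in> daughter_gt A F \<theta>s) = (of_bool (x \<in> A) :: nat)" for F \<theta>s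
    by (cases \<theta>s) (auto simp: daughter_le_def daughter_gt_def)
  then show ?case
    using Cons.IH[of k] Cons.IH[of "Suc k"] by (simp add: Let_def case_prod_beta flip: add.assoc)
qed simp

lemma sum_list_member_odt_layer:
  "(\<Sum>A\<leftarrow>fst (odt_layer sel D G S t l). of_bool (x \<in> A)) = (of_bool (x \<in> cbox 0 1) :: nat)"
  by (induction l) (simp_all add: case_prod_beta sum_list_member_grow_layer)

text \<open>The hypothesis says that exactly one entry of the list contains \<open>x\<close>. It is
  a count rather than disjointness because degenerate splits may put the empty set into the list
  several times.\<close>

lemma sum_list_find:
  fixes \<phi> :: "'a set \<Rightarrow> 'b::comm_monoid_add"
  assumes "(\<Sum>A\<leftarrow>As. of_bool (x \<in> A)) = (1 :: nat)"
  shows "(\<Sum>A\<leftarrow>As. if x \<in> A then \<phi> A else 0) = (case find (\<lambda>A. x \<in> A) As of None \<Rightarrow> 0 | Some A \<Rightarrow> \<phi> A)"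
  using assms
proof (induction As)
  case (Cons A As)
  show ?case
  proof (cases "x \<in> A")
    case True
    then have "(\<Sum>A\<leftarrow>As. of_bool (x \<in> A)) = (0 :: nat)" using Cons.prems by simp
    then have "\<forall>A\<in>set As. x \<notin> A" by (induction As) auto
    then have "(\<Sum>A\<leftarrow>As. if x \<in> A then \<phi> A else 0) = 0" by (induction As) auto
    then show ?thesis using True by simp
  qed (use Cons in simp)
qed simp

lemma sum_list_sum_node_points:
  fixes h :: "(real^'p::finite) set \<Rightarrow> nat \<Rightarrow> 'b::comm_monoid_add"
  assumes "finite G"
  shows "(\<Sum>A\<leftarrow>As. \<Sum>i\<in>node_points D G A. h A i)
    = (\<Sum>i\<in>G. \<Sum>A\<leftarrow>As. if fst (D i) \<in> A then h A i else 0)"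
  using assms by (induction As) (simp_all add: node_points_def sum.inter_filter sum.distrib)

lemma sum_list_node_count_odt_layer_le:
  assumes "finite G"
  shows "(\<Sum>A\<leftarrow>fst (odt_layer sel D G S t l). node_count D G A) \<le> card G"
proof -
  have "(\<Sum>A\<leftarrow>fst (odt_layer sel D G S t l). node_count D G A)
      = (\<Sum>i\<in>G. \<Sum>A\<leftarrow>fst (odt_layer sel D G S t l). of_bool (fst (D i) \<in> A))"
    using sum_list_sum_node_points[OF assms, where D = D and h = "\<lambda>_ _. 1 :: nat"]
    by (simp add: node_count_def of_bool_def)
  also have "\<dots> \<le> card G"
    using sum_bounded_above[of G _ "1 :: nat"] by (simp add: sum_list_member_odt_layer)
  finally show ?thesis .
qed

text \<open>The general \<open>\<phi>\<close> serves twice: for the squared residuals of the tree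
  and, constant in its second argument, for those of \<open>f\<close>.\<close>

lemma sum_list_odt_leaves:
  fixes D :: "'p::finite sample" and \<phi> :: "nat \<Rightarrow> real \<Rightarrow> real"
  assumes "finite G" "\<And>i. i \<in> G \<Longrightarrow> fst (D i) \<in> cbox 0 1"
  shows "(\<Sum>A\<leftarrow>odt_leaves sel D G S t. \<Sum>i\<in>node_points D G A. \<phi> i (node_mean D G A))
    = (\<Sum>i\<in>G. \<phi> i (odt_estimator sel D G S t (fst (D i))))"
proof -
  let ?L = "odt_leaves sel D G S t"
  have one: "(\<Sum>A\<leftarrow>?L. of_bool (fst (D i) \<in> A)) = (1 :: nat)" if "i \<in> G" for i
    using assms(2)[OF that] by (simp add: odt_leaves_eq_odt_layer sum_list_member_odt_layer)
  have found: "find (\<lambda>A. fst (D i) \<in> A) ?L \<noteq> None" if "i \<in> G" for i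
  proof
    assume "find (\<lambda>A. fst (D i) \<in> A) ?L = None"
    then have "(\<Sum>A\<leftarrow>?L. of_bool (fst (D i) \<in> A)) = (\<Sum>A\<leftarrow>?L. 0 :: nat)"
      by (intro arg_cong[of _ _ sum_list] map_cong) (auto simp: find_None_iff)
    then show False using one[OF that] by simp
  qed
  show ?thesis
    unfolding sum_list_sum_node_points[OF assms(1)]
    by (intro sum.cong refl)
      (use found in \<open>force simp: sum_list_find one odt_estimator_def split: option.split\<close>)
qed

lemma sum_list_node_excess_grow_layer_le:
  assumes "finite G"
  shows "(\<Sum>A\<leftarrow>fst (grow_layer sel D G S t As k). node_excess D G f A) \<le> (\<Sum>A\<leftarrow>As. node_excess D G f A)"
proof (induction As arbitrary: k)
  case (Cons A As)
  show ?case
    using Cons.IH[of k] Cons.IH[of "Suc k"]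
      node_excess_daughters_le[OF assms, of D f A "S (Suc k)" "sel (Suc k) (restrict D G) G A (S (Suc k))"]
    by (simp add: Let_def case_prod_beta)
qed simp

lemma sum_list_node_excess_odt_layer_antimono:
  assumes "finite G" "l \<le> l'"
  shows "(\<Sum>A\<leftarrow>fst (odt_layer sel D G S t l'). node_excess D G f A)
    \<le> (\<Sum>A\<leftarrow>fst (odt_layer sel D G S t l). node_excess D G f A)"
  using assms(2)
proof (induction rule: dec_induct)
  case (step l')
  then show ?case
    using sum_list_node_excess_grow_layer_le[OF assms(1), where As = "fst (odt_layer sel D G S t l')"
        and k = "snd (odt_layer sel D G S t l')" and sel = sel and D = D and S = S and t = t and f = f] by (simp add: case_prod_beta)
qed simp

text \<open>Cauchy-Schwarz with weights \<open>node_count\<close>, in tangent form: each node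
  satisfies \<open>e\<^sup>2 / N \<ge> 2 * b * e - b\<^sup>2 * N\<close>, and \<open>b\<close> is
  the best common slope. For empty nodes the excess and the quotient by zero are both
  \<open>0\<close>.\<close>

lemma sum_list_excess_squares_ge:
  assumes "finite G" "G \<noteq> {}" and cnt: "(\<Sum>A\<leftarrow>As. node_count D G A) \<le> card G"
  shows "(max 0 (\<Sum>A\<leftarrow>As. node_excess D G f A))\<^sup>2 / real (card G)
    \<le> (\<Sum>A\<leftarrow>As. (max 0 (node_excess D G f A))\<^sup>2 / real (node_count D G A))"
proof -
  define e where "e A = max 0 (node_excess D G f A)" for A
  define X where "X = max 0 (\<Sum>A\<leftarrow>As. node_excess D G f A)"
  define b where "b = X / real (card G)"
  have G: "card G > 0" using assms by (simp add: card_gt_0_iff)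
  have b: "b \<ge> 0" by (simp add: b_def X_def)
  have term_ge: "2 * b * e A - b\<^sup>2 * real (node_count D G A) \<le> (e A)\<^sup>2 / real (node_count D G A)" for A
  proof (cases "node_count D G A = 0")
    case True
    then have "node_points D G A = {}" using assms(1) by (simp add: node_count_def)
    then have "e A = 0" by (simp add: e_def node_excess_def node_sse_def)
    then show ?thesis using True by simp
  next
    case False
    then have N: "real (node_count D G A) > 0" by simp
    have "0 \<le> (e A - b * real (node_count D G A))\<^sup>2" by simp
    then show ?thesis using N by (simp add: field_simps power2_eq_square)
  qed
  have "(\<Sum>A\<leftarrow>As. node_excess D G f A) \<le> (\<Sum>A\<leftarrow>As. e A)"
    by (intro sum_list_mono) (simp add: e_def)
  moreover have "0 \<le> (\<Sum>A\<leftarrow>As. e A)" by (intro sum_list_nonneg) (auto simp: e_def)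
  ultimately have X_le: "X \<le> (\<Sum>A\<leftarrow>As. e A)" by (simp add: X_def)
  have "X\<^sup>2 / real (card G) = 2 * b * X - b\<^sup>2 * real (card G)"
    using G by (simp add: b_def field_simps power2_eq_square)
  also have "\<dots> \<le> 2 * b * (\<Sum>A\<leftarrow>As. e A) - b\<^sup>2 * real (\<Sum>A\<leftarrow>As. node_count D G A)"
    using X_le b cnt by (intro diff_mono mult_left_mono) auto
  also have "\<dots> = (\<Sum>A\<leftarrow>As. 2 * b * e A - b\<^sup>2 * real (node_count D G A))"
    by (simp add: sum_list_subtractf sum_list_const_mult o_def flip: sum_list_of_nat)
  also have "\<dots> \<le> (\<Sum>A\<leftarrow>As. (e A)\<^sup>2 / real (node_count D G A))"
    by (intro sum_list_mono term_ge)
  finally show ?thesis by (simp add: X_def e_def)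
qed

text \<open>The total excess never increases from layer to layer, so each of the \<open>L\<close>
  complete layers predicts a decrease of at least
  \<open>q * (max 0 (X S))\<^sup>2 / (a * V\<^sup>2)\<close>, where \<open>X S\<close> is the final
  excess. The predictions cannot exceed the initial error in mean, which bounds the second moment of
  the positive part of the final excess; \<open>\<eta>\<close> converts this into a bound on its
  mean.\<close>

lemma expected_training_error_le:
  fixes Q :: "'p::finite set pmf" and D :: "'p sample"
  assumes H: "finite H" "H \<noteq> {}" and cube: "\<And>i. i \<in> H \<Longrightarrow> fst (D i) \<in> cbox 0 1"
    and Q: "pmf Q {} = 0" "pmf Q UNIV > 0"
    and sel: "\<And>\<tau> A F. \<tau> \<in> {1..t - 1} \<Longrightarrow> A \<subseteq> cbox 0 1 \<Longrightarrow> F \<noteq> {} \<Longrightarrow> node_count D H A \<ge> 2 \<Longrightarrow>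
      split_maximizer D H A F (sel \<tau> (restrict D H) H A F)"
    and f: "f = ridge_step c0 ps" and unit: "\<And>c \<theta> s. (c, \<theta>, s) \<in> set ps \<Longrightarrow> norm \<theta> = 1"
    and V: "(\<Sum>(c, \<theta>, s)\<leftarrow>ps. \<bar>c\<bar>) \<le> V" "V > 0"
    and L: "2 ^ L \<le> t" "L > 0" and \<eta>: "\<eta> > 0"
  shows "measure_pmf.expectation (Pi_pmf {1..t-1} UNIV (\<lambda>_. Q))
       (\<lambda>S. \<Sum>i\<in>H. (snd (D i) - odt_estimator sel D H S t (fst (D i)))\<^sup>2)
     \<le> (\<Sum>i\<in>H. (snd (D i) - f (fst (D i)))\<^sup>2) + real (card H) * \<eta>
       + V\<^sup>2 / (4 * \<eta> * pmf Q UNIV * real L) * (\<Sum>i\<in>H. (snd (D i))\<^sup>2)"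
proof -
  define q where "q = pmf Q UNIV"
  define a where "a = real (card H)"
  define ex where "ex = node_excess D H f"
  define u where "u A = (max 0 (ex A))\<^sup>2 / (real (node_count D H A) * V\<^sup>2)" for A
  define pr where "pr A = q * u A" for A
  define P where "P = Pi_pmf {1..t-1} (UNIV :: 'p set) (\<lambda>_. Q)"
  define layer where "layer S l = fst (odt_layer sel D H S t l)" for S l
  define X where "X S = (\<Sum>A\<leftarrow>odt_leaves sel D H S t. ex A)" for S
  define Ef where "Ef = (\<Sum>i\<in>H. (snd (D i) - f (fst (D i)))\<^sup>2)"
  define EY where "EY = (\<Sum>i\<in>H. (snd (D i))\<^sup>2)"
  have q: "q > 0" using Q by (simp add: q_def)
  have a: "a > 0" using H by (simp add: a_def card_gt_0_iff)
  have int [simp]: "integrable (measure_pmf P) h" for h :: "(nat \<Rightarrow> 'p set) \<Rightarrow> real"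
    unfolding P_def by (intro integrable_measure_pmf_finite) (simp add: set_Pi_pmf finite_PiE_dflt)
  have Lt: "L \<le> t" using L(1) less_exp[of L] by linarith
  have X_eq: "X S = (\<Sum>i\<in>H. (snd (D i) - odt_estimator sel D H S t (fst (D i)))\<^sup>2) - Ef" for S
    using sum_list_odt_leaves[OF H(1) cube, where \<phi> = "\<lambda>i m. (snd (D i) - m)\<^sup>2"]
      sum_list_odt_leaves[OF H(1) cube, where \<phi> = "\<lambda>i _. (snd (D i) - f (fst (D i)))\<^sup>2"]
    by (simp add: X_def ex_def node_excess_def node_sse_def sum_list_subtractf Ef_def)
  have X_le: "X S \<le> (\<Sum>A\<leftarrow>layer S l. ex A)" if "l \<le> t" for S l
    using sum_list_node_excess_odt_layer_antimono[OF H(1) that]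
    by (simp add: X_def ex_def layer_def odt_leaves_eq_odt_layer)
  have value_ge: "q * real L * (max 0 (X S))\<^sup>2 / (a * V\<^sup>2) + X S
      \<le> descent_value sel D H t ex pr L [cbox 0 1] [] 0 S" for S
  proof -
    have "q * (max 0 (X S))\<^sup>2 / (a * V\<^sup>2) \<le> (\<Sum>A\<leftarrow>layer S l. pr A)" if "l < L" for l
    proof -
      have "(max 0 (X S))\<^sup>2 / a \<le> (max 0 (\<Sum>A\<leftarrow>layer S l. ex A))\<^sup>2 / a"
        using X_le[of l S] that Lt a by (intro divide_right_mono power_mono) auto
      also have "\<dots> \<le> (\<Sum>A\<leftarrow>layer S l. (max 0 (ex A))\<^sup>2 / real (node_count D H A))"
        unfolding a_def ex_def layer_def
        by (intro sum_list_excess_squares_ge H sum_list_node_count_odt_layer_le)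
      finally have "q / V\<^sup>2 * ((max 0 (X S))\<^sup>2 / a)
          \<le> q / V\<^sup>2 * (\<Sum>A\<leftarrow>layer S l. (max 0 (ex A))\<^sup>2 / real (node_count D H A))"
        using q by (intro mult_left_mono) auto
      also have "\<dots> = (\<Sum>A\<leftarrow>layer S l. pr A)"
        unfolding sum_list_const_mult[symmetric] pr_def u_def
        by (intro arg_cong[of _ _ sum_list] map_cong) (auto simp: field_simps)
      finally show ?thesis by (simp add: field_simps)
    qed
    then have "(\<Sum>l<L. q * (max 0 (X S))\<^sup>2 / (a * V\<^sup>2)) \<le> (\<Sum>l<L. \<Sum>A\<leftarrow>layer S l. pr A)"
      by (intro sum_mono) auto
    then show ?thesis
      using descent_value_odt_layer[where l = 0 and j = L and sel = sel and D = D and G = H and S = S and t = t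
        and ex = ex and pr = pr] X_le[OF Lt, of S]
      by (simp add: layer_def mult.commute mult.left_commute)
  qed
  have "measure_pmf.expectation P (descent_value sel D H t ex pr L [cbox 0 1] [] 0)
      \<le> (\<Sum>A\<leftarrow>[cbox 0 1]. ex A) + (\<Sum>A\<leftarrow>[]. ex A - pr A)"
    unfolding P_def
  proof (rule expectation_descent_value_le[where k = 0, simplified add_0])
    \<comment> \<open>At most one point is fitted exactly, so the excess is not positive and no
      decrease is predicted.\<close>
    fix A assume "node_count D H A \<le> 1"
    have "ex A \<le> 0"
    proof -
      have "node_sse D H A = 0"
      proof (cases "node_count D H A = 0")
        case False
        then have "card (node_points D H A) = 1" using \<open>node_count D H A \<le> 1\<close> by (simp add: node_count_def)
        then obtain i where "node_points D H A = {i}" by (auto simp: card_1_singleton_iff)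
        then show ?thesis by (simp add: node_sse_def node_mean_def node_count_def)
      qed (use H in \<open>simp add: node_sse_def node_count_def\<close>)
      then show ?thesis by (simp add: ex_def node_excess_def sum_nonneg)
    qed
    then show "pr A = 0" by (simp add: pr_def u_def)
  next
    fix \<tau> and A :: "(real^'p) set" and F :: "'p set"
    assume *: "\<tau> \<in> {1..t - 1}" "A \<subseteq> cbox 0 1" "2 \<le> node_count D H A" "F \<noteq> {}"
    let ?\<theta>s = "sel \<tau> (restrict D H) H A F"
    show "ex (daughter_le A F ?\<theta>s) + ex (daughter_gt A F ?\<theta>s) \<le> ex A - (if F = UNIV then u A else 0)"
    proof (cases "F = UNIV")
      case True
      then show ?thesis
        using node_excess_decrease[OF H(1) _ f unit V, where A = A and D = D and \<theta>s = ?\<theta>s] sel[OF *(1,2,4,3)] *(3)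
        by (simp add: ex_def u_def)
    next
      case False
      then show ?thesis using node_excess_daughters_le[OF H(1)] by (simp add: ex_def)
    qed
  qed (use Q L in \<open>auto simp: pr_def q_def\<close>)
  then have "measure_pmf.expectation P (\<lambda>S. q * real L * (max 0 (X S))\<^sup>2 / (a * V\<^sup>2) + X S) \<le> ex (cbox 0 1)"
    by (intro order_trans[OF integral_mono[OF int int value_ge]]) simp
  \<comment> \<open>The mean at the root fits at least as well as the constant
    \<open>0\<close>.\<close>
  also have "ex (cbox 0 1) \<le> EY - Ef"
  proof -
    have "node_points D H (cbox 0 1) = H" using cube by (auto simp: node_points_def)
    then show ?thesis
      using node_sse_le[OF H(1), of D "cbox 0 1" 0] by (simp add: ex_def node_excess_def EY_def Ef_def)
  qed
  finally have main: "q * real L / (a * V\<^sup>2) * measure_pmf.expectation P (\<lambda>S. (max 0 (X S))\<^sup>2)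
      + measure_pmf.expectation P X \<le> EY - Ef"
    by simp
  \<comment> \<open>The training error of the tree is nonnegative; this removes \<open>Ef\<close>
    from the bound.\<close>
  have "- Ef \<le> X S" for S unfolding X_eq by (simp add: sum_nonneg)
  then have "measure_pmf.expectation P (\<lambda>_. - Ef) \<le> measure_pmf.expectation P X"
    by (intro integral_mono) auto
  then have "q * real L / (a * V\<^sup>2) * measure_pmf.expectation P (\<lambda>S. (max 0 (X S))\<^sup>2) \<le> EY"
    using main by (simp add: measure_pmf.prob_space)
  then have square: "measure_pmf.expectation P (\<lambda>S. (max 0 (X S))\<^sup>2) \<le> a * V\<^sup>2 / (q * real L) * EY"
    using q a L V by (simp add: field_simps)
  \<comment> \<open>Young's inequality, weighted so that its constant term becomes
    \<open>\<eta>\<close> after division by \<open>a\<close>.\<close>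
  have "X S \<le> a * \<eta> + (max 0 (X S))\<^sup>2 / (4 * a * \<eta>)" for S
  proof -
    define y where "y = max 0 (X S)"
    have "0 \<le> (y - 2 * (a * \<eta>))\<^sup>2" by simp
    then have "y * (4 * a * \<eta>) \<le> (a * \<eta>) * (4 * a * \<eta>) + y\<^sup>2"
      by (simp add: power2_eq_square algebra_simps)
    then have "y \<le> a * \<eta> + y\<^sup>2 / (4 * a * \<eta>)" using a \<eta> by (simp add: field_simps)
    then show ?thesis by (simp add: y_def)
  qed
  then have "measure_pmf.expectation P X
      \<le> measure_pmf.expectation P (\<lambda>S. a * \<eta> + (max 0 (X S))\<^sup>2 / (4 * a * \<eta>))"
    by (intro integral_mono) auto
  also have "\<dots> = a * \<eta> + measure_pmf.expectation P (\<lambda>S. (max 0 (X S))\<^sup>2) / (4 * a * \<eta>)"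
    by (simp add: measure_pmf.prob_space)
  also have "\<dots> \<le> a * \<eta> + (a * V\<^sup>2 / (q * real L) * EY) / (4 * a * \<eta>)"
    using square a \<eta> by (intro add_left_mono divide_right_mono) auto
  also have "\<dots> = a * \<eta> + V\<^sup>2 / (4 * \<eta> * q * real L) * EY"
    using a by (simp add: field_simps)
  finally have "measure_pmf.expectation P X \<le> a * \<eta> + V\<^sup>2 / (4 * \<eta> * q * real L) * EY" .
  moreover have "measure_pmf.expectation P X
      = measure_pmf.expectation P (\<lambda>S. \<Sum>i\<in>H. (snd (D i) - odt_estimator sel D H S t (fst (D i)))\<^sup>2) - Ef"
    by (simp add: X_eq[abs_def] measure_pmf.prob_space)
  ultimately show ?thesis by (simp add: P_def a_def q_def EY_def Ef_def)
qed

section \<open>Deviation between theoretical and empirical risk\<close>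

text \<open>The number of sign patterns times the bound on \<open>tree_labels\<close> for the
  \<open>2 * a\<close> points of a sample and its ghost copy; \<open>d\<close> is the
  dimension.\<close>

definition tree_class_bound :: "nat \<Rightarrow> nat \<Rightarrow> nat \<Rightarrow> real" where
  "tree_class_bound d a t = 2 ^ t * real (t * (t * (2 * a + 1) ^ (d + 1)) ^ t)"

lemma two_le_tree_class_bound:
  assumes "t \<ge> 1"
  shows "2 \<le> tree_class_bound d a t"
proof -
  have "(2::real) ^ 1 \<le> 2 ^ t" using assms by (intro power_increasing) auto
  moreover have "1 \<le> t * (t * (2 * a + 1) ^ (d + 1)) ^ t"
    using assms by (simp add: Suc_le_eq)
  then have "1 \<le> real (t * (t * (2 * a + 1) ^ (d + 1)) ^ t)"
    by (metis of_nat_1 of_nat_le_iff)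
  ultimately have "2 * 1 \<le> (2::real) ^ t * real (t * (t * (2 * a + 1) ^ (d + 1)) ^ t)"
    by (intro mult_mono) auto
  then show ?thesis by (simp add: tree_class_bound_def)
qed

text \<open>The value \<open>sqrt (L / (2 * a)) / b\<close> in place of \<open>l\<close> makes the
  terms \<open>L / l\<close> and \<open>l * (2 * b)\<^sup>2 * a / 2\<close> equal.\<close>

lemma optimize_rademacher:
  fixes L a b :: real
  assumes "L > 0" "a > 0" "b > 0"
  shows "L / (sqrt (L / (2 * a)) / b) + sqrt (L / (2 * a)) / b * (2 * b)\<^sup>2 * a / 2 = 2 * b * sqrt (2 * a * L)"
proof -
  define x where "x = sqrt (L / (2 * a))"
  have x: "x > 0" "L = 2 * a * x\<^sup>2" using assms by (auto simp: x_def)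
  have "sqrt (2 * a * L) = 2 * a * x"
    using x assms by (intro real_sqrt_unique) (auto simp: power2_eq_square)
  moreover have "L / (x / b) + x / b * (2 * b)\<^sup>2 * a / 2 = 4 * a * b * x"
    using x assms by (simp add: field_simps power2_eq_square)
  ultimately show ?thesis by (simp add: x_def)
qed

text \<open>The squared error minus \<open>y\<^sup>2\<close>. The omitted term does not depend on
  \<open>g\<close> and has the same mean on training and test data.\<close>

definition excess_loss :: "(real^'p \<Rightarrow> real) \<Rightarrow> (real^'p::finite) \<times> real \<Rightarrow> real" where
  "excess_loss g = (\<lambda>(x, y). (g x)\<^sup>2 - 2 * y * g x)"

text \<open>\<open>W\<close> holds two copies of every observation. The copy \<open>True\<close> is
  used for training at the indices in \<open>T\<close>, the copy \<open>False\<close> elsewhere; the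
  copy left out is the ghost observation.\<close>

definition swap_sample :: "nat \<Rightarrow> nat set \<Rightarrow> (nat \<times> bool \<Rightarrow> 'z) \<Rightarrow> nat \<Rightarrow> 'z" where
  "swap_sample n T W = (\<lambda>i\<in>{1..n}. W (i, i \<in> T))"

text \<open>For a fixed double sample a swap changes both the signs and the tree; the second effect
  is harmless because all these trees take their labellings from the one set \<open>Labs\<close>.
  The linear and the quadratic part of the loss each cost \<open>2 * \<beta>\<^sup>2\<close> times
  the root, and the linear part enters twice: this is the factor \<open>6\<close>.\<close>

lemma sum_swapped_excess_loss_le:
  fixes W :: "nat \<times> bool \<Rightarrow> (real^'p::finite) \<times> real" and sel :: "'p split_rule" and R :: "nat \<Rightarrow> 'p set"
  assumes H: "H \<subseteq> {1..n}" "H \<noteq> {}" and t: "t \<ge> 1"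
    and \<beta>: "\<And>i b. i \<in> H \<Longrightarrow> \<bar>snd (W (i, b))\<bar> \<le> \<beta>" "\<beta> > 0"
  defines "est \<equiv> \<lambda>T. odt_estimator sel (swap_sample n T W) H R t"
    and "L \<equiv> ln (tree_class_bound CARD('p) (card H) t)"
  shows "(\<Sum>T\<in>Pow H. \<Sum>i\<in>H. excess_loss (est T) (W (i, i \<notin> T)) - excess_loss (est T) (W (i, i \<in> T)))
    \<le> 2 ^ card H * (6 * \<beta>\<^sup>2 * sqrt (2 * real (card H) * L))"
proof -
  define N where "N = tree_class_bound CARD('p) (card H) t"
  define I where "I = H \<times> (UNIV :: bool set)"
  define Labs where "Labs = tree_labels (\<lambda>j. fst (W j)) I t"
  define l where "l = sqrt (L / (2 * real (card H))) / \<beta>\<^sup>2"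
  have "finite H" using H finite_subset by blast
  then have fin: "finite H" "finite I" by (auto simp: I_def)
  have a: "real (card H) > 0" using H fin by (simp add: card_gt_0_iff)
  have N2: "N \<ge> 2" unfolding N_def by (rule two_le_tree_class_bound[OF t])
  then have L: "L > 0" by (simp add: L_def N_def)
  then have l: "l > 0" using a \<beta>(2) by (simp add: l_def)
  have "\<exists>lab val. lab \<in> Labs \<and> (\<forall>m. \<bar>val m\<bar> \<le> \<beta>) \<and>
      (\<forall>j\<in>I. est T (fst (W j)) = (case lab j of None \<Rightarrow> 0 | Some m \<Rightarrow> val m))" if "T \<subseteq> H" for T
  proof -
    have "\<bar>snd (swap_sample n T W i)\<bar> \<le> \<beta>" if "i \<in> H" for i
      using \<beta>(1)[OF that] H that by (auto simp: swap_sample_def)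
    then obtain la v where "la \<in> tree_labels (\<lambda>j. fst (W j)) I t" "\<And>m. \<bar>v m\<bar> \<le> \<beta>"
      "\<And>j. j \<in> I \<Longrightarrow> odt_estimator sel (swap_sample n T W) H R t (fst (W j))
          = (case la j of None \<Rightarrow> 0 | Some m \<Rightarrow> v m)"
      by (rule odt_estimator_tree_labels[OF t _ less_imp_le[OF \<beta>(2)], where x = "\<lambda>j. fst (W j)"
            and I = I and sel = sel and S = R]) auto
    then show ?thesis unfolding Labs_def est_def by (intro exI[of _ la] exI[of _ v]) auto
  qed
  then obtain lab where "\<forall>T\<in>Pow H. \<exists>val. lab T \<in> Labs \<and> (\<forall>m. \<bar>val m\<bar> \<le> \<beta>) \<and>
      (\<forall>j\<in>I. est T (fst (W j)) = (case lab T j of None \<Rightarrow> 0 | Some m \<Rightarrow> val m))"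
    using bchoice[of "Pow H" "\<lambda>T lab. \<exists>val. lab \<in> Labs \<and> (\<forall>m. \<bar>val m\<bar> \<le> \<beta>) \<and>
      (\<forall>j\<in>I. est T (fst (W j)) = (case lab j of None \<Rightarrow> 0 | Some m \<Rightarrow> val m))"] by blast
  from bchoice[OF this] obtain val where lab_val: "\<forall>T\<in>Pow H. lab T \<in> Labs \<and> (\<forall>m. \<bar>val T m\<bar> \<le> \<beta>) \<and>
      (\<forall>j\<in>I. est T (fst (W j)) = (case lab T j of None \<Rightarrow> 0 | Some m \<Rightarrow> val T m))" by blast
  then have lab: "lab T \<in> Labs" and val: "\<bar>val T m\<bar> \<le> \<beta>"
    and est: "j \<in> I \<Longrightarrow> est T (fst (W j)) = (case lab T j of None \<Rightarrow> 0 | Some m \<Rightarrow> val T m)"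
    if "T \<subseteq> H" for T m j
    using that by blast+
  have "card I = 2 * card H" by (simp add: I_def card_cartesian_product)
  then have "card Labs \<le> t * (t * (2 * card H + 1) ^ (CARD('p) + 1)) ^ t"
    using card_tree_labels_le[OF fin(2) t, of "\<lambda>j. fst (W j)"] by (simp only: Labs_def)
  then have "real (card Labs) \<le> real (t * (t * (2 * card H + 1) ^ (CARD('p) + 1)) ^ t)"
    by (simp only: of_nat_le_iff)
  then have card_Labs: "2 ^ t * real (card Labs) \<le> N"
    unfolding N_def tree_class_bound_def by (intro mult_left_mono) auto
  have finLabs: "finite Labs" using fin by (simp add: Labs_def finite_tree_labels)
  have labs_less: "m < t" if "la \<in> Labs" "la (i, b) = Some m" for la i b m
    by (rule tree_labels_less[OF that[unfolded Labs_def]])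
  have opt: "ln N / l + l * (2 * \<beta>\<^sup>2)\<^sup>2 * real (card H) / 2 = 2 * \<beta>\<^sup>2 * sqrt (2 * real (card H) * L)"
    using optimize_rademacher[OF L a, of "\<beta>\<^sup>2"] \<beta>(2) by (simp add: l_def L_def N_def)
  define e where "e T i = (if i \<in> T then -1 else 1 :: real)" for T and i :: nat
  define y where "y j = snd (W j)" for j
  define u where "u T j = est T (fst (W j))" for T j
  have lin: "(\<Sum>T\<in>Pow H. \<Sum>i\<in>H. e T i * (- y (i, True) * u T (i, True) - - y (i, False) * u T (i, False)))
      \<le> 2 ^ card H * (2 * \<beta>\<^sup>2 * sqrt (2 * real (card H) * L))"
  proof -
    have "(\<Sum>T\<in>Pow H. \<Sum>i\<in>H. e T i * (- y (i, True) * u T (i, True) - - y (i, False) * u T (i, False)))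
      \<le> 2 ^ card H * (ln N / l + l * (2 * \<beta> * \<beta>)\<^sup>2 * real (card H) / 2)"
      unfolding e_def
      by (rule label_rademacher_sum_le[where lab = lab and val = val and t = t and Labs = Labs])
        (use fin finLabs card_Labs N2 l labs_less \<beta> lab val est in \<open>auto simp: y_def u_def I_def\<close>)
    then show ?thesis using opt by (simp add: power2_eq_square mult.assoc)
  qed
  \<comment> \<open>The squared cell values are again constant on the cells, now bounded by
    \<open>\<beta>\<^sup>2\<close>, and all coefficients are \<open>1\<close>.\<close>
  have sq: "(\<Sum>T\<in>Pow H. \<Sum>i\<in>H. e T i * (1 * (u T (i, True))\<^sup>2 - 1 * (u T (i, False))\<^sup>2))
      \<le> 2 ^ card H * (2 * \<beta>\<^sup>2 * sqrt (2 * real (card H) * L))"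
  proof -
    have "(\<Sum>T\<in>Pow H. \<Sum>i\<in>H. e T i * (1 * (u T (i, True))\<^sup>2 - 1 * (u T (i, False))\<^sup>2))
      \<le> 2 ^ card H * (ln N / l + l * (2 * \<beta>\<^sup>2 * 1)\<^sup>2 * real (card H) / 2)"
      unfolding e_def
    proof (rule label_rademacher_sum_le[where lab = lab and val = "\<lambda>T m. (val T m)\<^sup>2" and t = t and Labs = Labs
          and z = "\<lambda>_. 1" and u = "\<lambda>T j. (u T j)\<^sup>2"])
      fix T m assume "T \<subseteq> H"
      then show "\<bar>(val T m)\<^sup>2\<bar> \<le> \<beta>\<^sup>2" using val[of T m] \<beta>(2) by (simp add: abs_le_square_iff[symmetric])
    next
      fix T i b assume "T \<subseteq> H" "i \<in> H"
      then show "(u T (i, b))\<^sup>2 = (case lab T (i, b) of None \<Rightarrow> 0 | Some m \<Rightarrow> (val T m)\<^sup>2)"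
        using est[of T "(i, b)"] by (auto simp: u_def I_def split: option.split)
    qed (use fin finLabs card_Labs N2 l labs_less lab in auto)
    then show ?thesis using opt by simp
  qed
  have "(\<Sum>T\<in>Pow H. \<Sum>i\<in>H. excess_loss (est T) (W (i, i \<notin> T)) - excess_loss (est T) (W (i, i \<in> T)))
      = (\<Sum>T\<in>Pow H. \<Sum>i\<in>H. 2 * (e T i * (- y (i, True) * u T (i, True) - - y (i, False) * u T (i, False)))
          + e T i * (1 * (u T (i, True))\<^sup>2 - 1 * (u T (i, False))\<^sup>2))"
    by (intro sum.cong refl)
      (auto simp: excess_loss_def e_def y_def u_def case_prod_beta algebra_simps)
  also have "\<dots> = 2 * (\<Sum>T\<in>Pow H. \<Sum>i\<in>H. e T i * (- y (i, True) * u T (i, True) - - y (i, False) * u T (i, False)))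
      + (\<Sum>T\<in>Pow H. \<Sum>i\<in>H. e T i * (1 * (u T (i, True))\<^sup>2 - 1 * (u T (i, False))\<^sup>2))"
    by (simp only: sum.distrib sum_distrib_left)
  also have "\<dots> \<le> 2 * (2 ^ card H * (2 * \<beta>\<^sup>2 * sqrt (2 * real (card H) * L)))
      + 2 ^ card H * (2 * \<beta>\<^sup>2 * sqrt (2 * real (card H) * L))"
    using lin sq by (intro add_mono mult_left_mono) auto
  finally show ?thesis by (simp add: algebra_simps)
qed

section \<open>Symmetrization on a double sample\<close>

lemma integrable_PiM_component:
  fixes h :: "'z \<Rightarrow> real"
  assumes \<nu>: "prob_space \<nu>" and fin: "finite J" and j: "j \<in> J" and h: "integrable \<nu> h"
  shows "integrable (Pi\<^sub>M J (\<lambda>_. \<nu>)) (\<lambda>\<omega>. h (\<omega> j))"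
    and "(\<integral>\<omega>. h (\<omega> j) \<partial>Pi\<^sub>M J (\<lambda>_. \<nu>)) = (\<integral>z. h z \<partial>\<nu>)"
proof -
  have distr: "distr (Pi\<^sub>M J (\<lambda>_. \<nu>)) \<nu> (\<lambda>\<omega>. \<omega> j) = \<nu>"
    using \<nu> j fin by (intro distr_PiM_component) auto
  have meas [measurable]: "(\<lambda>\<omega>. \<omega> j) \<in> measurable (Pi\<^sub>M J (\<lambda>_. \<nu>)) \<nu>"
    using measurable_component_singleton[OF j, of "\<lambda>_. \<nu>"] by simp
  have "h \<in> borel_measurable \<nu>" using h by simp
  then show "integrable (Pi\<^sub>M J (\<lambda>_. \<nu>)) (\<lambda>\<omega>. h (\<omega> j))"
    using integrable_distr_eq[OF meas, of h] h distr by simp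
  show "(\<integral>\<omega>. h (\<omega> j) \<partial>Pi\<^sub>M J (\<lambda>_. \<nu>)) = (\<integral>z. h z \<partial>\<nu>)"
    using integral_distr[OF meas, of h] \<open>h \<in> borel_measurable \<nu>\<close> distr by simp
qed

text \<open>Injectivity makes the selected coordinates independent again. It is applied to the
  choice of a training sample, with or without a test point, from the double sample.\<close>

lemma integral_PiM_reindex:
  fixes h :: "('i \<Rightarrow> 'z) \<Rightarrow> real"
  assumes \<nu>: "prob_space \<nu>" and f: "inj_on f I" "f \<in> I \<rightarrow> K" and h: "integrable (Pi\<^sub>M I (\<lambda>_. \<nu>)) h"
  shows "integrable (Pi\<^sub>M K (\<lambda>_. \<nu>)) (\<lambda>\<omega>. h (\<lambda>i\<in>I. \<omega> (f i)))"
    and "(\<integral>\<omega>. h (\<lambda>i\<in>I. \<omega> (f i)) \<partial>Pi\<^sub>M K (\<lambda>_. \<nu>)) = (\<integral>\<omega>. h \<omega> \<partial>Pi\<^sub>M I (\<lambda>_. \<nu>))"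
proof -
  have distr: "distr (Pi\<^sub>M K (\<lambda>_. \<nu>)) (Pi\<^sub>M I (\<lambda>_. \<nu>)) (\<lambda>\<omega>. \<lambda>i\<in>I. \<omega> (f i)) = Pi\<^sub>M I (\<lambda>_. \<nu>)"
    using distr_PiM_reindex[of K "\<lambda>_. \<nu>" f I] \<nu> f by simp
  have meas: "(\<lambda>\<omega>. \<lambda>i\<in>I. \<omega> (f i)) \<in> measurable (Pi\<^sub>M K (\<lambda>_. \<nu>)) (Pi\<^sub>M I (\<lambda>_. \<nu>))"
    using f by (intro measurable_restrict measurable_component_singleton) auto
  have "h \<in> borel_measurable (Pi\<^sub>M I (\<lambda>_. \<nu>))" using h by simp
  then show "integrable (Pi\<^sub>M K (\<lambda>_. \<nu>)) (\<lambda>\<omega>. h (\<lambda>i\<in>I. \<omega> (f i)))"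
    "(\<integral>\<omega>. h (\<lambda>i\<in>I. \<omega> (f i)) \<partial>Pi\<^sub>M K (\<lambda>_. \<nu>)) = (\<integral>\<omega>. h \<omega> \<partial>Pi\<^sub>M I (\<lambda>_. \<nu>))"
    using integrable_distr_eq[OF meas, of h] integral_distr[OF meas, of h] h distr by simp_all
qed

text \<open>The subsample \<open>H\<close> and the feature sets \<open>R\<close> are fixed, so that
  only the observations are random. The tree is bounded by the largest response in \<open>H\<close>,
  a bound that varies with the sample.\<close>

locale bounded_estimator =
  fixes \<nu> :: "((real^'p::finite) \<times> real) measure" and n :: nat and H :: "nat set"
    and sel :: "'p split_rule" and R :: "nat \<Rightarrow> 'p set" and t :: nat and c :: real
  assumes prob: "prob_space \<nu>" and sets_\<nu>: "sets \<nu> = sets borel"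
    and c: "c > 0" and exp_moment: "integrable \<nu> (\<lambda>z. exp (c * (snd z)\<^sup>2))"
    and H: "H \<subseteq> {1..n}" "H \<noteq> {}" and t: "t \<ge> 1"
    and meas: "(\<lambda>(D, x). odt_estimator sel D H R t x)
        \<in> borel_measurable ((\<Pi>\<^sub>M i\<in>{1..n}. borel) \<Otimes>\<^sub>M borel)"
begin

sublocale prob_space \<nu> by (rule prob)

definition est where "est D = odt_estimator sel D H R t"

abbreviation Sample where "Sample \<equiv> Pi\<^sub>M {1..n} (\<lambda>_. \<nu>)"

lemma measurable_\<nu>: "measurable \<nu> N = measurable borel N"
  by (rule measurable_cong_sets) (auto simp: sets_\<nu>)

lemma sets_Sample: "sets Sample = sets (\<Pi>\<^sub>M i\<in>{1..n}. borel)"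
  by (intro sets_PiM_cong) (auto simp: sets_\<nu>)

lemma finite_H: "finite H"
  using H finite_subset by blast

lemma fst_snd_measurable [measurable]: "fst \<in> borel_measurable \<nu>" "snd \<in> borel_measurable \<nu>"
  unfolding measurable_\<nu> by (auto simp flip: borel_prod)

lemma est_measurable_pair: "(\<lambda>(D, x). est D x) \<in> borel_measurable (Sample \<Otimes>\<^sub>M borel)"
  unfolding est_def using meas
  by (subst measurable_cong_sets[OF sets_pair_measure_cong[OF sets_Sample refl] refl]) auto

lemma est_measurable [measurable (raw)]:
  assumes [measurable]: "D \<in> measurable N Sample" "x \<in> borel_measurable N"
  shows "(\<lambda>\<omega>. est (D \<omega>) (x \<omega>)) \<in> borel_measurable N"
proof -
  have "(\<lambda>\<omega>. (D \<omega>, x \<omega>)) \<in> measurable N (Sample \<Otimes>\<^sub>M borel)" by measurable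
  from measurable_compose[OF this est_measurable_pair] show ?thesis by simp
qed

lemma est_measurable_point:
  assumes "D \<in> space Sample"
  shows "est D \<in> borel_measurable borel"
  using est_measurable[of "\<lambda>_. D" borel "\<lambda>x. x"] assms by simp

lemma integrable_square: "integrable \<nu> (\<lambda>z. (snd z)\<^sup>2)"
proof (rule Bochner_Integration.integrable_bound)
  show "integrable \<nu> (\<lambda>z. exp (c * (snd z)\<^sup>2) / c)" using exp_moment by simp
  show "AE z in \<nu>. norm ((snd z)\<^sup>2) \<le> norm (exp (c * (snd z)\<^sup>2) / c)"
  proof (rule AE_I2)
    fix z :: "(real^'p) \<times> real"
    have "c * (snd z)\<^sup>2 \<le> exp (c * (snd z)\<^sup>2)" using exp_ge_add_one_self[of "c * (snd z)\<^sup>2"] by linarith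
    then show "norm ((snd z)\<^sup>2) \<le> norm (exp (c * (snd z)\<^sup>2) / c)" using c by (simp add: field_simps)
  qed
qed simp

text \<open>The sum replaces the maximum of the squared responses: it is an integrable envelope that
  is uniform in \<open>x\<close>.\<close>

lemma est_square_le: "(est D x)\<^sup>2 \<le> (\<Sum>k\<in>H. (snd (D k))\<^sup>2)"
proof -
  define s where "s = (\<Sum>k\<in>H. (snd (D k))\<^sup>2)"
  have "\<bar>snd (D k)\<bar> \<le> sqrt s" if "k \<in> H" for k
  proof -
    have "(snd (D k))\<^sup>2 \<le> s" unfolding s_def using that finite_H by (intro member_le_sum) auto
    then show ?thesis by (metis real_sqrt_abs real_sqrt_le_iff)
  qed
  moreover have "0 \<le> s" by (simp add: s_def sum_nonneg)
  ultimately have "\<bar>est D x\<bar> \<le> sqrt s"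
    unfolding est_def by (intro abs_odt_estimator_le) auto
  then have "\<bar>est D x\<bar>\<^sup>2 \<le> (sqrt s)\<^sup>2" by (intro power_mono) auto
  then show ?thesis using \<open>0 \<le> s\<close> by (simp add: s_def)
qed

lemma abs_excess_loss_le: "\<bar>excess_loss (est D) z\<bar> \<le> (snd z)\<^sup>2 + 2 * (\<Sum>k\<in>H. (snd (D k))\<^sup>2)"
proof -
  obtain x y where z: "z = (x, y)" by (cases z)
  have "\<bar>(est D x)\<^sup>2 - 2 * y * est D x\<bar> \<le> y\<^sup>2 + 2 * (est D x)\<^sup>2"
  proof -
    have "0 \<le> (y - est D x)\<^sup>2" "0 \<le> (y + est D x)\<^sup>2" by simp_all
    then have "2 * y * est D x \<le> y\<^sup>2 + (est D x)\<^sup>2" "- (2 * y * est D x) \<le> y\<^sup>2 + (est D x)\<^sup>2"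
      by (simp_all add: power2_eq_square algebra_simps)
    moreover have "0 \<le> (est D x)\<^sup>2" by simp
    ultimately show ?thesis by linarith
  qed
  then show ?thesis using est_square_le[of D x] by (simp add: excess_loss_def z)
qed

lemma excess_loss_measurable [measurable (raw)]:
  assumes [measurable]: "D \<in> measurable N Sample" "z \<in> measurable N \<nu>"
  shows "(\<lambda>\<omega>. excess_loss (est (D \<omega>)) (z \<omega>)) \<in> borel_measurable N"
proof -
  have [measurable]: "(\<lambda>\<omega>. fst (z \<omega>)) \<in> borel_measurable N" "(\<lambda>\<omega>. snd (z \<omega>)) \<in> borel_measurable N"
    using measurable_compose[OF assms(2) fst_snd_measurable(1)]
      measurable_compose[OF assms(2) fst_snd_measurable(2)] by auto
  show ?thesis unfolding excess_loss_def case_prod_beta by measurable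
qed

lemma integrable_sum_squares: "integrable Sample (\<lambda>D. \<Sum>k\<in>H. (snd (D k))\<^sup>2)"
  using H by (intro Bochner_Integration.integrable_sum integrable_PiM_component[OF prob _ _ integrable_square]) auto

lemma integrable_training_loss:
  assumes "i \<in> H"
  shows "integrable Sample (\<lambda>D. excess_loss (est D) (D i))"
proof (rule Bochner_Integration.integrable_bound)
  have i: "i \<in> {1..n}" using assms H by auto
  show "integrable Sample (\<lambda>D. (snd (D i))\<^sup>2 + 2 * (\<Sum>k\<in>H. (snd (D k))\<^sup>2))"
    using integrable_sum_squares i integrable_PiM_component(1)[OF prob _ i integrable_square] by simp
  show "(\<lambda>D. excess_loss (est D) (D i)) \<in> borel_measurable Sample"
    using i by measurable
  show "AE D in Sample. norm (excess_loss (est D) (D i)) \<le> norm ((snd (D i))\<^sup>2 + 2 * (\<Sum>k\<in>H. (snd (D k))\<^sup>2))"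
    using abs_excess_loss_le by (intro AE_I2) (simp add: sum_nonneg)
qed

text \<open>Index \<open>0\<close> carries a fresh observation, so that the product over
  \<open>{0..n}\<close> holds the training sample and the test point together.\<close>

definition test_loss where "test_loss V = excess_loss (est (restrict V {1..n})) (V 0)"

lemma integrable_test_loss: "integrable (Pi\<^sub>M {0..n} (\<lambda>_. \<nu>)) test_loss"
proof (rule Bochner_Integration.integrable_bound)
  show "integrable (Pi\<^sub>M {0..n} (\<lambda>_. \<nu>)) (\<lambda>V. (snd (V 0))\<^sup>2 + 2 * (\<Sum>k\<in>H. (snd (V k))\<^sup>2))"
    using H by (intro Bochner_Integration.integrable_add integrable_mult_right Bochner_Integration.integrable_sum
        integrable_PiM_component[OF prob _ _ integrable_square]) auto
  have [measurable]: "(\<lambda>V. restrict V {1..n}) \<in> measurable (Pi\<^sub>M {0..n} (\<lambda>_. \<nu>)) Sample"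
    by (intro measurable_restrict_subset) auto
  show "test_loss \<in> borel_measurable (Pi\<^sub>M {0..n} (\<lambda>_. \<nu>))"
    unfolding test_loss_def by measurable
  show "AE V in Pi\<^sub>M {0..n} (\<lambda>_. \<nu>). norm (test_loss V) \<le> norm ((snd (V 0))\<^sup>2 + 2 * (\<Sum>k\<in>H. (snd (V k))\<^sup>2))"
  proof (rule AE_I2)
    fix V :: "nat \<Rightarrow> (real^'p) \<times> real"
    have "(\<Sum>k\<in>H. (snd (restrict V {1..n} k))\<^sup>2) = (\<Sum>k\<in>H. (snd (V k))\<^sup>2)"
      using H by (intro sum.cong) auto
    then show "norm (test_loss V) \<le> norm ((snd (V 0))\<^sup>2 + 2 * (\<Sum>k\<in>H. (snd (V k))\<^sup>2))"
      using abs_excess_loss_le[of "restrict V {1..n}" "V 0"] by (simp add: test_loss_def sum_nonneg)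
  qed
qed

lemma integral_test_loss:
  "(\<integral>V. test_loss V \<partial>Pi\<^sub>M {0..n} (\<lambda>_. \<nu>)) = (\<integral>D. (\<integral>z. excess_loss (est D) z \<partial>\<nu>) \<partial>Sample)"
proof -
  interpret product_sigma_finite "\<lambda>_ :: nat. \<nu>"
    by unfold_locales
  have ins: "{0..n} = insert 0 {1..n}" by auto
  have "(\<integral>V. test_loss V \<partial>Pi\<^sub>M {0..n} (\<lambda>_. \<nu>))
      = (\<integral>D. (\<integral>z. test_loss (D(0 := z)) \<partial>\<nu>) \<partial>Sample)"
    using integrable_test_loss unfolding ins by (intro product_integral_insert) auto
  also have "\<dots> = (\<integral>D. (\<integral>z. excess_loss (est D) z \<partial>\<nu>) \<partial>Sample)"
  proof (intro Bochner_Integration.integral_cong refl)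
    fix D z assume "D \<in> space Sample"
    then have "restrict (D(0 := z)) {1..n} = D"
      by (auto simp: space_PiM restrict_def fun_eq_iff PiE_def extensional_def)
    then show "test_loss (D(0 := z)) = excess_loss (est D) z" by (simp add: test_loss_def)
  qed
  finally show ?thesis .
qed

text \<open>For every \<open>T\<close> the ghost observation \<open>i\<close> is independent of the
  swapped sample, so its loss has the mean of a test loss, while the swapped sample has the law of
  the original one. Hence the deviation equals its average over all \<open>T\<close>, and the sign
  bound applies for each double sample before integration.\<close>

lemma deviation_le:
  fixes a K L
  defines "a \<equiv> real (card H)" and "K \<equiv> (\<integral>z. exp (c * (snd z)\<^sup>2) \<partial>\<nu>)"
    and "L \<equiv> ln (tree_class_bound CARD('p) (card H) t)"
  shows "a * (\<integral>D. (\<integral>z. excess_loss (est D) z \<partial>\<nu>) \<partial>Sample) - (\<Sum>i\<in>H. \<integral>D. excess_loss (est D) (D i) \<partial>Sample)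
    \<le> 6 * ((ln (2 * a * K) + 1) / c) * sqrt (2 * a * L)"
proof -
  define J where "J = {1..n} \<times> (UNIV :: bool set)"
  define P2 where "P2 = Pi\<^sub>M J (\<lambda>_. \<nu>)"
  interpret P2: prob_space P2 unfolding P2_def by (rule prob_space_PiM) (rule prob)
  let ?ghost = "\<lambda>T i W. excess_loss (est (swap_sample n T W)) (W (i, i \<notin> T))"
  let ?train = "\<lambda>T i W. excess_loss (est (swap_sample n T W)) (W (i, i \<in> T))"
  let ?risk = "\<integral>D. (\<integral>z. excess_loss (est D) z \<partial>\<nu>) \<partial>Sample"
  have a: "a > 0" using H finite_H by (simp add: a_def card_gt_0_iff)
  have a1: "a \<ge> 1" using H finite_H by (simp add: a_def Suc_le_eq card_gt_0_iff)
  have K: "K \<ge> 1"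
  proof -
    have "(\<integral>z. 1 \<partial>\<nu>) \<le> K" unfolding K_def using exp_moment c by (intro integral_mono) auto
    then show ?thesis by (simp add: prob_space)
  qed
  \<comment> \<open>The sum in \<open>\<beta>2\<close> has \<open>2 * a\<close> terms of mean
    \<open>K\<close>. With \<open>M\<close> equal to their total, \<open>\<beta>2\<close> has mean
    \<open>(ln M + 1) / c\<close>; by \<open>le_exp_div_add_ln\<close> it bounds all squared
    responses at the indices in \<open>H\<close>, and it does not depend on
    \<open>T\<close>.\<close>
  define M where "M = 2 * a * K"
  have M: "M \<ge> 2" using a1 K mult_mono[of 1 a 1 K] by (simp add: M_def mult.assoc)
  define \<beta>2 where "\<beta>2 W = (ln M + (\<Sum>j\<in>H \<times> UNIV. exp (c * (snd (W j))\<^sup>2)) / M) / c"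
    for W :: "nat \<times> bool \<Rightarrow> (real^'p) \<times> real"
  have HJ: "j \<in> J" if "j \<in> H \<times> UNIV" for j using that H by (auto simp: J_def)
  have finJ: "finite J" by (simp add: J_def)
  have int_exp: "integrable P2 (\<lambda>W. exp (c * (snd (W j))\<^sup>2))"
    "(\<integral>W. exp (c * (snd (W j))\<^sup>2) \<partial>P2) = K" if "j \<in> H \<times> UNIV" for j
    using integrable_PiM_component[OF prob finJ HJ[OF that] exp_moment] by (simp_all add: P2_def K_def)
  have int_\<beta>2: "integrable P2 \<beta>2"
    unfolding \<beta>2_def using int_exp by (intro integrable_divide Bochner_Integration.integrable_add Bochner_Integration.integrable_sum) auto
  have E_\<beta>2: "(\<integral>W. \<beta>2 W \<partial>P2) = (ln M + 1) / c"
  proof -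
    have "(\<integral>W. \<beta>2 W \<partial>P2) = (ln M + (\<Sum>j\<in>H \<times> (UNIV :: bool set). K) / M) / c"
      unfolding \<beta>2_def using int_exp by (simp add: Bochner_Integration.integral_add P2.prob_space)
    also have "(\<Sum>j\<in>H \<times> (UNIV :: bool set). K) = M" by (simp add: M_def a_def card_cartesian_product)
    finally show ?thesis using M by simp
  qed
  have test: "integrable P2 (?ghost T i)"
    "(\<integral>W. ?ghost T i W \<partial>P2)
       = ?risk" if i: "i \<in> H" for i T
  proof -
    \<comment> \<open>Sends the test index to the ghost copy of \<open>i\<close> and every other
      index to its training copy; injective because the two copies of \<open>i\<close>
      differ.\<close>
    define f where "f k = (if k = 0 then (i, i \<notin> T) else (k, k \<in> T))" for k
    have f: "inj_on f {0..n}" "f \<in> {0..n} \<rightarrow> J"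
      using i H by (auto simp: f_def J_def inj_on_def split: if_splits)
    have "restrict (\<lambda>k\<in>{0..n}. W (f k)) {1..n} = swap_sample n T W" for W :: "nat \<times> bool \<Rightarrow> (real^'p) \<times> real"
      by (auto simp: swap_sample_def f_def restrict_def fun_eq_iff)
    then have eq: "test_loss (\<lambda>k\<in>{0..n}. W (f k)) = ?ghost T i W" for W
      by (simp add: test_loss_def f_def)
    show "integrable P2 (?ghost T i)"
      "(\<integral>W. ?ghost T i W \<partial>P2)
       = ?risk"
      using integral_PiM_reindex[OF prob f integrable_test_loss] by (simp_all add: P2_def eq integral_test_loss)
  qed
  have train: "integrable P2 (?train T i)"
    "(\<integral>W. ?train T i W \<partial>P2)
       = (\<integral>D. excess_loss (est D) (D i) \<partial>Sample)" if i: "i \<in> H" for i T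
  proof -
    have f: "inj_on (\<lambda>k. (k, k \<in> T)) {1..n}" "(\<lambda>k. (k, k \<in> T)) \<in> {1..n} \<rightarrow> J"
      by (auto simp: J_def inj_on_def)
    have eq: "swap_sample n T W i = W (i, i \<in> T)" for W :: "nat \<times> bool \<Rightarrow> (real^'p) \<times> real"
      using i H by (auto simp: swap_sample_def)
    show "integrable P2 (?train T i)"
      "(\<integral>W. ?train T i W \<partial>P2)
       = (\<integral>D. excess_loss (est D) (D i) \<partial>Sample)"
      using integral_PiM_reindex[OF prob f integrable_training_loss[OF i], folded swap_sample_def P2_def, unfolded eq]
      by simp_all
  qed
  define d where "d = a * ?risk
    - (\<Sum>i\<in>H. \<integral>D. excess_loss (est D) (D i) \<partial>Sample)"
  define \<Delta> where "\<Delta> W = (\<Sum>T\<in>Pow H. \<Sum>i\<in>H. ?ghost T i W - ?train T i W)" for W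
  have int_diff: "integrable P2 (\<lambda>W. ?ghost T i W - ?train T i W)" if "i \<in> H" for i T
    by (rule Bochner_Integration.integrable_diff[OF test(1)[OF that] train(1)[OF that]])
  have int_sum: "integrable P2 (\<lambda>W. \<Sum>i\<in>H. ?ghost T i W - ?train T i W)" for T
    by (rule Bochner_Integration.integrable_sum[OF int_diff])
  have int_\<Delta>: "integrable P2 \<Delta>"
    unfolding \<Delta>_def by (rule Bochner_Integration.integrable_sum[OF int_sum])
  have "(\<integral>W. \<Delta> W \<partial>P2) = (\<Sum>T\<in>Pow H. \<integral>W. (\<Sum>i\<in>H. ?ghost T i W - ?train T i W) \<partial>P2)"
    unfolding \<Delta>_def by (rule Bochner_Integration.integral_sum[OF int_sum])
  also have "\<dots> = (\<Sum>T\<in>Pow H. \<Sum>i\<in>H. \<integral>W. ?ghost T i W - ?train T i W \<partial>P2)"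
    by (intro sum.cong refl Bochner_Integration.integral_sum int_diff)
  also have "\<dots> = (\<Sum>T\<in>Pow H. \<Sum>i\<in>H. ?risk
      - (\<integral>D. excess_loss (est D) (D i) \<partial>Sample))"
  proof (intro sum.cong refl)
    fix T i assume i: "i \<in> H"
    show "(\<integral>W. ?ghost T i W - ?train T i W \<partial>P2)
        = ?risk - (\<integral>D. excess_loss (est D) (D i) \<partial>Sample)"
      by (simp only: Bochner_Integration.integral_diff[OF test(1)[OF i] train(1)[OF i]] test(2)[OF i] train(2)[OF i])
  qed
  also have "\<dots> = 2 ^ card H * d"
    using finite_H by (simp add: sum_subtractf d_def a_def card_Pow)
  finally have E_\<Delta>: "(\<integral>W. \<Delta> W \<partial>P2) = 2 ^ card H * d" .
  have "\<Delta> W \<le> 2 ^ card H * (6 * \<beta>2 W * sqrt (2 * a * L))" for W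
  proof -
    have pos: "\<beta>2 W > 0"
      unfolding \<beta>2_def using M c by (intro divide_pos_pos add_pos_nonneg sum_nonneg divide_nonneg_pos) auto
    have "\<bar>snd (W (i, b))\<bar> \<le> sqrt (\<beta>2 W)" if i: "i \<in> H" for i b
    proof -
      let ?y = "snd (W (i, b))"
      have "c * ?y\<^sup>2 \<le> exp (c * ?y\<^sup>2) / M - 1 + ln M" using M by (intro le_exp_div_add_ln) auto
      also have "exp (c * ?y\<^sup>2) \<le> (\<Sum>j\<in>H \<times> UNIV. exp (c * (snd (W j))\<^sup>2))"
        using finite_H i by (intro member_le_sum[where i = "(i, b)" and f = "\<lambda>j. exp (c * (snd (W j))\<^sup>2)"]) auto
      finally have "c * ?y\<^sup>2 \<le> c * \<beta>2 W"
        using M c by (simp add: \<beta>2_def divide_right_mono)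
      then have "?y\<^sup>2 \<le> \<beta>2 W" using c by simp
      then show ?thesis by (metis real_sqrt_abs real_sqrt_le_iff)
    qed
    then have "\<Delta> W \<le> 2 ^ card H * (6 * (sqrt (\<beta>2 W))\<^sup>2 * sqrt (2 * real (card H) * L))"
      unfolding \<Delta>_def est_def L_def using pos
      by (intro sum_swapped_excess_loss_le[OF H t, where W = W]) auto
    then show ?thesis using pos by (simp add: a_def)
  qed
  then have "(\<integral>W. \<Delta> W \<partial>P2) \<le> (\<integral>W. 2 ^ card H * (6 * \<beta>2 W * sqrt (2 * a * L)) \<partial>P2)"
    using int_\<Delta> int_\<beta>2 by (intro integral_mono) auto
  also have "\<dots> = 2 ^ card H * (6 * ((ln M + 1) / c) * sqrt (2 * a * L))"
    by (simp add: E_\<beta>2)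
  finally show ?thesis
    unfolding E_\<Delta> d_def M_def by (rule mult_left_le_imp_le) simp
qed

end

section \<open>Density of combinations of halfspace indicators in L2\<close>

text \<open>Directions are normalized because \<open>split_maximizer\<close> compares with unit
  directions only.\<close>

definition unit_ridge_step :: "(real^'p::finite \<Rightarrow> real) \<Rightarrow> bool" where
  "unit_ridge_step f \<longleftrightarrow> (\<exists>c0 ps. (\<forall>(c, \<theta>, s)\<in>set ps. norm \<theta> = 1) \<and> f = ridge_step c0 ps)"

lemma unit_ridge_step_const: "unit_ridge_step (\<lambda>_. c)"
  unfolding unit_ridge_step_def by (intro exI[of _ c] exI[of _ "[]"]) (auto simp: ridge_step_def)

lemma unit_ridge_step_add:
  assumes "unit_ridge_step f" "unit_ridge_step g"
  shows "unit_ridge_step (\<lambda>x. f x + g x)"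
proof -
  obtain c ps d qs where "\<forall>(c, \<theta>, s)\<in>set ps. norm \<theta> = 1" "f = ridge_step c ps"
    "\<forall>(c, \<theta>, s)\<in>set qs. norm \<theta> = 1" "g = ridge_step d qs"
    using assms unfolding unit_ridge_step_def by metis
  then show ?thesis
    unfolding unit_ridge_step_def
    by (intro exI[of _ "c + d"] exI[of _ "ps @ qs"]) (auto simp: ridge_step_def)
qed

lemma unit_ridge_step_mult:
  assumes "unit_ridge_step f"
  shows "unit_ridge_step (\<lambda>x. k * f x)"
proof -
  obtain c ps where ps: "\<forall>(c, \<theta>, s)\<in>set ps. norm \<theta> = 1" "f = ridge_step c ps"
    using assms unfolding unit_ridge_step_def by metis
  have "ridge_step (k * c) (map (\<lambda>(c, p). (k * c, p)) ps) x = k * ridge_step c ps x" for x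
    by (induction ps) (auto simp: ridge_step_def algebra_simps)
  then show ?thesis
    unfolding unit_ridge_step_def using ps
    by (intro exI[of _ "k * c"] exI[of _ "map (\<lambda>(c, p). (k * c, p)) ps"]) (auto simp: fun_eq_iff)
qed

lemma unit_ridge_step_sum:
  assumes "\<And>i. i \<in> I \<Longrightarrow> unit_ridge_step (f i)"
  shows "unit_ridge_step (\<lambda>x. \<Sum>i\<in>I. f i x)"
  using assms by (induction I rule: infinite_finite_induct) (auto intro: unit_ridge_step_add unit_ridge_step_const)

text \<open>Dividing direction and threshold by the norm keeps the halfspace; the zero direction
  gives a constant.\<close>

lemma unit_ridge_step_halfspace: "unit_ridge_step (\<lambda>x. of_bool (\<theta> \<bullet> x > s))"
proof (cases "\<theta> = 0")
  case True
  then show ?thesis using unit_ridge_step_const[of "of_bool (0 > s)"] by simp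
next
  case False
  have eq: "(\<theta> \<bullet> x > s) = (sgn \<theta> \<bullet> x > s / norm \<theta>)" for x
    using False by (simp add: sgn_div_norm field_simps)
  show ?thesis
    unfolding unit_ridge_step_def eq using False
    by (intro exI[of _ 0] exI[of _ "[(1, sgn \<theta>, s / norm \<theta>)]"]) (auto simp: ridge_step_def norm_sgn)
qed

lemma unit_ridge_step_measurable:
  assumes "unit_ridge_step f"
  shows "f \<in> borel_measurable borel"
proof -
  obtain c0 ps where f: "f = ridge_step c0 ps" using assms by (auto simp: unit_ridge_step_def)
  have "ridge_step c0 ps \<in> borel_measurable borel"
  proof (induction ps)
    case (Cons p ps)
    obtain c \<theta> s where p: "p = (c, \<theta>, s)" by (cases p)
    have [measurable]: "(\<lambda>x. \<theta> \<bullet> x) \<in> borel_measurable borel"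
      by (intro borel_measurable_inner) auto
    have "ridge_step c0 (p # ps) = (\<lambda>x. c * of_bool (\<theta> \<bullet> x > s) + ridge_step c0 ps x)"
      by (simp add: ridge_step_def p fun_eq_iff)
    moreover have "(\<lambda>x. c * of_bool (\<theta> \<bullet> x > s) + ridge_step c0 ps x) \<in> borel_measurable borel"
      using Cons by measurable
    ultimately show ?case by simp
  qed (simp add: ridge_step_def[abs_def])
  then show ?thesis by (simp add: f)
qed

text \<open>A staircase of width \<open>1 / k\<close> along \<open>\<theta>\<close>: its jumps
  telescope to the value of \<open>h\<close> at the first grid point not below
  \<open>\<theta> \<bullet> x\<close>, which is less than \<open>1 / k\<close> away.\<close>

lemma ridge_uniform_approx:
  fixes \<theta> :: "real^'p::finite"
  assumes h: "continuous_on UNIV h" and K: "compact K" and "\<epsilon> > 0"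
  shows "\<exists>r. unit_ridge_step r \<and> (\<forall>x\<in>K. \<bar>r x - h (\<theta> \<bullet> x)\<bar> < \<epsilon>)"
proof -
  have "bounded ((\<lambda>x. \<theta> \<bullet> x) ` K)"
    using K by (intro compact_imp_bounded compact_continuous_image continuous_intros)
  then obtain M where M: "\<And>x. x \<in> K \<Longrightarrow> \<bar>\<theta> \<bullet> x\<bar> \<le> M" "M > 0"
    by (auto simp: bounded_pos)
  \<comment> \<open>The grid point used for \<open>x\<close> may exceed \<open>M\<close>, but by
    less than \<open>1 / k\<close>, which is at most \<open>1\<close>.\<close>
  have "uniformly_continuous_on {-M..M + 1} h"
    using h by (intro compact_uniformly_continuous) (auto intro: continuous_on_subset)
  then obtain \<delta> where \<delta>: "\<delta> > 0"
    "\<And>u v. u \<in> {-M..M + 1} \<Longrightarrow> v \<in> {-M..M + 1} \<Longrightarrow> dist v u < \<delta> \<Longrightarrow> dist (h v) (h u) < \<epsilon>"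
    using \<open>\<epsilon> > 0\<close> unfolding uniformly_continuous_on_def by metis
  obtain k :: nat where "1 / \<delta> < real k" using reals_Archimedean2 by blast
  moreover from this have "k > 0" using \<delta>(1) by (auto intro: Nat.gr0I)
  ultimately have k: "k > 0" "1 / real k < \<delta>" using \<delta>(1) by (auto simp: field_simps)
  define g where "g w = h (real w / real k - M)" for w
  define N where "N = nat \<lceil>2 * M * real k\<rceil>"
  define r where "r x = g 0 + (\<Sum>j<N. (g (Suc j) - g j) * of_bool (\<theta> \<bullet> x > real j / real k - M))" for x
  have "unit_ridge_step r"
    unfolding r_def by (intro unit_ridge_step_add unit_ridge_step_const unit_ridge_step_sum
        unit_ridge_step_mult unit_ridge_step_halfspace)
  moreover have "\<bar>r x - h (\<theta> \<bullet> x)\<bar> < \<epsilon>" if x: "x \<in> K" for x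
  proof -
    define u where "u = \<theta> \<bullet> x"
    \<comment> \<open>The number of thresholds strictly below \<open>u\<close>, and also the index
      of the grid point at which the staircase evaluates \<open>h\<close>.\<close>
    define w where "w = nat \<lceil>(u + M) * real k\<rceil>"
    have u: "- M \<le> u" "u \<le> M" using M(1)[OF x] by (auto simp: u_def)
    have nonneg: "0 \<le> (u + M) * real k" using u by simp
    have "(u + M) * real k \<le> 2 * M * real k" using u by (intro mult_right_mono) auto
    then have "w \<le> N" unfolding w_def N_def by (intro nat_mono ceiling_mono)
    have less: "(u > real j / real k - M) = (j < w)" for j
    proof -
      have "(u > real j / real k - M) = ((u + M) * real k > real j)" using k by (simp add: field_simps)
      also have "\<dots> = (int j < \<lceil>(u + M) * real k\<rceil>)" by (simp add: less_ceiling_iff)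
      also have "\<dots> = (j < w)" by (simp add: w_def zless_nat_eq_int_zless)
      finally show ?thesis .
    qed
    have "r x = g 0 + (\<Sum>j<N. if j < w then g (Suc j) - g j else 0)"
      unfolding r_def u_def[symmetric] less by (intro arg_cong2[of _ _ _ _ "(+)"] refl sum.cong) auto
    also have "(\<Sum>j<N. if j < w then g (Suc j) - g j else 0) = (\<Sum>j<w. g (Suc j) - g j)"
      using \<open>w \<le> N\<close> by (intro sum.mono_neutral_cong_right) auto
    also have "g 0 + \<dots> = g w" by (simp add: sum_lessThan_telescope)
    finally have "r x = h (real w / real k - M)" by (simp add: g_def)
    moreover have w: "(u + M) * real k \<le> real w" "real w < (u + M) * real k + 1"
      using nonneg by (auto simp: w_def) linarith+
    have w': "u \<le> real w / real k - M" "real w / real k - M < u + 1 / real k"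
    proof -
      show "u \<le> real w / real k - M" using w(1) k(1) by (simp add: field_simps)
      have "real w / real k < ((u + M) * real k + 1) / real k"
        using w(2) k(1) by (intro divide_strict_right_mono) auto
      then show "real w / real k - M < u + 1 / real k" using k(1) by (simp add: add_divide_distrib)
    qed
    have k1: "1 / real k \<le> 1" using k by simp
    have "dist (h (real w / real k - M)) (h u) < \<epsilon>"
    proof (intro \<delta>(2))
      have "real w / real k - M \<le> M + 1" using w' u k1 by linarith
      then show "real w / real k - M \<in> {- M..M + 1}" using w' u by auto
      show "u \<in> {- M..M + 1}" using u by auto
      show "dist (real w / real k - M) u < \<delta>" using w' k(2) by (simp add: dist_real_def)
    qed
    ultimately show ?thesis by (simp add: dist_real_def u_def)
  qed
  ultimately show ?thesis by blast
qed

text \<open>Unlike halfspace indicators, the exponential ridge functions span an algebra, so that the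
  Stone--Weierstrass theorem applies to them.\<close>

inductive exp_ridge_span :: "(real^'p::finite \<Rightarrow> real) \<Rightarrow> bool" where
  exp_ridge: "exp_ridge_span (\<lambda>x. c * exp (\<theta> \<bullet> x))"
| add: "exp_ridge_span f \<Longrightarrow> exp_ridge_span g \<Longrightarrow> exp_ridge_span (\<lambda>x. f x + g x)"

lemma exp_ridge_span_mult:
  assumes "exp_ridge_span f" "exp_ridge_span g"
  shows "exp_ridge_span (\<lambda>x. f x * g x)"
  using assms
proof (induction f rule: exp_ridge_span.induct)
  case (exp_ridge c \<theta>)
  from exp_ridge.prems show ?case
  proof (induction g rule: exp_ridge_span.induct)
    case (exp_ridge d \<eta>)
    have "(\<lambda>x. c * exp (\<theta> \<bullet> x) * (d * exp (\<eta> \<bullet> x))) = (\<lambda>x. (c * d) * exp ((\<theta> + \<eta>) \<bullet> x))"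
      by (simp add: inner_add_left exp_add fun_eq_iff)
    then show ?case by (simp only: exp_ridge_span.exp_ridge)
  next
    case (add f g)
    then show ?case using exp_ridge_span.add[of "\<lambda>x. c * exp (\<theta> \<bullet> x) * f x" "\<lambda>x. c * exp (\<theta> \<bullet> x) * g x"]
      by (simp add: distrib_left)
  qed
next
  case (add f1 f2)
  then show ?case using exp_ridge_span.add[of "\<lambda>x. f1 x * g x" "\<lambda>x. f2 x * g x"]
    by (simp add: distrib_right)
qed

lemma exp_ridge_span_continuous: "exp_ridge_span f \<Longrightarrow> continuous_on S f"
  by (induction f rule: exp_ridge_span.induct) (auto intro!: continuous_intros)

lemma exp_ridge_span_uniform_approx:
  assumes "exp_ridge_span f" "compact K" "\<epsilon> > 0"
  shows "\<exists>r. unit_ridge_step r \<and> (\<forall>x\<in>K. \<bar>r x - f x\<bar> < \<epsilon>)"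
  using assms
proof (induction f arbitrary: \<epsilon> rule: exp_ridge_span.induct)
  case (exp_ridge c \<theta>)
  then show ?case using ridge_uniform_approx[of "\<lambda>u. c * exp u" K \<epsilon> \<theta>] by (simp add: continuous_intros)
next
  case (add f g)
  then obtain r s where "unit_ridge_step r" "\<forall>x\<in>K. \<bar>r x - f x\<bar> < \<epsilon> / 2"
    "unit_ridge_step s" "\<forall>x\<in>K. \<bar>s x - g x\<bar> < \<epsilon> / 2"
    by (meson half_gt_zero)
  moreover have "\<bar>(r x + s x) - (f x + g x)\<bar> < \<epsilon>" if "\<bar>r x - f x\<bar> < \<epsilon> / 2" "\<bar>s x - g x\<bar> < \<epsilon> / 2" for x
    using that by linarith
  ultimately show ?case
    by (intro exI[of _ "\<lambda>x. r x + s x"] conjI unit_ridge_step_add ballI) auto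
qed

lemma continuous_uniform_approx:
  fixes f :: "real^'p::finite \<Rightarrow> real"
  assumes f: "continuous_on K f" and K: "compact K" and \<epsilon>: "\<epsilon> > 0"
  shows "\<exists>r. unit_ridge_step r \<and> (\<forall>x\<in>K. \<bar>r x - f x\<bar> < \<epsilon>)"
proof -
  have "\<exists>g. exp_ridge_span g \<and> (\<forall>x\<in>K. \<bar>f x - g x\<bar> < \<epsilon> / 2)"
  proof (rule Stone_Weierstrass_HOL[OF K])
    show "exp_ridge_span (\<lambda>x. c)" for c using exp_ridge_span.exp_ridge[of c 0] by simp
    show "\<exists>f. exp_ridge_span f \<and> f x \<noteq> f y" if "x \<in> K \<and> y \<in> K \<and> x \<noteq> y" for x y
    proof (intro exI conjI)
      show "exp_ridge_span (\<lambda>z. 1 * exp ((x - y) \<bullet> z))" by (rule exp_ridge_span.exp_ridge)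
      have "(x - y) \<bullet> x - (x - y) \<bullet> y = (norm (x - y))\<^sup>2" by (simp add: power2_norm_eq_inner inner_diff_right)
      then show "1 * exp ((x - y) \<bullet> x) \<noteq> 1 * exp ((x - y) \<bullet> y)" using that by auto
    qed
  qed (use f \<epsilon> exp_ridge_span_continuous exp_ridge_span_mult in \<open>auto intro: exp_ridge_span.add\<close>)
  then obtain g where g: "exp_ridge_span g" "\<And>x. x \<in> K \<Longrightarrow> \<bar>f x - g x\<bar> < \<epsilon> / 2" by blast
  obtain r where r: "unit_ridge_step r" "\<And>x. x \<in> K \<Longrightarrow> \<bar>r x - g x\<bar> < \<epsilon> / 2"
    using exp_ridge_span_uniform_approx[OF g(1) K, of "\<epsilon> / 2"] \<epsilon> by auto
  have "\<bar>r x - f x\<bar> < \<epsilon>" if "x \<in> K" for x using g(2)[OF that] r(2)[OF that] by linarith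
  then show ?thesis using r(1) by blast
qed

section \<open>The L2 closure of the ridge steps\<close>

locale ridge_density = prob_space \<mu> for \<mu> :: "(real^'p::finite) measure" +
  fixes K :: "(real^'p) set"
  assumes sets_\<mu>: "sets \<mu> = sets borel" and compact: "compact K" and AE_K: "AE x in \<mu>. x \<in> K"
begin

abbreviation l2 :: "(real^'p \<Rightarrow> real) \<Rightarrow> ennreal" where
  "l2 u \<equiv> \<integral>\<^sup>+x. ennreal ((u x)\<^sup>2) \<partial>\<mu>"

definition approximable :: "(real^'p \<Rightarrow> real) \<Rightarrow> bool" where
  "approximable f \<longleftrightarrow> f \<in> borel_measurable borel \<and>
     (\<forall>\<epsilon>>0. \<exists>r. unit_ridge_step r \<and> l2 (\<lambda>x. r x - f x) \<le> ennreal \<epsilon>)"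

lemma measurable_\<mu>: "measurable \<mu> N = measurable borel N"
  by (rule measurable_cong_sets) (auto simp: sets_\<mu>)

lemma two_ennreal_add: "a \<ge> 0 \<Longrightarrow> b \<ge> 0 \<Longrightarrow> 2 * ennreal a + 2 * ennreal b = ennreal (2 * a + 2 * b)"
  by (simp add: ennreal_plus ennreal_mult)

lemma nn_integral_square_add_le:
  fixes u v :: "real^'p \<Rightarrow> real"
  assumes [measurable]: "u \<in> borel_measurable borel" "v \<in> borel_measurable borel"
  shows "l2 (\<lambda>x. u x + v x) \<le> 2 * l2 u + 2 * l2 v"
proof -
  have [measurable]: "u \<in> borel_measurable \<mu>" "v \<in> borel_measurable \<mu>" using assms by (simp_all add: measurable_\<mu>)
  have "l2 (\<lambda>x. u x + v x) \<le> (\<integral>\<^sup>+x. 2 * ennreal ((u x)\<^sup>2) + 2 * ennreal ((v x)\<^sup>2) \<partial>\<mu>)"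
  proof (intro nn_integral_mono)
    fix x
    have "(u x + v x)\<^sup>2 \<le> 2 * (u x)\<^sup>2 + 2 * (v x)\<^sup>2"
      using sum_squares_bound[of "u x" "v x"] by (simp add: power2_sum)
    then show "ennreal ((u x + v x)\<^sup>2) \<le> 2 * ennreal ((u x)\<^sup>2) + 2 * ennreal ((v x)\<^sup>2)"
      using ennreal_leI[of "(u x + v x)\<^sup>2" "2 * (u x)\<^sup>2 + 2 * (v x)\<^sup>2"]
      by (simp add: two_ennreal_add)
  qed
  also have "\<dots> = 2 * l2 u + 2 * l2 v"
    by (subst nn_integral_add) (auto simp: nn_integral_cmult)
  finally show ?thesis .
qed

lemma two_ennreal_quarter: "\<epsilon> > 0 \<Longrightarrow> 2 * ennreal (\<epsilon> / 4) + 2 * ennreal (\<epsilon> / 4) = ennreal \<epsilon>"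
  by (simp add: two_ennreal_add)

text \<open>A limit of approximable functions is approximable. The \<open>4\<close> offsets the
  constants in \<open>(u + v)\<^sup>2 \<le> 2 * u\<^sup>2 + 2 * v\<^sup>2\<close>, which stands in
  for the triangle inequality.\<close>

lemma approximable_closed:
  assumes f: "f \<in> borel_measurable borel"
    and approx: "\<And>\<epsilon>. \<epsilon> > 0 \<Longrightarrow> \<exists>g. approximable g \<and> l2 (\<lambda>x. g x - f x) \<le> ennreal \<epsilon>"
  shows "approximable f"
  unfolding approximable_def
proof (intro conjI allI impI f)
  fix \<epsilon> :: real assume \<epsilon>: "\<epsilon> > 0"
  then obtain g where g: "approximable g" "l2 (\<lambda>x. g x - f x) \<le> ennreal (\<epsilon> / 4)"
    using approx[of "\<epsilon> / 4"] by auto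
  then obtain r where r: "unit_ridge_step r" "l2 (\<lambda>x. r x - g x) \<le> ennreal (\<epsilon> / 4)"
    using g(1)[unfolded approximable_def, THEN conjunct2, rule_format, of "\<epsilon> / 4"] \<epsilon> by auto
  have meas: "(\<lambda>x. r x - g x) \<in> borel_measurable borel" "(\<lambda>x. g x - f x) \<in> borel_measurable borel"
    using f g(1) unit_ridge_step_measurable[OF r(1)] by (auto simp: approximable_def)
  have "l2 (\<lambda>x. r x - f x) \<le> 2 * ennreal (\<epsilon> / 4) + 2 * ennreal (\<epsilon> / 4)"
    (is "?I \<le> _")
  proof -
    have "?I \<le> 2 * l2 (\<lambda>x. r x - g x) + 2 * l2 (\<lambda>x. g x - f x)"
      using nn_integral_square_add_le[OF meas] by simp
    also have "\<dots> \<le> 2 * ennreal (\<epsilon> / 4) + 2 * ennreal (\<epsilon> / 4)"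
      by (intro add_mono mult_left_mono r(2) g(2)) auto
    finally show ?thesis .
  qed
  then show "\<exists>r. unit_ridge_step r \<and> l2 (\<lambda>x. r x - f x) \<le> ennreal \<epsilon>"
    using r(1) two_ennreal_quarter[OF \<epsilon>] by auto
qed

lemma approximable_add:
  assumes "approximable f" "approximable g"
  shows "approximable (\<lambda>x. f x + g x)"
  unfolding approximable_def
proof (intro conjI allI impI)
  show "(\<lambda>x. f x + g x) \<in> borel_measurable borel" using assms by (auto simp: approximable_def)
  fix \<epsilon> :: real assume \<epsilon>: "\<epsilon> > 0"
  then obtain r s where r: "unit_ridge_step r" "l2 (\<lambda>x. r x - f x) \<le> ennreal (\<epsilon> / 4)"
    and s: "unit_ridge_step s" "l2 (\<lambda>x. s x - g x) \<le> ennreal (\<epsilon> / 4)"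
    using assms[unfolded approximable_def, THEN conjunct2, rule_format, of "\<epsilon> / 4"] by auto
  have meas: "(\<lambda>x. r x - f x) \<in> borel_measurable borel" "(\<lambda>x. s x - g x) \<in> borel_measurable borel"
    using assms unit_ridge_step_measurable[OF r(1)] unit_ridge_step_measurable[OF s(1)]
    by (auto simp: approximable_def)
  have "l2 (\<lambda>x. (r x - f x) + (s x - g x)) \<le> 2 * ennreal (\<epsilon> / 4) + 2 * ennreal (\<epsilon> / 4)"
    by (rule order_trans[OF nn_integral_square_add_le[OF meas]])
      (intro add_mono mult_left_mono r(2) s(2); simp)
  moreover have "(r x - f x) + (s x - g x) = (r x + s x) - (f x + g x)" for x by simp
  ultimately show "\<exists>r. unit_ridge_step r \<and> l2 (\<lambda>x. r x - (f x + g x)) \<le> ennreal \<epsilon>"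
    using unit_ridge_step_add[OF r(1) s(1)] two_ennreal_quarter[OF \<epsilon>] by (intro exI[of _ "\<lambda>x. r x + s x"]) simp
qed

lemma approximable_mult:
  assumes "approximable f"
  shows "approximable (\<lambda>x. c * f x)"
  unfolding approximable_def
proof (intro conjI allI impI)
  have f: "f \<in> borel_measurable borel" using assms by (simp add: approximable_def)
  then show "(\<lambda>x. c * f x) \<in> borel_measurable borel" by simp
  fix \<epsilon> :: real assume \<epsilon>: "\<epsilon> > 0"
  \<comment> \<open>Dividing by \<open>c\<^sup>2 + 1\<close> instead of \<open>c\<^sup>2\<close>
    avoids a separate case for \<open>c = 0\<close>.\<close>
  have c: "c\<^sup>2 + 1 > 0" by (simp add: add_nonneg_pos)
  then obtain r where r: "unit_ridge_step r" "l2 (\<lambda>x. r x - f x) \<le> ennreal (\<epsilon> / (c\<^sup>2 + 1))"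
    using assms[unfolded approximable_def, THEN conjunct2, rule_format, of "\<epsilon> / (c\<^sup>2 + 1)"] \<epsilon> by auto
  have [measurable]: "f \<in> borel_measurable \<mu>" "r \<in> borel_measurable \<mu>"
    using f unit_ridge_step_measurable[OF r(1)] by (simp_all add: measurable_\<mu>)
  have "l2 (\<lambda>x. c * r x - c * f x) = (\<integral>\<^sup>+x. ennreal (c\<^sup>2) * ennreal ((r x - f x)\<^sup>2) \<partial>\<mu>)"
    by (intro nn_integral_cong) (simp add: power_mult_distrib flip: ennreal_mult right_diff_distrib)
  also have "\<dots> = ennreal (c\<^sup>2) * l2 (\<lambda>x. r x - f x)"
    by (rule nn_integral_cmult) simp
  also have "\<dots> \<le> ennreal (c\<^sup>2) * ennreal (\<epsilon> / (c\<^sup>2 + 1))" by (rule mult_left_mono[OF r(2)]) simp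
  also have "\<dots> \<le> ennreal \<epsilon>"
    using c \<epsilon> by (simp flip: ennreal_mult) (simp add: field_simps)
  finally show "\<exists>r. unit_ridge_step r \<and> l2 (\<lambda>x. r x - c * f x) \<le> ennreal \<epsilon>"
    using unit_ridge_step_mult[OF r(1)] by blast
qed

lemma approximable_dominated_limit:
  fixes u :: "nat \<Rightarrow> real^'p \<Rightarrow> real"
  assumes u: "\<And>i. approximable (u i)" and f: "f \<in> borel_measurable borel" and w: "w \<in> borel_measurable borel"
    and bound: "\<And>i x. (u i x - f x)\<^sup>2 \<le> w x" and fin: "(\<integral>\<^sup>+x. ennreal (w x) \<partial>\<mu>) < \<infinity>"
    and lim: "\<And>x. (\<lambda>i. u i x) \<longlonglongrightarrow> f x"
  shows "approximable f"
proof (rule approximable_closed[OF f])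
  fix \<epsilon> :: real assume \<epsilon>: "\<epsilon> > 0"
  have [measurable]: "f \<in> borel_measurable \<mu>" "\<And>i. u i \<in> borel_measurable \<mu>" "w \<in> borel_measurable \<mu>"
    using f w u by (auto simp: measurable_\<mu> approximable_def)
  have "(\<lambda>i. \<integral>\<^sup>+x. ennreal ((u i x - f x)\<^sup>2) \<partial>\<mu>) \<longlonglongrightarrow> (\<integral>\<^sup>+x. 0 \<partial>\<mu>)"
  proof (rule nn_integral_dominated_convergence[where w = "\<lambda>x. ennreal (w x)"])
    show "AE x in \<mu>. (\<lambda>i. ennreal ((u i x - f x)\<^sup>2)) \<longlonglongrightarrow> 0"
    proof (rule AE_I2)
      fix x
      have "(\<lambda>i. (u i x - f x)\<^sup>2) \<longlonglongrightarrow> (f x - f x)\<^sup>2" by (intro tendsto_intros lim)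
      then show "(\<lambda>i. ennreal ((u i x - f x)\<^sup>2)) \<longlonglongrightarrow> 0"
        using tendsto_ennrealI by fastforce
    qed
  qed (use bound fin in \<open>auto intro: ennreal_leI\<close>)
  then have "\<forall>\<^sub>F i in sequentially. l2 (\<lambda>x. u i x - f x) < ennreal \<epsilon>"
    using \<epsilon> by (intro order_tendstoD(2)) auto
  then obtain i where "l2 (\<lambda>x. u i x - f x) < ennreal \<epsilon>"
    by (auto simp: eventually_sequentially)
  then show "\<exists>g. approximable g \<and> l2 (\<lambda>x. g x - f x) \<le> ennreal \<epsilon>"
    using u less_imp_le by blast
qed

lemma approximable_continuous:
  assumes f: "continuous_on UNIV f"
  shows "approximable f"
  unfolding approximable_def
proof (intro conjI allI impI)
  show "f \<in> borel_measurable borel" using f by (rule borel_measurable_continuous_onI)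
  fix \<epsilon> :: real assume \<epsilon>: "\<epsilon> > 0"
  obtain r where r: "unit_ridge_step r" "\<And>x. x \<in> K \<Longrightarrow> \<bar>r x - f x\<bar> < sqrt \<epsilon>"
    using continuous_uniform_approx[OF continuous_on_subset[OF f subset_UNIV] compact, of "sqrt \<epsilon>"] \<epsilon> by auto
  have "(r x - f x)\<^sup>2 \<le> \<epsilon>" if "x \<in> K" for x
    using r(2)[OF that] by (metis abs_ge_zero less_imp_le power2_abs power_mono real_sqrt_pow2 \<epsilon>)
  then have "l2 (\<lambda>x. r x - f x) \<le> (\<integral>\<^sup>+x. ennreal \<epsilon> \<partial>\<mu>)"
    using AE_K by (intro nn_integral_mono_AE) (auto intro: ennreal_leI)
  then show "\<exists>r. unit_ridge_step r \<and> l2 (\<lambda>x. r x - f x) \<le> ennreal \<epsilon>"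
    using r(1) by (auto simp: emeasure_space_1)
qed

text \<open>The functions \<open>1 - i * infdist x C\<close>, cut off at zero, are continuous and
  decrease to the indicator.\<close>

lemma approximable_indicator_closed:
  assumes C: "closed C"
  shows "approximable (indicator C)"
\<comment> \<open>\<open>infdist\<close> to the empty set is \<open>0\<close>, which would make the
  functions \<open>u\<close> constantly \<open>1\<close>.\<close>
proof (cases "C = {}")
  case True
  then have "(indicator C :: real^'p \<Rightarrow> real) = (\<lambda>_. 0)" by (simp add: fun_eq_iff)
  then show ?thesis using approximable_continuous[of "\<lambda>_. 0"] by simp
next
  case False
  define u where "u i x = max 0 (1 - real i * infdist x C)" for i :: nat and x
  show ?thesis
  proof (rule approximable_dominated_limit[where u = u and w = "\<lambda>_. 1"])
    show "approximable (u i)" for i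
      unfolding u_def by (intro approximable_continuous continuous_intros)
    show "(\<lambda>i. u i x) \<longlonglongrightarrow> indicator C x" for x
    proof (cases "x \<in> C")
      case True
      then show ?thesis by (simp add: u_def)
    next
      case x: False
      then have d: "infdist x C > 0" using infdist_pos_not_in_closed[OF C False] by simp
      obtain k :: nat where "1 / infdist x C < real k" using reals_Archimedean2 by blast
      then have "u i x = 0" if "i \<ge> k" for i
      proof -
        have "1 < real k * infdist x C" using \<open>1 / infdist x C < real k\<close> d by (simp add: field_simps)
        also have "\<dots> \<le> real i * infdist x C" using that d by (intro mult_right_mono) auto
        finally show ?thesis by (simp add: u_def)
      qed
      then have "\<forall>\<^sub>F i in sequentially. u i x = 0" by (auto simp: eventually_sequentially)
      then show ?thesis using x by (simp add: tendsto_eventually)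
    qed
    show "(u i x - indicator C x)\<^sup>2 \<le> 1" for i x
    proof -
      have "0 \<le> u i x" "u i x \<le> 1" by (auto simp: u_def infdist_nonneg)
      then have "\<bar>u i x - indicator C x\<bar> \<le> 1" by (auto simp: indicator_def)
      then show ?thesis by (simp add: abs_square_le_1)
    qed
  qed (use C in \<open>auto simp: emeasure_space_1\<close>)
qed

text \<open>Dynkin's theorem with the closed sets as generator; a disjoint union is the limit of its
  partial sums, whose error is at most \<open>1\<close>.\<close>

lemma approximable_indicator:
  assumes "A \<in> sets borel"
  shows "approximable (indicator A)"
proof -
  have sets: "sets borel = sigma_sets UNIV (Collect closed :: (real^'p) set set)"
    by (simp add: borel_eq_closed)
  have "Int_stable (Collect closed :: (real^'p) set set)" "Collect closed \<subseteq> Pow (UNIV :: (real^'p) set)"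
    by (auto simp: Int_stable_def)
  moreover have "A \<in> sigma_sets UNIV (Collect closed)" using assms sets by simp
  ultimately show ?thesis
  proof (induction rule: sigma_sets_induct_disjoint)
    case (compl A)
    have "indicator (UNIV - A) x = 1 + -1 * (indicator A x :: real)" for x by (auto simp: indicator_def)
    then have "indicator (UNIV - A) = (\<lambda>x. 1 + -1 * indicator A x :: real)" by (rule ext)
    then show ?case
      using approximable_add[OF approximable_continuous approximable_mult[OF compl.IH], of "\<lambda>_. 1" "-1"] by simp
  next
    case (union A)
    define u where "u i x = (\<Sum>j<i. indicator (A j) x :: real)" for i x
    have "approximable (u i)" for i
    proof (induction i)
      case 0
      then show ?case using approximable_continuous[of "\<lambda>_. 0"] by (simp add: u_def[abs_def])
    next
      case (Suc i)
      then show ?case using approximable_add[OF Suc union.IH[of i]] by (simp add: u_def[abs_def])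
    qed
    moreover have "indicator (\<Union>(range A)) \<in> borel_measurable borel"
      using union(2) sets by (intro borel_measurable_indicator sets.countable_UN) auto
    moreover have "(u i x - indicator (\<Union>(range A)) x)\<^sup>2 \<le> 1" for i x
    proof -
      have "u i x = indicator (\<Union>j<i. A j) x"
        unfolding u_def using union(1) by (subst indicator_UN_disjoint) (auto simp: disjoint_family_on_def)
      then have "\<bar>u i x - indicator (\<Union>(range A)) x\<bar> \<le> 1" by (simp add: indicator_def)
      then show ?thesis by (simp add: abs_square_le_1)
    qed
    moreover have "(\<lambda>i. u i x) \<longlonglongrightarrow> indicator (\<Union>(range A)) x" for x
    proof -
      have "(\<lambda>j. indicator (A j) x :: real) sums indicator (\<Union>(range A)) x"
        using indicator_sums[of A x] union(1) by (auto simp: disjoint_family_on_def)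
      then show ?thesis by (simp add: sums_def u_def)
    qed
    ultimately show ?case
      by - (rule approximable_dominated_limit[where u = u and w = "\<lambda>_. 1"], auto simp: emeasure_space_1)
  next
    case empty
    show ?case by (rule approximable_indicator_closed) simp
  qed (use approximable_indicator_closed in auto)
qed

text \<open>Induction over nonnegative measurable functions. A finite norm passes to the parts,
  which are nonnegative and lie below the whole; for monotone limits the error is dominated by
  \<open>(f x)\<^sup>2\<close>.\<close>

lemma approximable_nonneg:
  assumes "f \<in> borel_measurable borel" "\<And>x. f x \<ge> 0" "l2 f < \<infinity>"
  shows "approximable f"
  using assms
proof (induction f rule: borel_measurable_induct_real)
  case (set A)
  then show ?case using approximable_indicator by simp
next
  case (mult u c)
  have [measurable]: "u \<in> borel_measurable \<mu>" using mult by (simp add: measurable_\<mu>)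
  show ?case
  \<comment> \<open>For \<open>c = 0\<close> the norm of \<open>u\<close> may be infinite, so the
    induction hypothesis cannot be used.\<close>
  proof (cases "c = 0")
    case True
    then show ?thesis using approximable_continuous[of "\<lambda>_. 0"] by simp
  next
    case False
    have "l2 (\<lambda>x. c * u x) = ennreal (c\<^sup>2) * l2 u"
      by (subst nn_integral_cmult[symmetric]) (auto simp: power_mult_distrib ennreal_mult intro!: nn_integral_cong)
    then have "l2 u < \<infinity>"
      using mult.prems False by (auto simp: ennreal_mult_less_top)
    then show ?thesis using mult approximable_mult by simp
  qed
next
  case (add u v)
  have "l2 u \<le> l2 (\<lambda>x. v x + u x)"
    "l2 v \<le> l2 (\<lambda>x. v x + u x)"
    using add.hyps by (intro nn_integral_mono ennreal_leI power_mono; simp)+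
  then have "approximable u" "approximable v" using add by (meson le_less_trans)+
  then show ?case by (rule approximable_add[rotated])
next
  case (seq U)
  have lim: "(\<lambda>i. U i x) \<longlonglongrightarrow> f x" for x using seq by simp
  have le: "U i x \<le> f x" for i x
    using \<open>incseq U\<close> lim by (intro incseq_le[of "\<lambda>i. U i x"]) (auto simp: incseq_def le_fun_def)
  have "approximable (U i)" for i
  proof (rule seq.IH)
    have "l2 (\<lambda>x. U i x) \<le> l2 f"
      using seq.hyps le by (intro nn_integral_mono ennreal_leI power_mono) auto
    then show "l2 (\<lambda>x. U i x) < \<infinity>" using seq.prems by (meson le_less_trans)
  qed
  moreover have "f \<in> borel_measurable borel" using assms(1) by simp
  moreover have "(U i x - f x)\<^sup>2 \<le> (f x)\<^sup>2" for i x
  proof -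
    have "\<bar>U i x - f x\<bar> \<le> \<bar>f x\<bar>" using le[of i x] seq(2)[of i x] by linarith
    then show ?thesis by (simp add: abs_le_square_iff)
  qed
  ultimately show ?case
    using seq.prems lim by - (rule approximable_dominated_limit[where u = U and w = "\<lambda>x. (f x)\<^sup>2"], auto)
qed

lemma approximable_square_integrable:
  assumes f: "f \<in> borel_measurable borel" and fin: "l2 f < \<infinity>"
  shows "approximable f"
proof -
  have "approximable (\<lambda>x. max 0 (f x))"
  proof (rule approximable_nonneg)
    have "l2 (\<lambda>x. max 0 (f x)) \<le> l2 f"
      by (intro nn_integral_mono ennreal_leI) (auto simp: max_def)
    then show "l2 (\<lambda>x. max 0 (f x)) < \<infinity>" using fin by (rule le_less_trans)
  qed (use f in auto)
  moreover have "approximable (\<lambda>x. max 0 (- f x))"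
  proof (rule approximable_nonneg)
    have "l2 (\<lambda>x. max 0 (- f x)) \<le> l2 f"
      by (intro nn_integral_mono ennreal_leI) (auto simp: max_def)
    then show "l2 (\<lambda>x. max 0 (- f x)) < \<infinity>" using fin by (rule le_less_trans)
  qed (use f in auto)
  ultimately have "approximable (\<lambda>x. max 0 (f x) + -1 * max 0 (- f x))"
    using approximable_mult by (intro approximable_add)
  moreover have "max 0 (f x) + -1 * max 0 (- f x) = f x" for x by auto
  ultimately show ?thesis by simp
qed

end

section \<open>Risk of a single tree\<close>

text \<open>\<open>regression\<close> is the defining property of a conditional expectation, tested
  against bounded functions of the first component; in this form it speaks of \<open>\<nu>\<close>
  alone.\<close>

locale regression_estimator = bounded_estimator \<nu> n H sel R t c
  for \<nu> :: "((real^'p::finite) \<times> real) measure" and n H and sel :: "'p split_rule" and R t c +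
  fixes m :: "real^'p \<Rightarrow> real"
  assumes m_measurable: "m \<in> borel_measurable borel"
    and m_L2: "integrable \<nu> (\<lambda>z. (m (fst z))\<^sup>2)"
    and regression: "\<And>g b. g \<in> borel_measurable borel \<Longrightarrow> (\<And>x. \<bar>g x\<bar> \<le> b) \<Longrightarrow>
      (\<integral>z. snd z * g (fst z) \<partial>\<nu>) = (\<integral>z. m (fst z) * g (fst z) \<partial>\<nu>)"
begin

text \<open>By \<open>regression\<close> the cross terms with \<open>snd z\<close> and with
  \<open>m (fst z)\<close> have equal integrals, so the risk is the mean of
  \<open>excess_loss\<close> plus a constant. The bound \<open>b\<close> may be specific to
  \<open>g\<close>, hence to the sample when \<open>g\<close> is a tree.\<close>

lemma bounded_risk:
  assumes g: "g \<in> borel_measurable borel" and b: "\<And>x. \<bar>g x\<bar> \<le> b"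
  shows "integrable \<nu> (\<lambda>z. (g (fst z) - m (fst z))\<^sup>2)"
    and "integrable \<nu> (excess_loss g)"
    and "(\<integral>z. (g (fst z) - m (fst z))\<^sup>2 \<partial>\<nu>) = (\<integral>z. excess_loss g z \<partial>\<nu>) + (\<integral>z. (m (fst z))\<^sup>2 \<partial>\<nu>)"
proof -
  have [measurable]: "(\<lambda>z. g (fst z)) \<in> borel_measurable \<nu>" "(\<lambda>z. m (fst z)) \<in> borel_measurable \<nu>"
    using measurable_compose[OF fst_snd_measurable(1) g] measurable_compose[OF fst_snd_measurable(1) m_measurable] .
  have b0: "b \<ge> 0" using b[of 0] by linarith
  have sq: "(g x)\<^sup>2 \<le> b\<^sup>2" for x using b by (metis abs_le_square_iff abs_of_nonneg b0)
  have g2: "integrable \<nu> (\<lambda>z. (g (fst z))\<^sup>2)"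
    by (rule integrable_const_bound[where B = "b\<^sup>2"]) (use sq in auto)
  have mult: "integrable \<nu> (\<lambda>z. u z * g (fst z))"
    if u: "integrable \<nu> (\<lambda>z. (u z)\<^sup>2)" and [measurable]: "u \<in> borel_measurable \<nu>" for u :: "_ \<Rightarrow> real"
  proof (rule Bochner_Integration.integrable_bound)
    show "integrable \<nu> (\<lambda>z. (u z)\<^sup>2 + (g (fst z))\<^sup>2)" using u g2 by simp
    show "AE z in \<nu>. norm (u z * g (fst z)) \<le> norm ((u z)\<^sup>2 + (g (fst z))\<^sup>2)"
    proof (rule AE_I2)
      fix z
      have "2 * (\<bar>u z\<bar> * \<bar>g (fst z)\<bar>) \<le> (u z)\<^sup>2 + (g (fst z))\<^sup>2"
        using sum_squares_bound[of "\<bar>u z\<bar>" "\<bar>g (fst z)\<bar>"] by (simp add: mult.assoc)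
      moreover have "0 \<le> \<bar>u z\<bar> * \<bar>g (fst z)\<bar>" by simp
      ultimately have "\<bar>u z\<bar> * \<bar>g (fst z)\<bar> \<le> (u z)\<^sup>2 + (g (fst z))\<^sup>2" by linarith
      then show "norm (u z * g (fst z)) \<le> norm ((u z)\<^sup>2 + (g (fst z))\<^sup>2)"
        by (simp add: abs_mult)
    qed
  qed measurable
  have yg: "integrable \<nu> (\<lambda>z. snd z * g (fst z))"
    by (rule mult[OF integrable_square]) measurable
  have mg: "integrable \<nu> (\<lambda>z. m (fst z) * g (fst z))"
    by (rule mult[OF m_L2]) measurable
  have loss: "excess_loss g = (\<lambda>z. (g (fst z))\<^sup>2 - 2 * (snd z * g (fst z)))"
    by (auto simp: excess_loss_def fun_eq_iff)
  show "integrable \<nu> (excess_loss g)" unfolding loss using g2 yg by simp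
  have sq_eq: "(g (fst z) - m (fst z))\<^sup>2 = (g (fst z))\<^sup>2 - 2 * (m (fst z) * g (fst z)) + (m (fst z))\<^sup>2" for z
    by (simp add: power2_diff)
  show "integrable \<nu> (\<lambda>z. (g (fst z) - m (fst z))\<^sup>2)" unfolding sq_eq using g2 mg m_L2 by simp
  show "(\<integral>z. (g (fst z) - m (fst z))\<^sup>2 \<partial>\<nu>) = (\<integral>z. excess_loss g z \<partial>\<nu>) + (\<integral>z. (m (fst z))\<^sup>2 \<partial>\<nu>)"
    unfolding sq_eq loss using g2 mg yg m_L2 regression[OF g b] by simp
qed

lemma est_bounded: "\<bar>est D x\<bar> \<le> sqrt (\<Sum>k\<in>H. (snd (D k))\<^sup>2)"
  using est_square_le[of D x] by (metis real_sqrt_abs real_sqrt_le_iff)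

lemma integrable_excess_risk: "integrable Sample (\<lambda>D. \<integral>z. excess_loss (est D) z \<partial>\<nu>)"
proof (rule Bochner_Integration.integrable_bound)
  interpret Sample: prob_space Sample by (rule prob_space_PiM) (rule prob)
  show "integrable Sample (\<lambda>D. (\<integral>z. (snd z)\<^sup>2 \<partial>\<nu>) + 2 * (\<Sum>k\<in>H. (snd (D k))\<^sup>2))"
    by (intro Bochner_Integration.integrable_add integrable_mult_right integrable_sum_squares
        Sample.integrable_const)
  show "(\<lambda>D. \<integral>z. excess_loss (est D) z \<partial>\<nu>) \<in> borel_measurable Sample"
    using excess_loss_measurable[OF measurable_fst measurable_snd]
    by (intro borel_measurable_lebesgue_integral) (simp add: case_prod_beta)
  show "AE D in Sample. norm (\<integral>z. excess_loss (est D) z \<partial>\<nu>) \<le> norm ((\<integral>z. (snd z)\<^sup>2 \<partial>\<nu>) + 2 * (\<Sum>k\<in>H. (snd (D k))\<^sup>2))"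
  proof (rule AE_I2)
    fix D assume D: "D \<in> space Sample"
    have int: "integrable \<nu> (excess_loss (est D))"
      by (rule bounded_risk(2)[OF est_measurable_point[OF D] est_bounded])
    have "\<bar>\<integral>z. excess_loss (est D) z \<partial>\<nu>\<bar> \<le> (\<integral>z. \<bar>excess_loss (est D) z\<bar> \<partial>\<nu>)" by (rule integral_abs_bound)
    also have "\<dots> \<le> (\<integral>z. (snd z)\<^sup>2 + 2 * (\<Sum>k\<in>H. (snd (D k))\<^sup>2) \<partial>\<nu>)"
      using int integrable_square abs_excess_loss_le by (intro integral_mono) auto
    also have "\<dots> = (\<integral>z. (snd z)\<^sup>2 \<partial>\<nu>) + 2 * (\<Sum>k\<in>H. (snd (D k))\<^sup>2)"
      using integrable_square by (simp add: prob_space)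
    finally show "norm (\<integral>z. excess_loss (est D) z \<partial>\<nu>) \<le> norm ((\<integral>z. (snd z)\<^sup>2 \<partial>\<nu>) + 2 * (\<Sum>k\<in>H. (snd (D k))\<^sup>2))"
      by simp
  qed
qed

lemma nn_integral_risk:
  "(\<integral>\<^sup>+D. (\<integral>\<^sup>+x. ennreal (\<bar>odt_estimator sel D H R t x - m x\<bar>\<^sup>2) \<partial>distr \<nu> borel fst) \<partial>Sample)
     = ennreal ((\<integral>D. (\<integral>z. excess_loss (est D) z \<partial>\<nu>) \<partial>Sample) + (\<integral>z. (m (fst z))\<^sup>2 \<partial>\<nu>))"
proof -
  interpret Sample: prob_space Sample by (rule prob_space_PiM) (rule prob)
  define r where "r D = (\<integral>z. excess_loss (est D) z \<partial>\<nu>) + (\<integral>z. (m (fst z))\<^sup>2 \<partial>\<nu>)" for D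
  have r: "(\<integral>\<^sup>+x. ennreal (\<bar>odt_estimator sel D H R t x - m x\<bar>\<^sup>2) \<partial>distr \<nu> borel fst) = ennreal (r D)" "0 \<le> r D"
    if D: "D \<in> space Sample" for D
  proof -
    note b = bounded_risk[OF est_measurable_point[OF D] est_bounded]
    have [measurable]: "est D \<in> borel_measurable borel" "m \<in> borel_measurable borel"
      using est_measurable_point[OF D] m_measurable .
    have "(\<integral>\<^sup>+x. ennreal (\<bar>est D x - m x\<bar>\<^sup>2) \<partial>distr \<nu> borel fst)
        = (\<integral>\<^sup>+z. ennreal ((est D (fst z) - m (fst z))\<^sup>2) \<partial>\<nu>)"
      by (subst nn_integral_distr) auto
    also have "\<dots> = ennreal (\<integral>z. (est D (fst z) - m (fst z))\<^sup>2 \<partial>\<nu>)"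
      by (rule nn_integral_eq_integral[OF b(1)]) simp
    finally show "(\<integral>\<^sup>+x. ennreal (\<bar>odt_estimator sel D H R t x - m x\<bar>\<^sup>2) \<partial>distr \<nu> borel fst) = ennreal (r D)"
      unfolding b(3) r_def by (simp only: est_def)
    have "0 \<le> (\<integral>z. (est D (fst z) - m (fst z))\<^sup>2 \<partial>\<nu>)" by simp
    then show "0 \<le> r D" by (simp add: b(3) r_def)
  qed
  have int: "integrable Sample r"
    unfolding r_def by (intro Bochner_Integration.integrable_add integrable_excess_risk Sample.integrable_const)
  have "(\<integral>\<^sup>+D. (\<integral>\<^sup>+x. ennreal (\<bar>odt_estimator sel D H R t x - m x\<bar>\<^sup>2) \<partial>distr \<nu> borel fst) \<partial>Sample)
      = (\<integral>\<^sup>+D. ennreal (r D) \<partial>Sample)"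
    using r(1) by (rule nn_integral_cong)
  also have "\<dots> = ennreal (\<integral>D. r D \<partial>Sample)"
    using r(2) by (intro nn_integral_eq_integral int AE_I2)
  also have "(\<integral>D. r D \<partial>Sample) = (\<integral>D. (\<integral>z. excess_loss (est D) z \<partial>\<nu>) \<partial>Sample) + (\<integral>z. (m (fst z))\<^sup>2 \<partial>\<nu>)"
    unfolding r_def Bochner_Integration.integral_add[OF integrable_excess_risk Sample.integrable_const]
    by (simp add: Sample.prob_space del: One_nat_def)
  finally show ?thesis .
qed

end

lemma ridge_step_bounded: "\<bar>ridge_step c0 ps x\<bar> \<le> \<bar>c0\<bar> + (\<Sum>(c, \<theta>, s)\<leftarrow>ps. \<bar>c\<bar>)"
proof (induction ps)
  case (Cons p ps)
  obtain c \<theta> s where p: "p = (c, \<theta>, s)" by (cases p)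
  have "ridge_step c0 (p # ps) x = c * of_bool (\<theta> \<bullet> x > s) + ridge_step c0 ps x"
    by (simp add: ridge_step_def p)
  moreover have "\<bar>c * of_bool (\<theta> \<bullet> x > s)\<bar> \<le> \<bar>c\<bar>" by (simp add: of_bool_def)
  ultimately show ?case using Cons by (simp add: p del: of_bool_def)
qed (simp add: ridge_step_def)

text \<open>For fixed \<open>R\<close> the risk is bounded by the mean training loss plus the
  deviation; for almost every sample the mean over \<open>R\<close> of the training loss is bounded
  by that of \<open>f\<close> plus the descent terms. Feature sequences have finite support, so the
  exchange of means is one of finite sums. The risk of \<open>f\<close> appears because the mean
  loss of a fixed function is the same on training and on fresh data.\<close>

lemma tree_risk_le:
  fixes \<nu> :: "((real^'p::finite) \<times> real) measure" and sel :: "'p split_rule" and Q :: "'p set pmf"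
    and m :: "real^'p \<Rightarrow> real"
  assumes RE: "\<And>R. \<forall>\<tau>\<in>{1..t - 1}. R \<tau> \<noteq> {} \<Longrightarrow> regression_estimator \<nu> n H sel R t c m"
    and cube: "AE z in \<nu>. fst z \<in> cbox 0 1"
    and Q: "pmf Q {} = 0" "pmf Q UNIV > 0"
    and sel: "\<And>\<tau> D A F. \<tau> \<in> {1..t - 1} \<Longrightarrow> A \<subseteq> cbox 0 1 \<Longrightarrow> F \<noteq> {} \<Longrightarrow> node_count D H A \<ge> 2 \<Longrightarrow>
      split_maximizer D H A F (sel \<tau> (restrict D H) H A F)"
    and f: "f = ridge_step c0 ps" and unit: "\<And>c \<theta> s. (c, \<theta>, s) \<in> set ps \<Longrightarrow> norm \<theta> = 1"
    and V: "(\<Sum>(c, \<theta>, s)\<leftarrow>ps. \<bar>c\<bar>) \<le> V" "V > 0"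
    and L: "2 ^ L \<le> t" "L > 0" and \<eta>: "\<eta> > 0"
  defines "a \<equiv> real (card H)" and "K \<equiv> (\<integral>z. exp (c * (snd z)\<^sup>2) \<partial>\<nu>)"
  shows "(\<integral>\<^sup>+R. (\<integral>\<^sup>+D. (\<integral>\<^sup>+x. ennreal (\<bar>odt_estimator sel D H R t x - m x\<bar>\<^sup>2) \<partial>distr \<nu> borel fst)
        \<partial>Pi\<^sub>M {1..n} (\<lambda>_. \<nu>)) \<partial>measure_pmf (Pi_pmf {1..t-1} UNIV (\<lambda>_. Q)))
    \<le> ennreal ((\<integral>z. (f (fst z) - m (fst z))\<^sup>2 \<partial>\<nu>) + \<eta>
        + V\<^sup>2 / (4 * \<eta> * pmf Q UNIV * real L) * (\<integral>z. (snd z)\<^sup>2 \<partial>\<nu>)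
        + 6 * ((ln (2 * a * K) + 1) / c) * sqrt (2 * a * ln (tree_class_bound CARD('p) (card H) t)) / a)"
proof -
  define P where "P = Pi_pmf {1..t-1} (UNIV :: 'p set) (\<lambda>_. Q)"
  define Sample where "Sample = Pi\<^sub>M {1..n} (\<lambda>_. \<nu>)"
  define lo where "lo R D = excess_loss (odt_estimator sel D H R t)" for R D
  define Gen where "Gen = 6 * ((ln (2 * a * K) + 1) / c) * sqrt (2 * a * ln (tree_class_bound CARD('p) (card H) t))"
  define Em where "Em = (\<integral>z. (m (fst z))\<^sup>2 \<partial>\<nu>)"
  define \<kappa> where "\<kappa> = V\<^sup>2 / (4 * \<eta> * pmf Q UNIV * real L)"
  define risk where "risk R = (\<integral>D. (\<integral>z. lo R D z \<partial>\<nu>) \<partial>Sample) + Em" for R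
  define tr where "tr R D = (\<Sum>i\<in>H. lo R D (D i))" for R D
  interpret U: regression_estimator \<nu> n H sel "\<lambda>_. UNIV" t c m by (rule RE) simp
  interpret Sample: prob_space Sample unfolding Sample_def by (rule prob_space_PiM) (rule U.prob)
  have a: "a > 0" using U.H U.finite_H by (simp add: a_def card_gt_0_iff)
  have finP: "finite (set_pmf P)" by (simp add: P_def set_Pi_pmf finite_PiE_dflt)
  have intP [simp]: "integrable (measure_pmf P) h" for h :: "(nat \<Rightarrow> 'p set) \<Rightarrow> real"
    by (rule integrable_measure_pmf_finite[OF finP])
  have expP: "measure_pmf.expectation P h = (\<Sum>R\<in>set_pmf P. pmf P R * h R)" for h
    using integral_measure_pmf[OF finP, of P h] by simp
  have RE': "regression_estimator \<nu> n H sel R t c m" if "R \<in> set_pmf P" for R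
  proof (rule RE, rule ballI)
    fix \<tau> assume "\<tau> \<in> {1..t - 1}"
    then have "R \<tau> \<in> set_pmf Q" using that by (auto simp: P_def set_Pi_pmf PiE_dflt_def)
    then show "R \<tau> \<noteq> {}" using Q(1) by (auto simp: set_pmf_eq)
  qed
  have risk: "(\<integral>\<^sup>+D. (\<integral>\<^sup>+x. ennreal (\<bar>odt_estimator sel D H R t x - m x\<bar>\<^sup>2) \<partial>distr \<nu> borel fst) \<partial>Sample) = ennreal (risk R)"
    and train_int: "\<And>i. i \<in> H \<Longrightarrow> integrable Sample (\<lambda>D. lo R D (D i))"
    and risk_le: "a * risk R \<le> (\<integral>D. tr R D \<partial>Sample) + Gen + a * Em"
    if R: "R \<in> set_pmf P" for R
  proof -
    interpret regression_estimator \<nu> n H sel R t c m by (rule RE'[OF R])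
    have lo: "lo R D = excess_loss (est D)" for D by (simp add: lo_def est_def)
    show "(\<integral>\<^sup>+D. (\<integral>\<^sup>+x. ennreal (\<bar>odt_estimator sel D H R t x - m x\<bar>\<^sup>2) \<partial>distr \<nu> borel fst) \<partial>Sample) = ennreal (risk R)"
      unfolding risk_def lo Em_def Sample_def by (rule nn_integral_risk)
    show int: "integrable Sample (\<lambda>D. lo R D (D i))" if "i \<in> H" for i
      unfolding lo Sample_def by (rule integrable_training_loss[OF that])
    have "(\<integral>D. tr R D \<partial>Sample) = (\<Sum>i\<in>H. \<integral>D. lo R D (D i) \<partial>Sample)"
      unfolding tr_def by (rule Bochner_Integration.integral_sum[OF int])
    then show "a * risk R \<le> (\<integral>D. tr R D \<partial>Sample) + Gen + a * Em"
      using deviation_le unfolding risk_def lo Gen_def a_def K_def Sample_def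
      by (simp add: distrib_left)
  qed
  have tr_int: "integrable Sample (\<lambda>D. tr R D)" if "R \<in> set_pmf P" for R
    unfolding tr_def by (rule Bochner_Integration.integrable_sum[OF train_int[OF that]])
  define af where "af = (\<integral>z. excess_loss f z \<partial>\<nu>)"
  have f_meas: "f \<in> borel_measurable borel"
    using unit by (intro unit_ridge_step_measurable) (auto simp: unit_ridge_step_def f intro!: exI[of _ c0] exI[of _ ps])
  note f_risk = U.bounded_risk[OF f_meas ridge_step_bounded[of c0 ps, folded f]]
  have sq_int: "integrable Sample (\<lambda>D. (snd (D i))\<^sup>2)" "(\<integral>D. (snd (D i))\<^sup>2 \<partial>Sample) = (\<integral>z. (snd z)\<^sup>2 \<partial>\<nu>)"
    and f_int: "integrable Sample (\<lambda>D. excess_loss f (D i))" "(\<integral>D. excess_loss f (D i) \<partial>Sample) = af"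
    if "i \<in> H" for i
  proof -
    have i: "i \<in> {1..n}" using that U.H by auto
    show "integrable Sample (\<lambda>D. (snd (D i))\<^sup>2)" "(\<integral>D. (snd (D i))\<^sup>2 \<partial>Sample) = (\<integral>z. (snd z)\<^sup>2 \<partial>\<nu>)"
      unfolding Sample_def by (rule integrable_PiM_component[OF U.prob _ i U.integrable_square]; simp)+
    show "integrable Sample (\<lambda>D. excess_loss f (D i))" "(\<integral>D. excess_loss f (D i) \<partial>Sample) = af"
      unfolding Sample_def af_def by (rule integrable_PiM_component[OF U.prob _ i f_risk(2)]; simp)+
  qed
  define bd where "bd D = (\<Sum>i\<in>H. excess_loss f (D i)) + a * \<eta> + \<kappa> * (\<Sum>i\<in>H. (snd (D i))\<^sup>2)" for D
  have bd_int: "integrable Sample bd"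
    unfolding bd_def using sq_int(1) f_int(1)
    by (intro Bochner_Integration.integrable_add integrable_mult_right Bochner_Integration.integrable_sum Sample.integrable_const)
  have E_bd: "(\<integral>D. bd D \<partial>Sample) = a * af + a * \<eta> + \<kappa> * (a * (\<integral>z. (snd z)\<^sup>2 \<partial>\<nu>))"
  proof -
    have "(\<integral>D. bd D \<partial>Sample) = (\<integral>D. (\<Sum>i\<in>H. excess_loss f (D i)) \<partial>Sample) + (\<integral>D. a * \<eta> \<partial>Sample)
        + (\<integral>D. \<kappa> * (\<Sum>i\<in>H. (snd (D i))\<^sup>2) \<partial>Sample)"
    proof -
      have 1: "integrable Sample (\<lambda>D. \<Sum>i\<in>H. excess_loss f (D i))"
        by (rule Bochner_Integration.integrable_sum[OF f_int(1)])
      have 2: "integrable Sample (\<lambda>D. \<kappa> * (\<Sum>i\<in>H. (snd (D i))\<^sup>2))"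
        by (intro integrable_mult_right Bochner_Integration.integrable_sum sq_int(1))
      show ?thesis
        unfolding bd_def Bochner_Integration.integral_add[OF Bochner_Integration.integrable_add[OF 1 Sample.integrable_const] 2]
          Bochner_Integration.integral_add[OF 1 Sample.integrable_const] ..
    qed
    also have "(\<integral>D. (\<Sum>i\<in>H. excess_loss f (D i)) \<partial>Sample) = a * af"
      using f_int by (subst Bochner_Integration.integral_sum) (auto simp: a_def)
    also have "(\<integral>D. \<kappa> * (\<Sum>i\<in>H. (snd (D i))\<^sup>2) \<partial>Sample) = \<kappa> * (a * (\<integral>z. (snd z)\<^sup>2 \<partial>\<nu>))"
      using sq_int by (subst integral_mult_right_zero, subst Bochner_Integration.integral_sum) (auto simp: a_def)
    finally show ?thesis by (simp add: Sample.prob_space)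
  qed
  have "AE D in Sample. \<forall>i\<in>H. fst (D i) \<in> cbox 0 1"
    unfolding Sample_def using U.finite_H U.H U.prob cube
    by (intro AE_finite_allI AE_PiM_component) auto
  then have "AE D in Sample. measure_pmf.expectation P (\<lambda>R. tr R D) \<le> bd D"
  proof eventually_elim
    case (elim D)
    \<comment> \<open>Tree and \<open>f\<close> lose the same sum of squared responses, so the
      comparison of training errors is one of sums of \<open>excess_loss\<close>.\<close>
    have tr_eq: "tr R D = (\<Sum>i\<in>H. (snd (D i) - odt_estimator sel D H R t (fst (D i)))\<^sup>2) - (\<Sum>i\<in>H. (snd (D i))\<^sup>2)" for R
      unfolding tr_def lo_def sum_subtractf[symmetric]
      by (intro sum.cong refl) (simp add: excess_loss_def case_prod_beta power2_diff)
    have f_eq: "(\<Sum>i\<in>H. excess_loss f (D i)) = (\<Sum>i\<in>H. (snd (D i) - f (fst (D i)))\<^sup>2) - (\<Sum>i\<in>H. (snd (D i))\<^sup>2)"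
      unfolding sum_subtractf[symmetric]
      by (intro sum.cong refl) (simp add: excess_loss_def case_prod_beta power2_diff)
    have "measure_pmf.expectation P (\<lambda>R. \<Sum>i\<in>H. (snd (D i) - odt_estimator sel D H R t (fst (D i)))\<^sup>2)
        \<le> (\<Sum>i\<in>H. (snd (D i) - f (fst (D i)))\<^sup>2) + real (card H) * \<eta> + \<kappa> * (\<Sum>i\<in>H. (snd (D i))\<^sup>2)"
      unfolding P_def \<kappa>_def
    proof (rule expected_training_error_le[where V = V and ps = ps and f = f])
      show "split_maximizer D H A F (sel \<tau> (restrict D H) H A F)"
        if "\<tau> \<in> {1..t - 1}" "A \<subseteq> cbox 0 1" "F \<noteq> {}" "node_count D H A \<ge> 2" for \<tau> A F
        using that by (rule sel)
    qed (use elim U.finite_H U.H(2) Q f unit V L \<eta> in auto)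
    then show ?case
      unfolding tr_eq bd_def f_eq a_def by (simp add: measure_pmf.prob_space)
  qed
  moreover have "integrable Sample (\<lambda>D. measure_pmf.expectation P (\<lambda>R. tr R D))"
    unfolding expP using tr_int by (intro Bochner_Integration.integrable_sum integrable_mult_right) auto
  ultimately have "(\<integral>D. measure_pmf.expectation P (\<lambda>R. tr R D) \<partial>Sample) \<le> (\<integral>D. bd D \<partial>Sample)"
    using bd_int by (intro integral_mono_AE) auto
  moreover have "(\<integral>D. measure_pmf.expectation P (\<lambda>R. tr R D) \<partial>Sample)
      = measure_pmf.expectation P (\<lambda>R. \<integral>D. tr R D \<partial>Sample)"
  proof -
    have "(\<integral>D. (\<Sum>R\<in>set_pmf P. pmf P R * tr R D) \<partial>Sample) = (\<Sum>R\<in>set_pmf P. \<integral>D. pmf P R * tr R D \<partial>Sample)"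
      using tr_int by (intro Bochner_Integration.integral_sum integrable_mult_right)
    then show ?thesis unfolding expP by simp
  qed
  ultimately have train: "measure_pmf.expectation P (\<lambda>R. \<integral>D. tr R D \<partial>Sample)
      \<le> a * af + a * \<eta> + \<kappa> * (a * (\<integral>z. (snd z)\<^sup>2 \<partial>\<nu>))"
    unfolding E_bd by simp
  have "measure_pmf.expectation P (\<lambda>R. a * risk R) \<le> measure_pmf.expectation P (\<lambda>R. (\<integral>D. tr R D \<partial>Sample) + (Gen + a * Em))"
    using risk_le by (intro integral_mono_AE) (auto simp: AE_measure_pmf_iff add.assoc)
  also have "\<dots> = measure_pmf.expectation P (\<lambda>R. \<integral>D. tr R D \<partial>Sample) + (Gen + a * Em)"
    by (simp add: measure_pmf.prob_space)
  finally have "a * measure_pmf.expectation P risk \<le> a * (af + Em + \<eta> + \<kappa> * (\<integral>z. (snd z)\<^sup>2 \<partial>\<nu>)) + Gen"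
    using train by (simp add: algebra_simps)
  then have bound: "measure_pmf.expectation P risk \<le> (af + Em) + \<eta> + \<kappa> * (\<integral>z. (snd z)\<^sup>2 \<partial>\<nu>) + Gen / a"
    using a by (simp add: field_simps)
  have "(\<integral>\<^sup>+R. (\<integral>\<^sup>+D. (\<integral>\<^sup>+x. ennreal (\<bar>odt_estimator sel D H R t x - m x\<bar>\<^sup>2) \<partial>distr \<nu> borel fst) \<partial>Sample) \<partial>measure_pmf P)
      = (\<integral>\<^sup>+R. ennreal (max 0 (risk R)) \<partial>measure_pmf P)"
    using risk by (intro nn_integral_cong_AE) (auto simp: AE_measure_pmf_iff max_def ennreal_neg)
  also have "\<dots> = ennreal (measure_pmf.expectation P (\<lambda>R. max 0 (risk R)))"
    by (intro nn_integral_eq_integral) auto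
  \<comment> \<open>Nonnegativity of \<open>risk R\<close> is established on the support of
    \<open>P\<close>, hence the detour through the positive part.\<close>
  also have "measure_pmf.expectation P (\<lambda>R. max 0 (risk R)) = measure_pmf.expectation P risk"
  proof (intro integral_cong_AE)
    show "AE R in measure_pmf P. max 0 (risk R) = risk R"
      unfolding AE_measure_pmf_iff
    proof
      fix R assume R: "R \<in> set_pmf P"
      interpret regression_estimator \<nu> n H sel R t c m by (rule RE'[OF R])
      have "0 \<le> (\<integral>z. lo R D z \<partial>\<nu>) + Em" if D: "D \<in> space (Pi\<^sub>M {1..n} (\<lambda>_. \<nu>))" for D
      proof -
        have "0 \<le> (\<integral>z. (est D (fst z) - m (fst z))\<^sup>2 \<partial>\<nu>)" by simp
        then show ?thesis
          unfolding bounded_risk(3)[OF est_measurable_point[OF D] est_bounded] by (simp add: lo_def Em_def est_def)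
      qed
      then have "0 \<le> (\<integral>D. (\<integral>z. lo R D z \<partial>\<nu>) + Em \<partial>Sample)"
        unfolding Sample_def by (intro integral_nonneg_AE AE_I2)
      also have "(\<integral>D. (\<integral>z. lo R D z \<partial>\<nu>) + Em \<partial>Sample) = risk R"
      proof -
        have "integrable Sample (\<lambda>D. \<integral>z. lo R D z \<partial>\<nu>)"
          using integrable_excess_risk unfolding lo_def Sample_def est_def .
        from Bochner_Integration.integral_add[OF this Sample.integrable_const] show ?thesis
          by (simp add: risk_def Sample.prob_space)
      qed
      finally show "max 0 (risk R) = risk R" by simp
    qed
  qed auto
  also have "ennreal (measure_pmf.expectation P risk)
      \<le> ennreal ((\<integral>z. (f (fst z) - m (fst z))\<^sup>2 \<partial>\<nu>) + \<eta> + \<kappa> * (\<integral>z. (snd z)\<^sup>2 \<partial>\<nu>) + Gen / a)"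
    using bound f_risk(3) by (intro ennreal_leI) (simp add: af_def Em_def)
  finally show ?thesis by (simp only: P_def Sample_def \<kappa>_def Gen_def)
qed

section \<open>Reduction of the forest to product measures\<close>

context prob_space
begin

text \<open>Restricting \<open>M\<close> to \<open>E\<close> and mapping to the observations gives a
  finite measure. On rectangles it is \<open>prob E\<close> times the product measure, and
  rectangles determine it. Seeds and observations have different types, so the seeds enter only
  through the event \<open>E\<close>.\<close>

lemma nn_integral_indep_event:
  fixes Z :: "'i \<Rightarrow> 'a \<Rightarrow> 'z::topological_space" and \<Psi> :: "('i \<Rightarrow> 'z) \<Rightarrow> ennreal"
  assumes I: "finite I" and Z: "\<And>i. i \<in> I \<Longrightarrow> Z i \<in> borel_measurable M"
    and distr: "\<And>i. i \<in> I \<Longrightarrow> distr M borel (Z i) = \<nu>" and \<nu>: "sets \<nu> = sets borel" "prob_space \<nu>"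
    and E: "E \<in> events"
    and indep: "\<And>U. (\<And>i. i \<in> I \<Longrightarrow> U i \<in> sets borel) \<Longrightarrow>
      prob {\<omega> \<in> E. \<forall>i\<in>I. Z i \<omega> \<in> U i} = prob E * (\<Prod>i\<in>I. measure \<nu> (U i))"
    and \<Psi>: "\<Psi> \<in> borel_measurable (Pi\<^sub>M I (\<lambda>_. borel))"
  shows "(\<integral>\<^sup>+\<omega>. indicator E \<omega> * \<Psi> (\<lambda>i\<in>I. Z i \<omega>) \<partial>M) = ennreal (prob E) * (\<integral>\<^sup>+D. \<Psi> D \<partial>Pi\<^sub>M I (\<lambda>_. \<nu>))"
proof -
  define W where "W \<omega> = (\<lambda>i\<in>I. Z i \<omega>)" for \<omega>
  have W [measurable]: "W \<in> measurable M (Pi\<^sub>M I (\<lambda>_. borel))"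
    unfolding W_def using Z by (intro measurable_restrict)
  have W' [measurable]: "W \<in> measurable (density M (indicator E)) (Pi\<^sub>M I (\<lambda>_. borel))"
    using W by simp
  interpret P: product_prob_space "\<lambda>_. \<nu>" I
    using \<nu>(2) by (auto simp: product_prob_space_def product_prob_space_axioms_def product_sigma_finite_def
        prob_space_imp_sigma_finite)
  have sets_P: "sets (Pi\<^sub>M I (\<lambda>_. \<nu>)) = sets (Pi\<^sub>M I (\<lambda>_. borel :: 'z measure))"
    by (intro sets_PiM_cong) (auto simp: \<nu>)
  have "distr (density M (indicator E)) (Pi\<^sub>M I (\<lambda>_. borel)) W
      = scale_measure (ennreal (prob E)) (Pi\<^sub>M I (\<lambda>_. \<nu>))" (is "?L = ?R")
  proof (rule measure_eqI_PiM_finite[OF I, where M = "\<lambda>_. borel :: 'z measure" and A = "\<lambda>_. Pi\<^sub>E I (\<lambda>_. UNIV)"])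
    show "sets ?L = sets (Pi\<^sub>M I (\<lambda>_. borel :: 'z measure))" by simp
    show "sets ?R = sets (Pi\<^sub>M I (\<lambda>_. borel :: 'z measure))" by (simp add: sets_P)
    show eq: "emeasure ?L (Pi\<^sub>E I A) = emeasure ?R (Pi\<^sub>E I A)" if A: "\<And>i. i \<in> I \<Longrightarrow> A i \<in> sets borel" for A
    proof -
      have box: "Pi\<^sub>E I A \<in> sets (Pi\<^sub>M I (\<lambda>_. borel :: 'z measure))"
        using A I by (intro sets_PiM_I_finite) auto
      have pre: "W -` Pi\<^sub>E I A \<inter> space M \<in> events" using measurable_sets[OF W box] .
      have "emeasure ?L (Pi\<^sub>E I A) = emeasure (density M (indicator E)) (W -` Pi\<^sub>E I A \<inter> space M)"
        by (subst emeasure_distr[OF W' box]) simp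
      also have "\<dots> = (\<integral>\<^sup>+\<omega>. indicator E \<omega> * indicator (W -` Pi\<^sub>E I A \<inter> space M) \<omega> \<partial>M)"
        by (rule emeasure_density) (use E pre in auto)
      also have "\<dots> = (\<integral>\<^sup>+\<omega>. indicator (E \<inter> (W -` Pi\<^sub>E I A \<inter> space M)) \<omega> \<partial>M)"
        by (simp add: indicator_inter_arith)
      also have "\<dots> = emeasure M (E \<inter> (W -` Pi\<^sub>E I A \<inter> space M))"
        using E pre by (intro nn_integral_indicator) auto
      also have "E \<inter> (W -` Pi\<^sub>E I A \<inter> space M) = {\<omega> \<in> E. \<forall>i\<in>I. Z i \<omega> \<in> A i}"
        using sets.sets_into_space[OF E] by (auto simp: W_def PiE_iff)
      also have "emeasure M \<dots> = ennreal (prob E * (\<Prod>i\<in>I. measure \<nu> (A i)))"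
        using indep[OF A] by (simp add: emeasure_eq_measure)
      also have "\<dots> = emeasure ?R (Pi\<^sub>E I A)"
      proof -
        have "emeasure (Pi\<^sub>M I (\<lambda>_. \<nu>)) (Pi\<^sub>E I A) = (\<Prod>i\<in>I. emeasure \<nu> (A i))"
          using A I \<nu> by (intro P.emeasure_PiM) auto
        also have "\<dots> = ennreal (\<Prod>i\<in>I. measure \<nu> (A i))"
          using \<nu>(2) by (simp add: prod_ennreal measure_nonneg finite_measure.emeasure_eq_measure prob_space.finite_measure)
        finally show ?thesis by (simp add: ennreal_mult prod_nonneg)
      qed
      finally show ?thesis .
    qed
    show "range (\<lambda>_. Pi\<^sub>E I (\<lambda>_. UNIV)) \<subseteq> prod_algebra I (\<lambda>_. borel :: 'z measure)"
      using I by (auto simp: prod_algebra_eq_finite)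
    show "(\<Union>i::nat. Pi\<^sub>E I (\<lambda>_. UNIV)) = space (Pi\<^sub>M I (\<lambda>_. borel :: 'z measure))"
      by (simp add: space_PiM)
    have "emeasure ?R (Pi\<^sub>E I (\<lambda>_. UNIV)) \<noteq> \<infinity>"
    proof -
      have "emeasure (Pi\<^sub>M I (\<lambda>_. \<nu>)) (Pi\<^sub>E I (\<lambda>_. UNIV)) \<le> 1"
        by (rule prob_space.emeasure_le_1[OF prob_space_PiM]) (rule \<nu>(2))
      then show ?thesis by (auto simp: ennreal_mult_eq_top_iff top_unique)
    qed
    then show "emeasure ?L (Pi\<^sub>E I (\<lambda>_. UNIV)) \<noteq> \<infinity>" using eq[of "\<lambda>_. UNIV"] by simp
  qed
  then have "(\<integral>\<^sup>+D. \<Psi> D \<partial>?L) = (\<integral>\<^sup>+D. \<Psi> D \<partial>?R)" by simp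
  moreover have "(\<integral>\<^sup>+D. \<Psi> D \<partial>?L) = (\<integral>\<^sup>+\<omega>. indicator E \<omega> * \<Psi> (W \<omega>) \<partial>M)"
    using \<Psi> E by (simp add: nn_integral_distr nn_integral_density)
  moreover have "(\<integral>\<^sup>+D. \<Psi> D \<partial>?R) = ennreal (prob E) * (\<integral>\<^sup>+D. \<Psi> D \<partial>Pi\<^sub>M I (\<lambda>_. \<nu>))"
    using \<Psi> by (intro nn_integral_scale_measure) (simp cong: measurable_cong_sets add: measurable_cong_sets[OF sets_P refl])
  ultimately show ?thesis by (simp add: W_def)
qed

text \<open>On each event \<open>E H R\<close> the integrand is a fixed function of the
  observations. The events are weighted by the law of the feature sets, which is \<open>P\<close>,
  and by the probabilities of the values \<open>H\<close>, which sum to at most one while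
  \<open>C\<close> bounds the contribution of every \<open>H\<close>.\<close>

lemma nn_integral_tree_le:
  fixes Z :: "nat \<Rightarrow> 'a \<Rightarrow> 'z::topological_space" and G :: "'a \<Rightarrow> nat set" and S :: "nat \<Rightarrow> 'a \<Rightarrow> 'b::finite"
    and d :: 'b and Q :: "'b pmf" and \<Psi> :: "nat set \<Rightarrow> (nat \<Rightarrow> 'b) \<Rightarrow> (nat \<Rightarrow> 'z) \<Rightarrow> ennreal"
  assumes I: "finite I" and T: "finite T" and Z: "\<And>i. i \<in> I \<Longrightarrow> Z i \<in> borel_measurable M"
    and distr: "\<And>i. i \<in> I \<Longrightarrow> distr M borel (Z i) = \<nu>" and \<nu>: "sets \<nu> = sets borel" "prob_space \<nu>"
    and G: "G \<in> measurable M (count_space UNIV)" and S: "\<And>\<tau>. \<tau> \<in> T \<Longrightarrow> S \<tau> \<in> measurable M (count_space UNIV)"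
    and law: "\<And>\<tau> F. \<tau> \<in> T \<Longrightarrow> prob {\<omega> \<in> space M. S \<tau> \<omega> = F} = pmf Q F"
    and \<H>: "finite \<H>"
    and indep: "\<And>U H R. (\<And>i. i \<in> I \<Longrightarrow> U i \<in> sets borel) \<Longrightarrow>
      prob {\<omega> \<in> space M. (\<forall>i\<in>I. Z i \<omega> \<in> U i) \<and> G \<omega> = H \<and> (\<forall>\<tau>\<in>T. S \<tau> \<omega> = R \<tau>)}
        = (\<Prod>i\<in>I. prob {\<omega> \<in> space M. Z i \<omega> \<in> U i}) * prob {\<omega> \<in> space M. G \<omega> = H}
          * (\<Prod>\<tau>\<in>T. prob {\<omega> \<in> space M. S \<tau> \<omega> = R \<tau>})"
  defines "P \<equiv> Pi_pmf T d (\<lambda>_. Q)"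
  defines "E \<equiv> \<lambda>H R. {\<omega> \<in> space M. G \<omega> = H \<and> (\<forall>\<tau>\<in>T. S \<tau> \<omega> = R \<tau>)}"
  assumes \<Psi>: "\<And>H R. H \<in> \<H> \<Longrightarrow> R \<in> set_pmf P \<Longrightarrow> \<Psi> H R \<in> borel_measurable (Pi\<^sub>M I (\<lambda>_. borel))"
    and bound: "\<And>H. H \<in> \<H> \<Longrightarrow> (\<integral>\<^sup>+R. (\<integral>\<^sup>+D. \<Psi> H R D \<partial>Pi\<^sub>M I (\<lambda>_. \<nu>)) \<partial>measure_pmf P) \<le> C"
  shows "(\<integral>\<^sup>+\<omega>. (\<Sum>H\<in>\<H>. \<Sum>R\<in>set_pmf P. indicator (E H R) \<omega> * \<Psi> H R (\<lambda>i\<in>I. Z i \<omega>)) \<partial>M) \<le> C"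
    and "(\<lambda>\<omega>. \<Sum>H\<in>\<H>. \<Sum>R\<in>set_pmf P. indicator (E H R) \<omega> * \<Psi> H R (\<lambda>i\<in>I. Z i \<omega>)) \<in> borel_measurable M"
    and "AE \<omega> in M. \<forall>\<tau>\<in>T. S \<tau> \<omega> \<in> set_pmf Q"
proof -
  let ?T = "\<lambda>H R \<omega>. indicator (E H R) \<omega> * \<Psi> H R (\<lambda>i\<in>I. Z i \<omega>)"
  have G_ev: "{\<omega> \<in> space M. G \<omega> = H} \<in> events" for H
    using measurable_sets[OF G, of "{H}"] by (simp add: vimage_def Int_def conj_commute)
  have S_ev: "{\<omega> \<in> space M. S \<tau> \<omega> = F} \<in> events" if "\<tau> \<in> T" for \<tau> F
    using measurable_sets[OF S[OF that], of "{F}"] by (simp add: vimage_def Int_def conj_commute)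
  have E_ev: "E H R \<in> events" for H R
  proof -
    have "{\<omega> \<in> space M. \<forall>\<tau>\<in>T. S \<tau> \<omega> = R \<tau>} \<in> events"
      using T S_ev by (intro sets.sets_Collect_finite_All) auto
    then have "{\<omega> \<in> space M. G \<omega> = H} \<inter> {\<omega> \<in> space M. \<forall>\<tau>\<in>T. S \<tau> \<omega> = R \<tau>} \<in> events"
      using G_ev by auto
    moreover have "{\<omega> \<in> space M. G \<omega> = H} \<inter> {\<omega> \<in> space M. \<forall>\<tau>\<in>T. S \<tau> \<omega> = R \<tau>} = E H R" by (auto simp: E_def)
    ultimately show ?thesis by simp
  qed
  show "AE \<omega> in M. \<forall>\<tau>\<in>T. S \<tau> \<omega> \<in> set_pmf Q"
  proof (rule AE_finite_allI[OF T])
    fix \<tau> assume \<tau>: "\<tau> \<in> T"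
    have "AE \<omega> in M. \<forall>F\<in>UNIV - set_pmf Q. S \<tau> \<omega> \<noteq> F"
    proof (rule AE_finite_allI)
      fix F assume "F \<in> UNIV - set_pmf Q"
      then have "prob {\<omega> \<in> space M. S \<tau> \<omega> = F} = 0" using law[OF \<tau>] by (simp add: set_pmf_eq)
      then have "AE \<omega> in M. \<not> S \<tau> \<omega> = F"
        using S_ev[OF \<tau>] prob_eq_0 by (subst (asm) prob_eq_0) auto
      then show "AE \<omega> in M. S \<tau> \<omega> \<noteq> F" by simp
    qed simp
    then show "AE \<omega> in M. S \<tau> \<omega> \<in> set_pmf Q" by eventually_elim auto
  qed
  have measure_\<nu>: "measure \<nu> A = prob {\<omega> \<in> space M. Z i \<omega> \<in> A}" if "i \<in> I" "A \<in> sets borel" for i A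
    using measure_distr[OF Z[OF that(1)] that(2)] distr[OF that(1)] by (simp add: vimage_def Int_def conj_commute)
  have prob_E: "prob (E H R) = \<P>(\<omega> in M. G \<omega> = H) * (\<Prod>\<tau>\<in>T. pmf Q (R \<tau>))" for H R
    using indep[of "\<lambda>_. UNIV" H R] law by (simp add: E_def prob_space)
  have step: "(\<integral>\<^sup>+\<omega>. ?T H R \<omega> \<partial>M)
      = ennreal (\<P>(\<omega> in M. G \<omega> = H)) * (ennreal (pmf P R) * (\<integral>\<^sup>+D. \<Psi> H R D \<partial>Pi\<^sub>M I (\<lambda>_. \<nu>)))"
    if "H \<in> \<H>" "R \<in> set_pmf P" for H R
  proof -
    have "(\<integral>\<^sup>+\<omega>. ?T H R \<omega> \<partial>M)
        = ennreal (prob (E H R)) * (\<integral>\<^sup>+D. \<Psi> H R D \<partial>Pi\<^sub>M I (\<lambda>_. \<nu>))"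
    proof (rule nn_integral_indep_event[OF I Z distr \<nu> E_ev _ \<Psi>[OF that]])
      fix U :: "nat \<Rightarrow> 'z set" assume U: "\<And>i. i \<in> I \<Longrightarrow> U i \<in> sets borel"
      have "{\<omega> \<in> E H R. \<forall>i\<in>I. Z i \<omega> \<in> U i}
          = {\<omega> \<in> space M. (\<forall>i\<in>I. Z i \<omega> \<in> U i) \<and> G \<omega> = H \<and> (\<forall>\<tau>\<in>T. S \<tau> \<omega> = R \<tau>)}"
        by (auto simp: E_def)
      then show "prob {\<omega> \<in> E H R. \<forall>i\<in>I. Z i \<omega> \<in> U i} = prob (E H R) * (\<Prod>i\<in>I. measure \<nu> (U i))"
        using indep[OF U] U law by (simp add: prob_E measure_\<nu>)
    qed
    moreover have "(\<Prod>\<tau>\<in>T. pmf Q (R \<tau>)) = pmf P R"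
      using that(2) unfolding P_def by (subst pmf_Pi'[OF T]) (auto simp: set_Pi_pmf[OF T] PiE_dflt_def)
    ultimately show ?thesis by (simp add: prob_E ennreal_mult mult.assoc)
  qed
  have W: "(\<lambda>\<omega>. \<lambda>i\<in>I. Z i \<omega>) \<in> measurable M (Pi\<^sub>M I (\<lambda>_. borel))"
    using Z by (intro measurable_restrict)
  have finP: "finite (set_pmf P)" by (simp add: P_def set_Pi_pmf[OF T] finite_PiE_dflt T)
  have meas: "?T H R \<in> borel_measurable M"
    if "H \<in> \<H>" "R \<in> set_pmf P" for H R
    using E_ev measurable_compose[OF W \<Psi>[OF that]] by (intro borel_measurable_times_ennreal borel_measurable_indicator) auto
  then show "(\<lambda>\<omega>. \<Sum>H\<in>\<H>. \<Sum>R\<in>set_pmf P. ?T H R \<omega>) \<in> borel_measurable M"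
    by (intro borel_measurable_sum) auto
  have "(\<integral>\<^sup>+\<omega>. (\<Sum>H\<in>\<H>. \<Sum>R\<in>set_pmf P. ?T H R \<omega>) \<partial>M)
      = (\<Sum>H\<in>\<H>. \<integral>\<^sup>+\<omega>. (\<Sum>R\<in>set_pmf P. ?T H R \<omega>) \<partial>M)"
    using meas by (intro nn_integral_sum borel_measurable_sum) auto
  also have "\<dots> = (\<Sum>H\<in>\<H>. \<Sum>R\<in>set_pmf P. \<integral>\<^sup>+\<omega>. ?T H R \<omega> \<partial>M)"
    using meas by (intro sum.cong refl nn_integral_sum) auto
  also have "\<dots> = (\<Sum>H\<in>\<H>. ennreal (\<P>(\<omega> in M. G \<omega> = H))
      * (\<integral>\<^sup>+R. (\<integral>\<^sup>+D. \<Psi> H R D \<partial>Pi\<^sub>M I (\<lambda>_. \<nu>)) \<partial>measure_pmf P))"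
    using step finP
    by (intro sum.cong refl) (simp add: nn_integral_measure_pmf_finite sum_distrib_left mult.commute)
  also have "\<dots> \<le> (\<Sum>H\<in>\<H>. ennreal (\<P>(\<omega> in M. G \<omega> = H)) * C)"
    using bound by (intro sum_mono mult_left_mono) auto
  also have "\<dots> = ennreal (\<Sum>H\<in>\<H>. \<P>(\<omega> in M. G \<omega> = H)) * C"
    by (simp add: sum_distrib_right sum_ennreal measure_nonneg flip: sum_distrib_right)
  also have "(\<Sum>H\<in>\<H>. \<P>(\<omega> in M. G \<omega> = H)) = prob (\<Union>H\<in>\<H>. {\<omega> \<in> space M. G \<omega> = H})"
    using \<H> G_ev by (intro finite_measure_finite_Union[symmetric]) (auto simp: disjoint_family_on_def)
  also have "ennreal \<dots> * C \<le> 1 * C"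
    by (intro mult_right_mono) (auto intro: order_trans[OF ennreal_leI[OF prob_le_1]])
  finally show "(\<integral>\<^sup>+\<omega>. (\<Sum>H\<in>\<H>. \<Sum>R\<in>set_pmf P. ?T H R \<omega>) \<partial>M) \<le> C"
    by (simp only: mult_1)
qed

end

section \<open>Size of the deviation bound as \<open>n\<close> grows\<close>

lemma ln_tree_class_bound_le:
  assumes "1 \<le> t" "t \<le> a" "2 \<le> a"
  shows "ln (tree_class_bound d a t) \<le> real (3 * d + 6) * (real t * ln (real a))"
proof -
  define A where "A = real a"
  define T where "T = real t"
  have A: "A \<ge> 2" and T: "1 \<le> T" "T \<le> A" using assms by (auto simp: A_def T_def)
  have lnA: "0 \<le> ln A" using A by simp
  define q where "q = (2 * A + 1) ^ (d + 1)"
  have q: "q > 0" "ln q = real (d + 1) * ln (2 * A + 1)" using A by (simp_all add: q_def ln_realpow del: power_Suc)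
  have "tree_class_bound d a t = 2 ^ t * (T * (T * q) ^ t)"
    by (simp add: tree_class_bound_def A_def T_def q_def add.commute del: power_Suc)
  then have "ln (tree_class_bound d a t) = T * ln 2 + (ln T + T * (ln T + real (d + 1) * ln (2 * A + 1)))"
    using T q(1) unfolding q(2)[symmetric] by (simp add: ln_mult ln_realpow T_def)
  \<comment> \<open>Each logarithm is compared with \<open>ln A\<close>, with
    \<open>2 * A + 1 \<le> A ^ 3\<close> for \<open>A \<ge> 2\<close>; the coefficients add up to
    \<open>1 + 1 + 1 + 3 * (d + 1)\<close>.\<close>
  also have "\<dots> \<le> T * ln A + (T * ln A + T * (ln A + real (d + 1) * (3 * ln A)))"
  proof (intro add_mono mult_left_mono)
    show "ln 2 \<le> ln A" using A by simp
    have "ln T \<le> ln A" using A T by simp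
    also have "\<dots> \<le> T * ln A" using T lnA by (simp add: mult_le_cancel_right1)
    finally show "ln T \<le> T * ln A" .
    show "ln T \<le> ln A" using A T by simp
    have "2 * A + 1 \<le> A ^ 3"
    proof -
      have "4 * A \<le> A ^ 3" using A mult_mono[of 2 A 2 A] by (simp add: power3_eq_cube)
      then show ?thesis using A by linarith
    qed
    then have "ln (2 * A + 1) \<le> ln (A ^ 3)" using A by (intro ln_mono) auto
    then show "ln (2 * A + 1) \<le> 3 * ln A" using A by (simp add: ln_realpow)
  qed (use T in auto)
  also have "\<dots> = real (3 * d + 6) * (T * ln A)" by (simp add: algebra_simps)
  finally show ?thesis by (simp add: A_def T_def)
qed

text \<open>With \<open>l = ln (a n)\<close> the bound on the responses contributes a factor of
  order \<open>l\<close> and the class size one of order \<open>sqrt (t n * l / a n)\<close>; the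
  rate makes the latter at most a small multiple of \<open>1 / l\<close>.\<close>

lemma eventually_deviation_small:
  fixes a t :: "nat \<Rightarrow> nat" and c K \<epsilon> :: real
  assumes a: "filterlim a at_top sequentially" and t: "\<And>n. n \<ge> 1 \<Longrightarrow> 1 \<le> t n" "\<And>n. n \<ge> 1 \<Longrightarrow> t n \<le> a n"
    and rate: "(\<lambda>n. real (t n)) \<in> o(\<lambda>n. real (a n) / ln (real (a n)) ^ 4)"
    and c: "c > 0" and K: "K > 0" and \<epsilon>: "\<epsilon> > 0"
  shows "\<forall>\<^sub>F n in sequentially. 6 * ((ln (2 * real (a n) * K) + 1) / c)
    * sqrt (2 * real (a n) * ln (tree_class_bound d (a n) (t n))) / real (a n) \<le> \<epsilon>"
proof -
  define C where "C = 2 * real (3 * d + 6)"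
  \<comment> \<open>Chosen so that
    \<open>6 * (2 / c) * sqrt (C * \<delta>) = \<epsilon>\<close>.\<close>
  define \<delta> where "\<delta> = (\<epsilon> * c / 12)\<^sup>2 / C"
  have C: "C > 0" by (simp add: C_def)
  have \<delta>: "\<delta> > 0" using \<epsilon> c C by (simp add: \<delta>_def)
  have lna: "filterlim (\<lambda>n. ln (real (a n))) at_top sequentially"
    by (intro filterlim_compose[OF ln_at_top] filterlim_compose[OF filterlim_real_sequentially a])
  have "\<forall>\<^sub>F n in sequentially. ln (2 * K) + 1 \<le> ln (real (a n))"
    "\<forall>\<^sub>F n in sequentially. 1 \<le> ln (real (a n))"
    using lna by (auto simp: filterlim_at_top)
  moreover have "\<forall>\<^sub>F n in sequentially. 2 \<le> a n" using a by (auto simp: filterlim_at_top)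
  moreover have "\<forall>\<^sub>F n in sequentially. norm (real (t n)) \<le> \<delta> * norm (real (a n) / ln (real (a n)) ^ 4)"
    by (rule landau_o.smallD[OF rate \<delta>])
  moreover have "\<forall>\<^sub>F n in sequentially. n \<ge> 1" by (rule eventually_ge_at_top)
  ultimately show ?thesis
  proof eventually_elim
    case (elim n)
    define A where "A = real (a n)"
    define l where "l = ln A"
    define T where "T = real (t n)"
    have A: "A \<ge> 2" using elim by (simp add: A_def)
    have l: "l \<ge> 1" "ln (2 * K) + 1 \<le> l" using elim by (auto simp: l_def A_def)
    have T: "T \<le> \<delta> * (A / l ^ 4)" using elim l by (simp add: T_def A_def l_def)
    have "ln (2 * A * K) = ln (2 * K) + l" using A K by (simp add: ln_mult l_def)
    then have "(ln (2 * A * K) + 1) / c \<le> 2 * l / c" using l c by (intro divide_right_mono) auto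
    moreover have "sqrt (2 * A * ln (tree_class_bound d (a n) (t n))) / A \<le> sqrt (C * \<delta>) / l"
    proof -
      have N: "ln (tree_class_bound d (a n) (t n)) \<ge> 0"
        using two_le_tree_class_bound[OF t(1), of n d "a n"] elim by (intro ln_ge_zero) auto
      have "2 * A * ln (tree_class_bound d (a n) (t n)) \<le> 2 * A * (real (3 * d + 6) * (T * l))"
        using ln_tree_class_bound_le[OF t, of n d] elim A by (intro mult_left_mono) (auto simp: T_def l_def A_def)
      also have "\<dots> = C * A * l * T" by (simp add: C_def)
      also have "\<dots> \<le> C * A * l * (\<delta> * (A / l ^ 4))"
        using T C A l by (intro mult_left_mono) auto
      also have "\<dots> = C * \<delta> * A\<^sup>2 / l ^ 3"
        using l by (simp add: field_simps power2_eq_square eval_nat_numeral)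
      also have "\<dots> \<le> C * \<delta> * A\<^sup>2 / l\<^sup>2"
        using C \<delta> A l by (intro divide_left_mono power_increasing) auto
      finally have "sqrt (2 * A * ln (tree_class_bound d (a n) (t n))) \<le> sqrt (C * \<delta> * A\<^sup>2 / l\<^sup>2)"
        by simp
      also have "\<dots> = sqrt (C * \<delta>) * A / l" using A l by (simp add: real_sqrt_mult real_sqrt_divide)
      finally show ?thesis using A l by (simp add: field_simps)
    qed
    moreover have "0 \<le> sqrt (2 * A * ln (tree_class_bound d (a n) (t n))) / A"
      using two_le_tree_class_bound[OF t(1), of n d "a n"] elim A by (intro divide_nonneg_nonneg real_sqrt_ge_zero mult_nonneg_nonneg ln_ge_zero) auto
    ultimately have "((ln (2 * A * K) + 1) / c) * (sqrt (2 * A * ln (tree_class_bound d (a n) (t n))) / A)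
        \<le> (2 * l / c) * (sqrt (C * \<delta>) / l)"
      using l c by (intro mult_mono) auto
    also have "\<dots> = 2 / c * sqrt (C * \<delta>)" using l by (simp add: field_simps)
    also have "sqrt (C * \<delta>) = \<epsilon> * c / 12" using C \<epsilon> c by (simp add: \<delta>_def)
    finally show ?case using c by (simp add: A_def field_simps)
  qed
qed

section \<open>Dependence of a tree on its seeds, and the laws of the seeds\<close>

lemma grow_layer_cong:
  assumes "\<And>i. i \<in> G \<Longrightarrow> D i = D' i" "\<And>\<tau>. \<tau> \<in> {1..t - 1} \<Longrightarrow> S \<tau> = S' \<tau>"
  shows "grow_layer sel D G S t As k = grow_layer sel D' G S' t As k"
proof (induction As arbitrary: k)
  case (Cons A As)
  have "restrict D G = restrict D' G" using assms(1) by (auto simp: restrict_def)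
  moreover have "node_count D G A = node_count D' G A"
    using assms(1) by (auto simp: node_count_def node_points_def intro!: arg_cong[of _ _ card])
  moreover have "S (k + 1) = S' (k + 1)" if "\<not> t \<le> k + 1" using that by (intro assms(2)) auto
  ultimately show ?case using Cons[of k] Cons[of "k + 1"] by (auto simp: Let_def)
qed simp

text \<open>A tree sees only the observations in its subsample and the first \<open>t - 1\<close>
  feature sets, so data and seeds can be cut down to the finite index sets of the product
  measures.\<close>

lemma odt_estimator_cong:
  assumes "\<And>i. i \<in> G \<Longrightarrow> D i = D' i" "\<And>\<tau>. \<tau> \<in> {1..t - 1} \<Longrightarrow> S \<tau> = S' \<tau>"
  shows "odt_estimator sel D G S t x = odt_estimator sel D' G S' t x"
proof -
  have points: "node_points D G A = node_points D' G A" for A using assms(1) by (auto simp: node_points_def)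
  then have "node_mean D G A = node_mean D' G A" for A
    using assms(1) by (auto simp: node_mean_def node_count_def node_points_def intro!: sum.cong arg_cong2[of _ _ _ _ "(/)"])
  moreover have "odt_leaves sel D G S t = odt_leaves sel D' G S' t"
  proof -
    have "grow_layer sel D G S t = grow_layer sel D' G S' t" by (intro ext grow_layer_cong assms)
    then show ?thesis by (simp add: odt_leaves_def)
  qed
  ultimately show ?thesis by (simp add: odt_estimator_def split: option.split)
qed

definition feature_pmf :: "'p::finite set pmf" where
  "feature_pmf = do {q \<leftarrow> pmf_of_set {1..CARD('p)}; pmf_of_set {F. card F = q}}"

lemma pmf_feature_pmf:
  fixes F :: "'p::finite set"
  shows "pmf feature_pmf F = (if F = {} then 0 else 1 / real CARD('p) * (1 / real (CARD('p) choose card F)))"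
proof -
  have size: "card {F :: 'p set. card F = q} = CARD('p) choose q" for q
    using n_subsets[of "UNIV :: 'p set" q] by simp
  have ne: "{F :: 'p set. card F = q} \<noteq> {}" if "q \<in> {1..CARD('p)}" for q
    using that size[of q] by (metis card.empty atLeastAtMost_iff binomial_eq_0_iff not_less)
  have "pmf feature_pmf F = (\<Sum>q\<in>{1..CARD('p)}. pmf (pmf_of_set {F. card F = q}) F) / real CARD('p)"
    unfolding feature_pmf_def pmf_bind by (subst integral_pmf_of_set) (auto simp: Suc_le_eq)
  also have "(\<Sum>q\<in>{1..CARD('p)}. pmf (pmf_of_set {F. card F = q}) F)
      = (\<Sum>q\<in>{1..CARD('p)}. if q = card F then 1 / real (CARD('p) choose q) else 0)"
    using ne by (intro sum.cong refl) (auto simp: pmf_of_set size)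
  also have "\<dots> = (if card F \<in> {1..CARD('p)} then 1 / real (CARD('p) choose card F) else 0)"
    by simp
  also have "card F \<in> {1..CARD('p)} \<longleftrightarrow> F \<noteq> {}"
    by (auto simp: Suc_le_eq card_gt_0_iff intro: card_mono)
  finally show ?thesis by (simp del: One_nat_def)
qed

context prob_space
begin

text \<open>The law is prescribed on nonempty sets only; as it already sums to one there, the empty
  set has probability zero.\<close>

lemma feature_law:
  fixes S :: "'a \<Rightarrow> 'p::finite set"
  assumes S: "S \<in> measurable M (count_space UNIV)"
    and law: "\<And>F. F \<noteq> {} \<Longrightarrow> prob {\<omega> \<in> space M. S \<omega> = F} = 1 / real CARD('p) * (1 / real (CARD('p) choose card F))"
  shows "prob {\<omega> \<in> space M. S \<omega> = F} = pmf feature_pmf F"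
proof (cases "F = {}")
  case True
  have ev: "{\<omega> \<in> space M. S \<omega> = F} \<in> events" for F
    using measurable_sets[OF S, of "{F}"] by (simp add: vimage_def Int_def conj_commute)
  have "(\<Sum>F\<in>UNIV. prob {\<omega> \<in> space M. S \<omega> = F}) = prob (\<Union>F\<in>UNIV. {\<omega> \<in> space M. S \<omega> = F})"
    using ev by (intro finite_measure_finite_Union[symmetric]) (auto simp: disjoint_family_on_def)
  also have "(\<Union>F\<in>UNIV. {\<omega> \<in> space M. S \<omega> = F}) = space M" by auto
  finally have "(\<Sum>F\<in>UNIV. prob {\<omega> \<in> space M. S \<omega> = F}) = (\<Sum>F\<in>UNIV. pmf (feature_pmf :: 'p set pmf) F)"
    by (simp add: prob_space sum_pmf_eq_1)
  moreover have "(\<Sum>F\<in>UNIV - {{}}. prob {\<omega> \<in> space M. S \<omega> = F}) = (\<Sum>F\<in>UNIV - {{}}. pmf (feature_pmf :: 'p set pmf) F)"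
    by (intro sum.cong refl) (simp add: law pmf_feature_pmf)
  ultimately show ?thesis
    using True sum.remove[of UNIV "{}" "\<lambda>F. prob {\<omega> \<in> space M. S \<omega> = F}"]
      sum.remove[of UNIV "{}" "pmf (feature_pmf :: 'p set pmf)"] by simp
qed (simp add: law pmf_feature_pmf)

text \<open>Independence for the sources of a single tree together with the observations; the events
  of the seeds are single values.\<close>

lemma indep_sources:
  fixes Z :: "nat \<Rightarrow> 'a \<Rightarrow> (real^'p::finite) \<times> real" and S :: "nat \<Rightarrow> nat \<Rightarrow> 'a \<Rightarrow> 'p set"
  assumes indep: "indep_sets (source_events M Z G S) (forest_sources n B t)" and b: "b \<in> {1..B}"
    and U: "\<And>i. i \<in> {1..n} \<Longrightarrow> U i \<in> sets borel"
  shows "prob {\<omega> \<in> space M. (\<forall>i\<in>{1..n}. Z i \<omega> \<in> U i) \<and> G b \<omega> = H \<and> (\<forall>\<tau>\<in>{1..t-1}. S b \<tau> \<omega> = R \<tau>)}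
        = (\<Prod>i\<in>{1..n}. prob {\<omega> \<in> space M. Z i \<omega> \<in> U i}) * prob {\<omega> \<in> space M. G b \<omega> = H}
          * (\<Prod>\<tau>\<in>{1..t-1}. prob {\<omega> \<in> space M. S b \<tau> \<omega> = R \<tau>})"
proof -
  define A where "A s = (case s of Obs i \<Rightarrow> {\<omega> \<in> space M. Z i \<omega> \<in> U i}
      | Sub b' \<Rightarrow> {\<omega> \<in> space M. G b' \<omega> = H} | Feat b' \<tau> \<Rightarrow> {\<omega> \<in> space M. S b' \<tau> \<omega> = R \<tau>})" for s
  define J where "J = Obs ` {1..n} \<union> insert (Sub b) (Feat b ` {1..t-1})"
  have "prob (\<Inter>j\<in>J. A j) = (\<Prod>j\<in>J. prob (A j))"
  proof (rule indep_setsD[OF indep])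
    show "J \<subseteq> forest_sources n B t" using b by (auto simp: J_def forest_sources_def)
    show "\<forall>j\<in>J. A j \<in> source_events M Z G S j"
    proof
      fix j assume "j \<in> J"
      then consider (1) i where "j = Obs i" "i \<in> {1..n}" | (2) "j = Sub b" | (3) \<tau> where "j = Feat b \<tau>"
        by (auto simp: J_def)
      then show "A j \<in> source_events M Z G S j"
      proof cases
        case 1
        then show ?thesis using U by (auto simp: A_def intro!: exI[of _ "U i"])
      next
        case 2
        then show ?thesis by (auto simp: A_def intro!: exI[of _ "{H}"])
      next
        case 3
        then show ?thesis by (auto simp: A_def intro!: exI[of _ "{R \<tau>}"])
      qed
    qed
  qed (auto simp: J_def)
  also have "(\<Prod>j\<in>J. prob (A j)) = (\<Prod>j\<in>Obs ` {1..n}. prob (A j)) * (prob (A (Sub b)) * (\<Prod>j\<in>Feat b ` {1..t-1}. prob (A j)))"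
    unfolding J_def by (subst prod.union_disjoint) (auto simp: image_iff)
  also have "(\<Prod>j\<in>Obs ` {1..n}. prob (A j)) = (\<Prod>i\<in>{1..n}. prob {\<omega> \<in> space M. Z i \<omega> \<in> U i})"
    by (subst prod.reindex) (auto simp: inj_on_def A_def)
  also have "(\<Prod>j\<in>Feat b ` {1..t-1}. prob (A j)) = (\<Prod>\<tau>\<in>{1..t-1}. prob {\<omega> \<in> space M. S b \<tau> \<omega> = R \<tau>})"
    by (subst prod.reindex) (auto simp: inj_on_def A_def)
  also have "(\<Inter>j\<in>J. A j) = {\<omega> \<in> space M. (\<forall>i\<in>{1..n}. Z i \<omega> \<in> U i) \<and> G b \<omega> = H \<and> (\<forall>\<tau>\<in>{1..t-1}. S b \<tau> \<omega> = R \<tau>)}"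
  proof -
    have "(\<Inter>j\<in>J. A j) = (\<Inter>i\<in>{1..n}. A (Obs i)) \<inter> (A (Sub b) \<inter> (\<Inter>\<tau>\<in>{1..t-1}. A (Feat b \<tau>)))"
      by (auto simp: J_def)
    then show ?thesis by (auto simp: A_def)
  qed
  finally show ?thesis by (simp add: A_def mult.assoc del: One_nat_def)
qed

text \<open>\<open>g (X \<omega>)\<close> is measurable for the sigma-algebra of \<open>X\<close>
  and moves under the conditional expectation.\<close>

lemma regression_identity:
  fixes X :: "'a \<Rightarrow> real^'p::finite" and Y :: "'a \<Rightarrow> real" and m g :: "real^'p \<Rightarrow> real"
  assumes X: "X \<in> borel_measurable M" and Y: "integrable M Y" and m: "m \<in> borel_measurable borel"
    and reg: "AE \<omega> in M. m (X \<omega>) = real_cond_exp M (vimage_algebra (space M) X borel) Y \<omega>"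
    and g: "g \<in> borel_measurable borel" and b: "\<And>x. \<bar>g x\<bar> \<le> b"
  shows "(\<integral>\<omega>. Y \<omega> * g (X \<omega>) \<partial>M) = (\<integral>\<omega>. m (X \<omega>) * g (X \<omega>) \<partial>M)"
proof -
  define F where "F = vimage_algebra (space M) X (borel :: (real^'p) measure)"
  have "subalgebra M F"
    unfolding subalgebra_def F_def using X
    by (auto simp: sets_vimage_algebra2 intro: measurable_sets)
  then interpret finite_measure_subalgebra M F
    by unfold_locales
  have XF: "X \<in> measurable F borel" unfolding F_def by (rule measurable_vimage_algebra1) simp
  have gF: "(\<lambda>\<omega>. g (X \<omega>)) \<in> borel_measurable F" by (rule measurable_compose[OF XF g])
  have [measurable]: "(\<lambda>\<omega>. g (X \<omega>)) \<in> borel_measurable M" "Y \<in> borel_measurable M"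
    "(\<lambda>\<omega>. m (X \<omega>)) \<in> borel_measurable M"
    using measurable_compose[OF X g] measurable_compose[OF X m] Y by auto
  have int: "integrable M (\<lambda>\<omega>. g (X \<omega>) * Y \<omega>)"
  proof (rule Bochner_Integration.integrable_bound)
    show "integrable M (\<lambda>\<omega>. b * Y \<omega>)" using Y by simp
    show "AE \<omega> in M. norm (g (X \<omega>) * Y \<omega>) \<le> norm (b * Y \<omega>)"
      using b by (intro AE_I2) (auto simp: abs_mult intro!: mult_right_mono order_trans[OF b])
  qed measurable
  have "(\<integral>\<omega>. g (X \<omega>) * Y \<omega> \<partial>M) = (\<integral>\<omega>. g (X \<omega>) * real_cond_exp M F Y \<omega> \<partial>M)"
    by (rule real_cond_exp_intg(2)[OF int gF, symmetric]) measurable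
  also have "\<dots> = (\<integral>\<omega>. g (X \<omega>) * m (X \<omega>) \<partial>M)"
  proof (rule integral_cong_AE)
    show "AE \<omega> in M. g (X \<omega>) * real_cond_exp M F Y \<omega> = g (X \<omega>) * m (X \<omega>)"
      using reg unfolding F_def by eventually_elim simp
  qed (auto intro!: borel_measurable_times measurable_from_subalg[OF subalg] borel_measurable_cond_exp2)
  finally show ?thesis by (simp add: mult.commute)
qed

end

section \<open>Consistency of the forest\<close>

text \<open>Jensen's inequality for the square; it reduces the risk of the forest to the average of
  the risks of its trees.\<close>

lemma square_mean_le:
  fixes v :: "nat \<Rightarrow> real"
  assumes "B \<ge> 1"
  shows "(1 / real B * (\<Sum>b=1..B. v b) - m)\<^sup>2 \<le> (\<Sum>b=1..B. 1 / real B * (v b - m)\<^sup>2)"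
proof -
  have "(\<Sum>b=1..B. v b - m) = (\<Sum>b=1..B. v b) - real B * m" by (simp add: sum_subtractf)
  then have "1 / real B * (\<Sum>b=1..B. v b) - m = 1 / real B * (\<Sum>b=1..B. v b - m)"
    using assms by (simp add: field_simps)
  then have "(1 / real B * (\<Sum>b=1..B. v b) - m)\<^sup>2 = 1 / (real B)\<^sup>2 * (\<Sum>b=1..B. v b - m)\<^sup>2"
    by (simp add: power_mult_distrib power_divide)
  also have "\<dots> \<le> 1 / (real B)\<^sup>2 * ((\<Sum>b=1..B. (v b - m)\<^sup>2) * real (card {1..B}))"
    by (intro mult_left_mono sum_squared_le_sum_of_squares) auto
  also have "\<dots> = 1 / real B * (\<Sum>b=1..B. (v b - m)\<^sup>2)"
    using assms by (simp add: power2_eq_square)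
  finally show ?thesis by (simp only: sum_distrib_left)
qed

text \<open>By convexity the trees are treated one at a time; given its seeds, each is a fixed
  function of the observations, and the bound of \<open>tree_risk_le\<close> is the same for all
  subsamples.\<close>

lemma (in prob_space) forest_risk_le:
  fixes X :: "'a \<Rightarrow> real^'p::finite" and Y :: "'a \<Rightarrow> real" and m :: "real^'p \<Rightarrow> real"
    and Z :: "nat \<Rightarrow> 'a \<Rightarrow> (real^'p) \<times> real" and G :: "nat \<Rightarrow> 'a \<Rightarrow> nat set"
    and S :: "nat \<Rightarrow> nat \<Rightarrow> 'a \<Rightarrow> 'p set" and sel :: "'p split_rule" and c :: real
  assumes X: "X \<in> borel_measurable M" and Y: "Y \<in> borel_measurable M"
    and cube: "AE \<omega> in M. X \<omega> \<in> cbox 0 1" and m: "m \<in> borel_measurable borel"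
    and reg: "AE \<omega> in M. m (X \<omega>) = real_cond_exp M (vimage_algebra (space M) X borel) Y \<omega>"
    and c: "c > 0" and exp_moment: "integrable M (\<lambda>\<omega>. exp (c * (Y \<omega>)\<^sup>2))"
    and m_L2: "integrable M (\<lambda>\<omega>. (m (X \<omega>))\<^sup>2)"
    and Z: "\<And>i. i \<in> {1..n} \<Longrightarrow> Z i \<in> borel_measurable M"
    and Z_copy: "\<And>i. i \<in> {1..n} \<Longrightarrow> distr M borel (Z i) = distr M borel (\<lambda>\<omega>. (X \<omega>, Y \<omega>))"
    and B: "B \<ge> 1" and t: "1 \<le> t" "t \<le> a" "a \<le> n"
    and G: "\<And>b. b \<in> {1..B} \<Longrightarrow> G b \<in> measurable M (count_space UNIV)"
    and G_uniform: "\<And>b. b \<in> {1..B} \<Longrightarrow>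
      distr M (count_space UNIV) (G b) = measure_pmf (pmf_of_set {H. H \<subseteq> {1..n} \<and> card H = a})"
    and S: "\<And>b \<tau>. b \<in> {1..B} \<Longrightarrow> \<tau> \<in> {1..t - 1} \<Longrightarrow> S b \<tau> \<in> measurable M (count_space UNIV)"
    and S_law: "\<And>b \<tau> F. b \<in> {1..B} \<Longrightarrow> \<tau> \<in> {1..t - 1} \<Longrightarrow> F \<noteq> {} \<Longrightarrow>
      prob {\<omega> \<in> space M. S b \<tau> \<omega> = F} = 1 / real CARD('p) * (1 / real (CARD('p) choose card F))"
    and indep: "indep_sets (source_events M Z G S) (forest_sources n B t)"
    and sel_max: "\<And>\<tau> D H A F. \<tau> \<in> {1..t - 1} \<Longrightarrow> H \<subseteq> {1..n} \<Longrightarrow> card H = a \<Longrightarrow>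
      A \<subseteq> cbox 0 1 \<Longrightarrow> F \<noteq> {} \<Longrightarrow> node_count D H A \<ge> 2 \<Longrightarrow>
      split_maximizer D H A F (sel \<tau> (restrict D H) H A F)"
    and sel_meas: "\<And>H R. H \<subseteq> {1..n} \<Longrightarrow> card H = a \<Longrightarrow> \<forall>\<tau>\<in>{1..t - 1}. R \<tau> \<noteq> {} \<Longrightarrow>
      (\<lambda>(D, x). odt_estimator sel D H R t x) \<in> borel_measurable ((\<Pi>\<^sub>M i\<in>{1..n}. borel) \<Otimes>\<^sub>M borel)"
    and f: "f = ridge_step c0 ps" and unit: "\<And>c \<theta> s. (c, \<theta>, s) \<in> set ps \<Longrightarrow> norm \<theta> = 1"
    and V: "(\<Sum>(c, \<theta>, s)\<leftarrow>ps. \<bar>c\<bar>) \<le> V" "V > 0"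
    and L: "2 ^ L \<le> t" "L > 0" and \<eta>: "\<eta> > 0"
  defines "K \<equiv> (\<integral>\<omega>. exp (c * (Y \<omega>)\<^sup>2) \<partial>M)"
  shows "(\<integral>\<^sup>+\<omega>. (\<integral>\<^sup>+x. ennreal (\<bar>odrf_estimator sel (\<lambda>i. Z i \<omega>) (\<lambda>b. G b \<omega>) (\<lambda>b \<tau>. S b \<tau> \<omega>) t B x - m x\<bar>\<^sup>2)
        \<partial>distr M borel X) \<partial>M)
    \<le> ennreal ((\<integral>\<omega>. (f (X \<omega>) - m (X \<omega>))\<^sup>2 \<partial>M) + \<eta>
        + V\<^sup>2 / (4 * \<eta> * (1 / real CARD('p)) * real L) * (\<integral>\<omega>. (Y \<omega>)\<^sup>2 \<partial>M)
        + 6 * ((ln (2 * real a * K) + 1) / c) * sqrt (2 * real a * ln (tree_class_bound CARD('p) a t)) / real a)"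
    (is "_ \<le> ennreal ?C")
proof -
  let ?F = "\<lambda>\<omega>. odrf_estimator sel (\<lambda>i. Z i \<omega>) (\<lambda>b. G b \<omega>) (\<lambda>b \<tau>. S b \<tau> \<omega>) t B"
  define \<nu> where "\<nu> = distr M borel (\<lambda>\<omega>. (X \<omega>, Y \<omega>))"
  define \<mu> where "\<mu> = distr M borel X"
  define \<H> where "\<H> = {H. H \<subseteq> {1..n} \<and> card H = a}"
  define P where "P = Pi_pmf {1..t-1} (UNIV :: 'p set) (\<lambda>_. feature_pmf)"
  define \<Psi> where "\<Psi> H R D = (\<integral>\<^sup>+x. ennreal (\<bar>odt_estimator sel D H R t x - m x\<bar>\<^sup>2) \<partial>\<mu>)" for H R D
  define E where "E b H R = {\<omega> \<in> space M. G b \<omega> = H \<and> (\<forall>\<tau>\<in>{1..t-1}. S b \<tau> \<omega> = R \<tau>)}" for b H R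
  define W where "W \<omega> = (\<lambda>i\<in>{1..n}. Z i \<omega>)" for \<omega>
  define C where "C = ?C"
  have XY [measurable]: "(\<lambda>\<omega>. (X \<omega>, Y \<omega>)) \<in> borel_measurable M"
    using X Y by (rule borel_measurable_Pair)
  have \<nu>: "prob_space \<nu>" "sets \<nu> = sets borel"
    unfolding \<nu>_def by (auto intro: prob_space_distr XY)
  have fst_borel [measurable]: "(fst :: (real^'p) \<times> real \<Rightarrow> _) \<in> borel_measurable borel"
    and snd_borel [measurable]: "(snd :: (real^'p) \<times> real \<Rightarrow> _) \<in> borel_measurable borel"
    by (auto simp flip: borel_prod)
  have \<mu>_eq: "distr \<nu> borel fst = \<mu>"
    unfolding \<nu>_def \<mu>_def by (subst distr_distr) (auto simp: o_def)
  have int_\<nu>: "(\<integral>z. h z \<partial>\<nu>) = (\<integral>\<omega>. h (X \<omega>, Y \<omega>) \<partial>M)" "integrable \<nu> h \<longleftrightarrow> integrable M (\<lambda>\<omega>. h (X \<omega>, Y \<omega>))"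
    if "h \<in> borel_measurable borel" for h :: "(real^'p) \<times> real \<Rightarrow> real"
    unfolding \<nu>_def by (rule integral_distr[OF XY that] integrable_distr_eq[OF XY that])+
  have [measurable]: "m \<in> borel_measurable borel" by (rule m)
  have finH: "finite \<H>" unfolding \<H>_def by (rule finite_subset[of _ "Pow {1..n}"]) auto
  have neH: "\<H> \<noteq> {}" unfolding \<H>_def using obtain_subset_with_card_n[of a "{1..n}"] t(3) by fastforce
  have Q: "pmf (feature_pmf :: 'p set pmf) {} = 0" "pmf (feature_pmf :: 'p set pmf) UNIV = 1 / real CARD('p)"
    by (simp_all add: pmf_feature_pmf)
  have P_ne: "\<forall>\<tau>\<in>{1..t-1}. R \<tau> \<noteq> {}" if "R \<in> set_pmf P" for R
  proof
    fix \<tau> assume "\<tau> \<in> {1..t-1}"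
    then have "R \<tau> \<in> set_pmf feature_pmf" using that by (auto simp: P_def set_Pi_pmf PiE_dflt_def)
    then show "R \<tau> \<noteq> {}" using Q(1) by (auto simp: set_pmf_eq)
  qed
  have Y_int: "integrable M Y"
  proof (rule Bochner_Integration.integrable_bound)
    show "integrable M (\<lambda>\<omega>. 1 + exp (c * (Y \<omega>)\<^sup>2) / c)" using exp_moment by simp
    show "AE \<omega> in M. norm (Y \<omega>) \<le> norm (1 + exp (c * (Y \<omega>)\<^sup>2) / c)"
    proof (rule AE_I2)
      fix \<omega>
      have "c * (Y \<omega>)\<^sup>2 \<le> exp (c * (Y \<omega>)\<^sup>2)" using exp_ge_add_one_self[of "c * (Y \<omega>)\<^sup>2"] by linarith
      then have "(Y \<omega>)\<^sup>2 \<le> exp (c * (Y \<omega>)\<^sup>2) / c" using c by (simp add: field_simps)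
      moreover have "\<bar>Y \<omega>\<bar> \<le> 1 + (Y \<omega>)\<^sup>2"
        using sum_squares_bound[of 1 "\<bar>Y \<omega>\<bar>"] by (simp add: power2_eq_square)
      ultimately show "norm (Y \<omega>) \<le> norm (1 + exp (c * (Y \<omega>)\<^sup>2) / c)" using c by simp
    qed
  qed (rule Y)
  have RE: "regression_estimator \<nu> n H sel R t c m" if H: "H \<in> \<H>" and R: "\<forall>\<tau>\<in>{1..t - 1}. R \<tau> \<noteq> {}" for H R
  proof (intro regression_estimator.intro bounded_estimator.intro regression_estimator_axioms.intro)
    show "prob_space \<nu>" "sets \<nu> = sets borel" by (rule \<nu>)+
    show "integrable \<nu> (\<lambda>z. exp (c * (snd z)\<^sup>2))" using exp_moment by (subst int_\<nu>(2)) auto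
    show "H \<subseteq> {1..n}" "H \<noteq> {}" using H t by (auto simp: \<H>_def)
    show "(\<lambda>(D, x). odt_estimator sel D H R t x) \<in> borel_measurable ((\<Pi>\<^sub>M i\<in>{1..n}. borel) \<Otimes>\<^sub>M borel)"
      using H R by (intro sel_meas) (auto simp: \<H>_def)
    show "integrable \<nu> (\<lambda>z. (m (fst z))\<^sup>2)" using m_L2 by (subst int_\<nu>(2)) auto
    show "(\<integral>z. snd z * g (fst z) \<partial>\<nu>) = (\<integral>z. m (fst z) * g (fst z) \<partial>\<nu>)"
      if [measurable]: "g \<in> borel_measurable borel" and b: "\<And>x. \<bar>g x\<bar> \<le> b" for g b
      using regression_identity[OF X Y_int m reg that(1) b] by (simp add: int_\<nu>(1))
  qed (use c t in auto)
  have \<Psi>_meas: "\<Psi> H R \<in> borel_measurable (\<Pi>\<^sub>M i\<in>{1..n}. borel)" if "H \<in> \<H>" "R \<in> set_pmf P" for H R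
  proof -
    interpret \<mu>: prob_space \<mu> unfolding \<mu>_def by (rule prob_space_distr[OF X])
    have "(\<lambda>(D, x). odt_estimator sel D H R t x) \<in> borel_measurable ((\<Pi>\<^sub>M i\<in>{1..n}. borel) \<Otimes>\<^sub>M \<mu>)"
      using sel_meas[of H R] that P_ne by (simp add: \<H>_def \<mu>_def measurable_cong_sets[OF sets_pair_measure_cong[OF refl sets_distr] refl])
    moreover have "(\<lambda>p. m (snd p)) \<in> borel_measurable ((\<Pi>\<^sub>M i\<in>{1..n}. borel :: ((real^'p) \<times> real) measure) \<Otimes>\<^sub>M \<mu>)"
      by (intro measurable_compose[OF measurable_snd]) (simp add: \<mu>_def)
    ultimately have "(\<lambda>(D, x). ennreal (\<bar>odt_estimator sel D H R t x - m x\<bar>\<^sup>2))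
        \<in> borel_measurable ((\<Pi>\<^sub>M i\<in>{1..n}. borel) \<Otimes>\<^sub>M \<mu>)"
      by (simp add: case_prod_beta)
    then show ?thesis unfolding \<Psi>_def by (rule \<mu>.borel_measurable_nn_integral)
  qed
  have tree: "(\<integral>\<^sup>+R. (\<integral>\<^sup>+D. \<Psi> H R D \<partial>Pi\<^sub>M {1..n} (\<lambda>_. \<nu>)) \<partial>measure_pmf P) \<le> ennreal C" if H: "H \<in> \<H>" for H
  proof -
    have Ha: "H \<subseteq> {1..n}" "card H = a" using H by (auto simp: \<H>_def)
    have cube_\<nu>: "AE z in \<nu>. fst z \<in> cbox 0 1"
      unfolding \<nu>_def by (subst AE_distr_iff[OF XY]) (use cube in \<open>auto intro!: measurable_sets_borel[OF fst_borel] borel_closed\<close>)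
    have f_meas [measurable]: "f \<in> borel_measurable borel"
      using unit by (intro unit_ridge_step_measurable) (auto simp: unit_ridge_step_def f intro!: exI[of _ c0] exI[of _ ps])
    have "(\<integral>\<^sup>+R. (\<integral>\<^sup>+D. (\<integral>\<^sup>+x. ennreal (\<bar>odt_estimator sel D H R t x - m x\<bar>\<^sup>2) \<partial>distr \<nu> borel fst)
        \<partial>Pi\<^sub>M {1..n} (\<lambda>_. \<nu>)) \<partial>measure_pmf (Pi_pmf {1..t-1} UNIV (\<lambda>_. feature_pmf)))
      \<le> ennreal ((\<integral>z. (f (fst z) - m (fst z))\<^sup>2 \<partial>\<nu>) + \<eta>
        + V\<^sup>2 / (4 * \<eta> * pmf (feature_pmf :: 'p set pmf) UNIV * real L) * (\<integral>z. (snd z)\<^sup>2 \<partial>\<nu>)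
        + 6 * ((ln (2 * real (card H) * (\<integral>z. exp (c * (snd z)\<^sup>2) \<partial>\<nu>)) + 1) / c)
          * sqrt (2 * real (card H) * ln (tree_class_bound CARD('p) (card H) t)) / real (card H))"
      by (rule tree_risk_le[OF RE[OF H] cube_\<nu> Q(1) _ _ f unit V L \<eta>])
        (use Q(2) Ha sel_max in auto)
    then show ?thesis
      unfolding \<Psi>_def \<mu>_eq P_def C_def K_def Ha(2) Q(2) by (simp add: int_\<nu>(1))
  qed
  \<comment> \<open>The indicators select the realized subsample and feature sets, so
    \<open>T b\<close> dominates the risk of tree \<open>b\<close> almost surely. It is measurable
    as a finite sum; the risk of the forest is only compared with these majorants.\<close>
  define T where "T b \<omega> = (\<Sum>H\<in>\<H>. \<Sum>R\<in>set_pmf P. indicator (E b H R) \<omega> * \<Psi> H R (W \<omega>))" for b \<omega>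
  have T: "(\<integral>\<^sup>+\<omega>. T b \<omega> \<partial>M) \<le> ennreal C" "T b \<in> borel_measurable M"
    and S_supp: "AE \<omega> in M. \<forall>\<tau>\<in>{1..t-1}. S b \<tau> \<omega> \<in> set_pmf feature_pmf"
    if b: "b \<in> {1..B}" for b
  proof -
    have law: "prob {\<omega> \<in> space M. S b \<tau> \<omega> = F} = pmf feature_pmf F" if "\<tau> \<in> {1..t-1}" for \<tau> F
      using that b by (intro feature_law S S_law)
    note r = nn_integral_tree_le[where I = "{1..n}" and T = "{1..t-1}" and Z = Z and \<nu> = \<nu> and G = "G b"
        and S = "S b" and Q = feature_pmf and d = UNIV and \<Psi> = \<Psi> and \<H> = \<H> and C = "ennreal C",
        OF _ _ Z _ \<nu>(2,1) G[OF b] S[OF b] law finH indep_sources[OF indep b] \<Psi>_meas[unfolded P_def] tree[unfolded P_def],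
        folded P_def, folded E_def W_def]
    show "(\<integral>\<^sup>+\<omega>. T b \<omega> \<partial>M) \<le> ennreal C" "T b \<in> borel_measurable M"
      "AE \<omega> in M. \<forall>\<tau>\<in>{1..t-1}. S b \<tau> \<omega> \<in> set_pmf feature_pmf"
      unfolding T_def[abs_def] using r Z_copy by (auto simp: \<nu>_def simp del: One_nat_def)
  qed
  have G_supp: "AE \<omega> in M. G b \<omega> \<in> \<H>" if b: "b \<in> {1..B}" for b
  proof -
    have "AE H in distr M (count_space UNIV) (G b). H \<in> \<H>"
      unfolding G_uniform[OF b] AE_measure_pmf_iff
      using neH finH by (auto simp: \<H>_def set_pmf_of_set)
    then show ?thesis by (rule AE_distrD[OF G[OF b]])
  qed
  have "AE \<omega> in M. \<forall>b\<in>{1..B}. G b \<omega> \<in> \<H> \<and> (\<forall>\<tau>\<in>{1..t-1}. S b \<tau> \<omega> \<in> set_pmf feature_pmf)"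
  proof (rule AE_finite_allI)
    fix b assume "b \<in> {1..B}"
    then show "AE \<omega> in M. G b \<omega> \<in> \<H> \<and> (\<forall>\<tau>\<in>{1..t-1}. S b \<tau> \<omega> \<in> set_pmf feature_pmf)"
      by (intro AE_conjI G_supp S_supp)
  qed simp
  moreover have "AE \<omega> in M. \<omega> \<in> space M" by (rule AE_space)
  ultimately have "AE \<omega> in M. (\<integral>\<^sup>+x. ennreal (\<bar>?F \<omega> x - m x\<bar>\<^sup>2) \<partial>\<mu>)
      \<le> (\<Sum>b=1..B. ennreal (1 / real B) * T b \<omega>)"
  proof eventually_elim
    case (elim \<omega>)
    \<comment> \<open>\<open>UNIV\<close> is the default value in \<open>P\<close>; with it the
      realized feature sets form an element of the support of \<open>P\<close>.\<close>
    define R where "R b \<tau> = (if \<tau> \<in> {1..t-1} then S b \<tau> \<omega> else UNIV)" for b \<tau>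
    define g where "g b x = odt_estimator sel (W \<omega>) (G b \<omega>) (R b) t x" for b x
    have R: "R b \<in> set_pmf P" if "b \<in> {1..B}" for b
      using elim that by (auto simp: P_def set_Pi_pmf PiE_dflt_def R_def simp del: One_nat_def)
    have g: "odt_estimator sel (\<lambda>i. Z i \<omega>) (G b \<omega>) (\<lambda>\<tau>. S b \<tau> \<omega>) t x = g b x" if "b \<in> {1..B}" for b x
      unfolding g_def
    proof (rule odt_estimator_cong)
      have "G b \<omega> \<subseteq> {1..n}" using elim that by (auto simp: \<H>_def)
      then show "Z i \<omega> = W \<omega> i" if "i \<in> G b \<omega>" for i using that unfolding W_def by auto
    qed (simp add: R_def del: One_nat_def)
    have g_meas [measurable]: "g b \<in> borel_measurable borel" if "b \<in> {1..B}" for b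
    proof -
      have "(\<lambda>(D, x). odt_estimator sel D (G b \<omega>) (R b) t x) \<in> borel_measurable ((\<Pi>\<^sub>M i\<in>{1..n}. borel) \<Otimes>\<^sub>M borel)"
        using elim that P_ne[OF R[OF that]] by (intro sel_meas) (auto simp: \<H>_def)
      moreover have "W \<omega> \<in> space (\<Pi>\<^sub>M i\<in>{1..n}. borel)" by (simp add: W_def space_PiM)
      ultimately show ?thesis
        unfolding g_def[abs_def] using measurable_Pair2 by fastforce
    qed
    have "(\<integral>\<^sup>+x. ennreal (\<bar>?F \<omega> x - m x\<bar>\<^sup>2) \<partial>\<mu>)
        \<le> (\<integral>\<^sup>+x. (\<Sum>b=1..B. ennreal (1 / real B) * ennreal (\<bar>g b x - m x\<bar>\<^sup>2)) \<partial>\<mu>)"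
    proof (intro nn_integral_mono)
      fix x
      have "?F \<omega> x = 1 / real B * (\<Sum>b=1..B. g b x)"
        unfolding odrf_estimator_def using g by (intro arg_cong2[of _ _ _ _ "(*)"] refl sum.cong) auto
      then have "\<bar>?F \<omega> x - m x\<bar>\<^sup>2
          \<le> (\<Sum>b=1..B. 1 / real B * (g b x - m x)\<^sup>2)"
        using square_mean_le[OF B, of "\<lambda>b. g b x" "m x"] by simp
      then have "ennreal (\<bar>?F \<omega> x - m x\<bar>\<^sup>2)
          \<le> ennreal (\<Sum>b=1..B. 1 / real B * (g b x - m x)\<^sup>2)" by (rule ennreal_leI)
      also have "\<dots> = (\<Sum>b=1..B. ennreal (1 / real B) * ennreal (\<bar>g b x - m x\<bar>\<^sup>2))"
        by (subst sum_ennreal[symmetric]) (auto simp flip: ennreal_mult)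
      finally show "ennreal (\<bar>?F \<omega> x - m x\<bar>\<^sup>2)
          \<le> (\<Sum>b=1..B. ennreal (1 / real B) * ennreal (\<bar>g b x - m x\<bar>\<^sup>2))" .
    qed
    also have "\<dots> = (\<Sum>b=1..B. ennreal (1 / real B) * (\<integral>\<^sup>+x. ennreal (\<bar>g b x - m x\<bar>\<^sup>2) \<partial>\<mu>))"
      by (subst nn_integral_sum) (auto simp: \<mu>_def nn_integral_cmult)
    also have "\<dots> \<le> (\<Sum>b=1..B. ennreal (1 / real B) * T b \<omega>)"
    proof (intro sum_mono mult_left_mono)
      fix b assume b: "b \<in> {1..B}"
      have Hb: "G b \<omega> \<in> \<H>" using elim b by blast
      have finP: "finite (set_pmf P)" by (simp add: P_def set_Pi_pmf finite_PiE_dflt)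
      have "\<omega> \<in> E b (G b \<omega>) (R b)" using elim by (auto simp: E_def R_def)
      then have "(\<integral>\<^sup>+x. ennreal (\<bar>g b x - m x\<bar>\<^sup>2) \<partial>\<mu>) = indicator (E b (G b \<omega>) (R b)) \<omega> * \<Psi> (G b \<omega>) (R b) (W \<omega>)"
        by (simp add: \<Psi>_def g_def)
      also have "\<dots> \<le> (\<Sum>R\<in>set_pmf P. indicator (E b (G b \<omega>) R) \<omega> * \<Psi> (G b \<omega>) R (W \<omega>))"
        using R[OF b] finP
        by (intro member_le_sum[where f = "\<lambda>R. indicator (E b (G b \<omega>) R) \<omega> * \<Psi> (G b \<omega>) R (W \<omega>)"]) auto
      also have "\<dots> \<le> T b \<omega>"
        unfolding T_def using Hb finH
        by (intro member_le_sum[where f = "\<lambda>H. \<Sum>R\<in>set_pmf P. indicator (E b H R) \<omega> * \<Psi> H R (W \<omega>)"]) auto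
      finally show "(\<integral>\<^sup>+x. ennreal (\<bar>g b x - m x\<bar>\<^sup>2) \<partial>\<mu>) \<le> T b \<omega>" .
    qed auto
    finally show ?case .
  qed
  then have "(\<integral>\<^sup>+\<omega>. (\<integral>\<^sup>+x. ennreal (\<bar>?F \<omega> x - m x\<bar>\<^sup>2) \<partial>\<mu>) \<partial>M)
      \<le> (\<integral>\<^sup>+\<omega>. (\<Sum>b=1..B. ennreal (1 / real B) * T b \<omega>) \<partial>M)"
    by (rule nn_integral_mono_AE)
  also have "\<dots> = (\<Sum>b=1..B. ennreal (1 / real B) * (\<integral>\<^sup>+\<omega>. T b \<omega> \<partial>M))"
    using T(2) by (subst nn_integral_sum) (auto simp: nn_integral_cmult)
  also have "\<dots> \<le> (\<Sum>b=1..B. ennreal (1 / real B) * ennreal C)"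
    using T(1) by (intro sum_mono mult_left_mono) auto
  also have "\<dots> = (\<Sum>b=1..B. ennreal (1 / real B)) * ennreal C" by (simp only: sum_distrib_right)
  also have "(\<Sum>b=1..B. ennreal (1 / real B)) = 1" using B by (subst sum_ennreal) auto
  finally show ?thesis by (simp only: \<mu>_def C_def mult_1)
qed

theorem theorem4p1:
  fixes M :: "'a measure"
    and X :: "'a \<Rightarrow> real^'p::finite" and Y :: "'a \<Rightarrow> real" and m :: "real^'p \<Rightarrow> real"
    and Z :: "nat \<Rightarrow> 'a \<Rightarrow> (real^'p) \<times> real"
    and G :: "nat \<Rightarrow> nat \<Rightarrow> 'a \<Rightarrow> nat set"
    and S :: "nat \<Rightarrow> nat \<Rightarrow> nat \<Rightarrow> 'a \<Rightarrow> 'p set"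
    and sel :: "nat \<Rightarrow> 'p split_rule"
    and a t :: "nat \<Rightarrow> nat" and B :: nat and c :: real
  assumes prob_space: "prob_space M"
    and X_measurable: "X \<in> borel_measurable M"
    and Y_measurable: "Y \<in> borel_measurable M"
    and X_in_cube: "AE \<omega> in M. X \<omega> \<in> cbox 0 1"
    and m_measurable: "m \<in> borel_measurable borel"
    and m_regression:
      "AE \<omega> in M. m (X \<omega>) = real_cond_exp M (vimage_algebra (space M) X borel) Y \<omega>"
    and c_pos: "c > 0"
    and exp_moment: "integrable M (\<lambda>\<omega>. exp (c * (Y \<omega>)\<^sup>2))"
    and m_L2: "integrable M (\<lambda>\<omega>. (m (X \<omega>))\<^sup>2)"
    and Z_measurable: "\<And>i. i \<ge> 1 \<Longrightarrow> Z i \<in> borel_measurable M"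
    and Z_copy: "\<And>i. i \<ge> 1 \<Longrightarrow> distr M borel (Z i) = distr M borel (\<lambda>\<omega>. (X \<omega>, Y \<omega>))"
    and B_pos: "B \<ge> 1"
    and t_pos: "\<And>n. n \<ge> 1 \<Longrightarrow> 1 \<le> t n"
    and t_le_a: "\<And>n. n \<ge> 1 \<Longrightarrow> t n \<le> a n"
    and a_le_n: "\<And>n. n \<ge> 1 \<Longrightarrow> a n \<le> n"
    and G_measurable: "\<And>n b. n \<ge> 1 \<Longrightarrow> b \<in> {1..B} \<Longrightarrow> G n b \<in> measurable M (count_space UNIV)"
    and G_uniform: "\<And>n b. n \<ge> 1 \<Longrightarrow> b \<in> {1..B} \<Longrightarrow>
      distr M (count_space UNIV) (G n b)
        = measure_pmf (pmf_of_set {H. H \<subseteq> {1..n} \<and> card H = a n})"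
    and S_measurable: "\<And>n b \<tau>. n \<ge> 1 \<Longrightarrow> b \<in> {1..B} \<Longrightarrow> \<tau> \<in> {1..t n - 1} \<Longrightarrow>
      S n b \<tau> \<in> measurable M (count_space UNIV)"
    and S_law: "\<And>n b \<tau> F. n \<ge> 1 \<Longrightarrow> b \<in> {1..B} \<Longrightarrow> \<tau> \<in> {1..t n - 1} \<Longrightarrow> F \<noteq> {} \<Longrightarrow>
      measure M {\<omega> \<in> space M. S n b \<tau> \<omega> = F}
        = 1 / real CARD('p) * (1 / real (CARD('p) choose card F))"
    and independence: "\<And>n. n \<ge> 1 \<Longrightarrow>
      prob_space.indep_sets M (source_events M Z (G n) (S n)) (forest_sources n B (t n))"
    and sel_maximizer: "\<And>n \<tau> D H A F. \<lbrakk>n \<ge> 1; \<tau> \<in> {1..t n - 1}; H \<subseteq> {1..n}; card H = a n;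
      A \<subseteq> cbox 0 1; F \<noteq> {}; node_count D H A \<ge> 2\<rbrakk> \<Longrightarrow>
      split_maximizer D H A F (sel n \<tau> (restrict D H) H A F)"
    and sel_measurable: "\<And>n H R. \<lbrakk>n \<ge> 1; H \<subseteq> {1..n}; card H = a n;
      \<forall>\<tau>\<in>{1..t n - 1}. R \<tau> \<noteq> {}\<rbrakk> \<Longrightarrow>
      (\<lambda>(D, x). odt_estimator (sel n) D H R (t n) x)
        \<in> borel_measurable ((\<Pi>\<^sub>M i\<in>{1..n}. borel) \<Otimes>\<^sub>M borel)"
    and a_lim: "filterlim a at_top sequentially"
    and t_lim: "filterlim t at_top sequentially"
    and t_rate: "(\<lambda>n. real (t n)) \<in> o(\<lambda>n. real (a n) / ln (real (a n)) ^ 4)"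
  shows "(\<lambda>n. \<integral>\<^sup>+\<omega>. (\<integral>\<^sup>+x. ennreal (\<bar>odrf_estimator (sel n) (\<lambda>i. Z i \<omega>)
             (\<lambda>b. G n b \<omega>) (\<lambda>b \<tau>. S n b \<tau> \<omega>) (t n) B x - m x\<bar>\<^sup>2) \<partial>distr M borel X) \<partial>M)
           \<longlonglongrightarrow> 0"
proof -
  interpret prob_space M by (rule prob_space)
  define \<mu> where "\<mu> = distr M borel X"
  define risk where "risk n = (\<integral>\<^sup>+\<omega>. (\<integral>\<^sup>+x. ennreal (\<bar>odrf_estimator (sel n) (\<lambda>i. Z i \<omega>)
             (\<lambda>b. G n b \<omega>) (\<lambda>b \<tau>. S n b \<tau> \<omega>) (t n) B x - m x\<bar>\<^sup>2) \<partial>distr M borel X) \<partial>M)" for n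
  define K where "K = (\<integral>\<omega>. exp (c * (Y \<omega>)\<^sup>2) \<partial>M)"
  have "(\<integral>\<omega>. 1 \<partial>M) \<le> K" unfolding K_def using exp_moment c_pos by (intro integral_mono) auto
  then have K: "K > 0" by (simp add: prob_space)
  interpret \<mu>: ridge_density \<mu> "cbox 0 1"
  proof (intro ridge_density.intro ridge_density_axioms.intro)
    show "prob_space \<mu>" unfolding \<mu>_def by (rule prob_space_distr[OF X_measurable])
    show "AE x in \<mu>. x \<in> cbox 0 1"
      unfolding \<mu>_def using X_in_cube by (subst AE_distr_iff[OF X_measurable]) auto
  qed (auto simp: \<mu>_def)
  have L2: "(\<integral>\<^sup>+x. ennreal ((m x)\<^sup>2) \<partial>\<mu>) < \<infinity>"
  proof -
    have "(\<integral>\<^sup>+x. ennreal ((m x)\<^sup>2) \<partial>\<mu>) = (\<integral>\<^sup>+\<omega>. ennreal ((m (X \<omega>))\<^sup>2) \<partial>M)"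
      unfolding \<mu>_def using m_measurable by (intro nn_integral_distr[OF X_measurable]) auto
    also have "\<dots> < \<infinity>" using m_L2 by (simp add: nn_integral_eq_integral)
    finally show ?thesis .
  qed
  have small: "\<forall>\<^sub>F n in sequentially. risk n \<le> ennreal \<epsilon>" if \<epsilon>: "\<epsilon> > 0" for \<epsilon>
  proof -
    \<comment> \<open>Each of the four error terms gets \<open>\<epsilon> / 4\<close>. The order of
      choice is \<open>f\<close>, then \<open>V\<close> and \<open>\<eta>\<close>, then
      \<open>L\<close>, and finally \<open>n\<close>, because the descent term is proportional to
      \<open>V\<^sup>2 / (\<eta> * L)\<close>.\<close>
    obtain f where f: "unit_ridge_step f" "(\<integral>\<^sup>+x. ennreal ((f x - m x)\<^sup>2) \<partial>\<mu>) \<le> ennreal (\<epsilon> / 4)"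
      using \<mu>.approximable_square_integrable[OF m_measurable L2] \<epsilon>
      unfolding \<mu>.approximable_def by (meson divide_pos_pos zero_less_numeral)
    obtain c0 ps where ps: "\<forall>(c, \<theta>, s)\<in>set ps. norm \<theta> = 1" "f = ridge_step c0 ps"
      using f(1) unfolding unit_ridge_step_def by blast
    have f_meas: "f \<in> borel_measurable borel" by (rule unit_ridge_step_measurable[OF f(1)])
    have approx: "(\<integral>\<omega>. (f (X \<omega>) - m (X \<omega>))\<^sup>2 \<partial>M) \<le> \<epsilon> / 4"
    proof (rule integral_real_bounded)
      have "(\<integral>\<^sup>+\<omega>. ennreal ((f (X \<omega>) - m (X \<omega>))\<^sup>2) \<partial>M) = (\<integral>\<^sup>+x. ennreal ((f x - m x)\<^sup>2) \<partial>\<mu>)"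
        unfolding \<mu>_def using m_measurable f_meas by (intro nn_integral_distr[OF X_measurable, symmetric]) auto
      then show "(\<integral>\<^sup>+\<omega>. ennreal ((f (X \<omega>) - m (X \<omega>))\<^sup>2) \<partial>M) \<le> ennreal (\<epsilon> / 4)" using f(2) by simp
    qed (use \<epsilon> in simp)
    \<comment> \<open>The summand \<open>1\<close> keeps \<open>V\<close> positive when
      \<open>ps\<close> is empty or has zero coefficients.\<close>
    define V where "V = (\<Sum>(c, \<theta>, s)\<leftarrow>ps. \<bar>c\<bar>) + 1"
    have V: "(\<Sum>(c, \<theta>, s)\<leftarrow>ps. \<bar>c\<bar>) \<le> V" "V > 0"
    proof -
      have "0 \<le> (\<Sum>(c, \<theta>, s)\<leftarrow>ps. \<bar>c\<bar>)" by (intro sum_list_nonneg) auto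
      then show "V > 0" by (simp add: V_def)
    qed (simp add: V_def)
    define \<eta> where "\<eta> = \<epsilon> / 4"
    have \<eta>: "\<eta> > 0" using \<epsilon> by (simp add: \<eta>_def)
    define k where "k = V\<^sup>2 / (4 * \<eta> * (1 / real CARD('p))) * (\<integral>\<omega>. (Y \<omega>)\<^sup>2 \<partial>M)"
    have k: "k \<ge> 0" using \<eta> by (simp add: k_def)
    obtain L :: nat where "4 * k / \<epsilon> + 1 < real L" using reals_Archimedean2 by blast
    moreover have "0 \<le> 4 * k / \<epsilon>" using k \<epsilon> by simp
    ultimately have L: "L > 0" "4 * k / \<epsilon> \<le> real L" by (auto intro: Nat.gr0I)
    then have kL: "k / real L \<le> \<epsilon> / 4" using \<epsilon> by (simp add: field_simps)
    have "\<forall>\<^sub>F n in sequentially. 2 ^ L \<le> t n" using t_lim by (auto simp: filterlim_at_top)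
    moreover have "\<forall>\<^sub>F n in sequentially. n \<ge> 1" by (rule eventually_ge_at_top)
    moreover have "\<forall>\<^sub>F n in sequentially. 6 * ((ln (2 * real (a n) * K) + 1) / c)
        * sqrt (2 * real (a n) * ln (tree_class_bound CARD('p) (a n) (t n))) / real (a n) \<le> \<epsilon> / 4"
      using eventually_deviation_small[OF a_lim t_pos t_le_a t_rate c_pos K, of "\<epsilon> / 4"] \<epsilon> by simp
    ultimately show ?thesis
    proof eventually_elim
      case (elim n)
      note n = elim(2)
      have "risk n \<le> ennreal ((\<integral>\<omega>. (f (X \<omega>) - m (X \<omega>))\<^sup>2 \<partial>M) + \<eta>
        + V\<^sup>2 / (4 * \<eta> * (1 / real CARD('p)) * real L) * (\<integral>\<omega>. (Y \<omega>)\<^sup>2 \<partial>M)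
        + 6 * ((ln (2 * real (a n) * K) + 1) / c) * sqrt (2 * real (a n) * ln (tree_class_bound CARD('p) (a n) (t n))) / real (a n))"
        unfolding risk_def K_def
      proof (rule forest_risk_le[OF X_measurable Y_measurable X_in_cube m_measurable m_regression c_pos exp_moment m_L2
            _ _ B_pos t_pos[OF n] t_le_a[OF n] a_le_n[OF n] G_measurable[OF n] G_uniform[OF n] S_measurable[OF n]
            S_law[OF n] independence[OF n] _ _ ps(2) _ V elim(1) L(1) \<eta>])
        show "split_maximizer D H A F (sel n \<tau> (restrict D H) H A F)"
          if "\<tau> \<in> {1..t n - 1}" "H \<subseteq> {1..n}" "card H = a n" "A \<subseteq> cbox 0 1" "F \<noteq> {}" "2 \<le> node_count D H A"
          for \<tau> D H A F
          by (rule sel_maximizer[OF n that])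
        show "(\<lambda>(D, x). odt_estimator (sel n) D H R (t n) x) \<in> borel_measurable ((\<Pi>\<^sub>M i\<in>{1..n}. borel) \<Otimes>\<^sub>M borel)"
          if "H \<subseteq> {1..n}" "card H = a n" "\<forall>\<tau>\<in>{1..t n - 1}. R \<tau> \<noteq> {}" for H R
          by (rule sel_measurable[OF n that])
      qed (use Z_measurable Z_copy ps(1) in auto)
      also have "V\<^sup>2 / (4 * \<eta> * (1 / real CARD('p)) * real L) * (\<integral>\<omega>. (Y \<omega>)\<^sup>2 \<partial>M) = k / real L"
        by (simp add: k_def)
      also have "ennreal ((\<integral>\<omega>. (f (X \<omega>) - m (X \<omega>))\<^sup>2 \<partial>M) + \<eta> + k / real L
        + 6 * ((ln (2 * real (a n) * K) + 1) / c) * sqrt (2 * real (a n) * ln (tree_class_bound CARD('p) (a n) (t n))) / real (a n))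
        \<le> ennreal \<epsilon>"
        using approx kL elim(3) \<eta>_def by (intro ennreal_leI) linarith
      finally show ?case .
    qed
  qed
  have "risk \<longlonglongrightarrow> 0"
  proof (rule order_tendstoI)
    \<comment> \<open>\<open>small\<close> speaks of real bounds, whereas \<open>e\<close> may be
      infinite; a finite number strictly between \<open>0\<close> and \<open>e\<close>
      serves.\<close>
    fix e :: ennreal assume "0 < e"
    then obtain r where r: "0 < r" "r < e" using dense by blast
    then have "r < top" by (simp add: less_top order.strict_trans2[OF r(2)])
    then have r': "r = ennreal (enn2real r)" "enn2real r > 0" using r(1) by (auto simp: enn2real_positive_iff)
    show "\<forall>\<^sub>F n in sequentially. risk n < e"
      using small[OF r'(2)] by eventually_elim (use r(2) r'(1) in \<open>auto intro: le_less_trans\<close>)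
  qed simp
  then show ?thesis by (simp only: risk_def[abs_def])
qed

end
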